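(* Let $n\ge 1$, let $B(t)=(B^1(t),\dots,B^n(t))^\tau$ be an $n$-dimensional Brownian motion, let $C=(C^i_j)$ be an $n\times n$ matrix-valued measurable function on $[0,\infty)$ whose entries are locally square-integrable, let $f=(f^1,\dots,f^n)^\tau:[0,\infty)\times\mathbb{R}^n\to\mathbb{R}^n$ be measurable, and let $x=(x^1,\dots,x^n)^\tau\in\mathbb{R}^n$. Consider the stochastic differential equation $$dX^i(t)=f^i(t,X(t))\,dt+\sum_{j=1}^n C^i_j(t)X^j(t)\,dB^j(t),\qquad X^i(0)=x^i,\qquad i=1,\dots,n. \tag{A}$$ Let $U=(U^i_j)$ be the $n\times n$ matrix-valued solution of the linear stochastic differential equation $$dU^i_j(t)=\sum_{k=1}^n C^i_k(t)U^k_j(t)\,dB^k(t),\qquad U^i_j(0)=\delta^i_j,\qquad i,j=1,\dots,n.$$ If $X$ is a solution of (A), then $$X(t)=U(t)\Bigl\{x+\int_0^t U(s)^{-1}f(s,X(s))\,ds\Bigr\},\qquad t\ge 0,$$ and $Y(t)=U(t)^{-1}X(t)$ satisfies the random differential equation (in integral form) $$Y(t)=x+\int_0^t U(s)^{-1}f(s,U(s)Y(s))\,ds,\qquad t\ge 0. \tag{B}$$ Conversely, if $Y$ is an adapted continuous process whose sample paths satisfy (B), then $X(t)=U(t)Y(t)$ is a solution of (A).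
   Context: All processes are defined on a standard stochastic basis $(\Omega,\mathcal{F},(\mathcal{F}_t)_{t\ge0},\mathbf{P})$ (filtered probability space satisfying the usual conditions), and $B$ is a Brownian motion with respect to $(\mathcal{F}_t)$. Stochastic integrals are Itô integrals. A solution of (A) is an adapted continuous $\mathbb{R}^n$-valued process $X$ such that $\int_0^t|f(s,X(s))|\,ds<\infty$ almost surely for all $t\ge 0$ and such that the integral form of (A) holds for all $t\ge 0$ almost surely. Similarly, $Y$ satisfying (B) includes that $\int_0^t|U(s)^{-1}f(s,U(s)Y(s))|\,ds<\infty$ almost surely for all $t\ge 0$. $\delta^i_j$ is the Kronecker delta, $\tau$ denotes transpose, and $U(t)^{-1}$ is the matrix inverse of $U(t)$; $U$ is the stochastic exponential of the continuous matrix-valued martingale $L$ with entries $L^i_j(t)=\int_0^t C^i_j(s)\,dB^j(s)$ and is invertible for all $t$ almost surely. Equalities of processes hold up to indistinguishability. *)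

theory Defs
  imports "HOL-Probability.Probability"
begin

section \<open>Stochastic basis and Brownian motion\<close>

text \<open>Time is \<open>[0,\<infinity>)\<close>; processes and filtrations are indexed by \<^typ>\<open>real\<close>, and their values at
  negative times are irrelevant throughout.\<close>

locale stochastic_basis = prob_space M + complete_measure M
  for M :: "'a measure" +
  fixes F :: "real \<Rightarrow> 'a measure"
  assumes subalgebra_F: "0 \<le> t \<Longrightarrow> subalgebra M (F t)"
    and F_mono: "0 \<le> s \<Longrightarrow> s \<le> t \<Longrightarrow> sets (F s) \<subseteq> sets (F t)"
    and F_right_continuous: "0 \<le> t \<Longrightarrow> sets (F t) = (\<Inter>u\<in>{t<..}. sets (F u))"
    and F_null_sets: "null_sets M \<subseteq> sets (F 0)"

text \<open>Continuity of paths is only required almost surely, so that the notions below are invariant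
  under indistinguishability.\<close>

definition adapted_continuous ::
    "'a measure \<Rightarrow> (real \<Rightarrow> 'a measure) \<Rightarrow> (real \<Rightarrow> 'a \<Rightarrow> 'b::topological_space) \<Rightarrow> bool" where
  "adapted_continuous M F Z \<longleftrightarrow>
     (\<forall>t\<ge>0. Z t \<in> borel_measurable (F t)) \<and>
     (AE \<omega> in M. continuous_on {0..} (\<lambda>t. Z t \<omega>))"

locale brownian_motion = stochastic_basis M F
  for M :: "'a measure" and F :: "real \<Rightarrow> 'a measure" +
  fixes B :: "real \<Rightarrow> 'a \<Rightarrow> real ^ 'n"
  assumes B_adapted_continuous: "adapted_continuous M F B"
    and B_zero: "AE \<omega> in M. B 0 \<omega> = 0"
    and B_indep_past: "0 \<le> s \<Longrightarrow> s < t \<Longrightarrow>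
      indep_set (sets (F s)) {(\<lambda>\<omega>. B t \<omega> - B s \<omega>) -` A \<inter> space M | A. A \<in> sets borel}"
    and B_indep_components: "0 \<le> s \<Longrightarrow> s < t \<Longrightarrow>
      indep_vars (\<lambda>_. borel) (\<lambda>i \<omega>. B t \<omega> $ i - B s \<omega> $ i) UNIV"
    and B_normal: "0 \<le> s \<Longrightarrow> s < t \<Longrightarrow>
      distributed M lborel (\<lambda>\<omega>. B t \<omega> $ i - B s \<omega> $ i)
        (\<lambda>u. ennreal (normal_density 0 (sqrt (t - s)) u))"

section \<open>Ito integral\<close>

text \<open>A simple process \<open>\<Sum>k<m. \<xi> k * indicator {\<tau> k<..\<tau> (Suc k)}\<close> with deterministic times and bounded
  \<open>F (\<tau> k)\<close>-measurable coefficients, and its integral with respect to a real process \<open>W\<close>.\<close>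

definition simple_process ::
    "(real \<Rightarrow> 'a measure) \<Rightarrow> nat \<Rightarrow> (nat \<Rightarrow> real) \<Rightarrow> (nat \<Rightarrow> 'a \<Rightarrow> real) \<Rightarrow> bool" where
  "simple_process F m \<tau> \<xi> \<longleftrightarrow>
     0 \<le> \<tau> 0 \<and> (\<forall>k<m. \<tau> k \<le> \<tau> (Suc k)) \<and>
     (\<forall>k<m. \<xi> k \<in> borel_measurable (F (\<tau> k)) \<and> bounded (\<xi> k ` space (F (\<tau> k))))"

definition simple_value ::
    "nat \<Rightarrow> (nat \<Rightarrow> real) \<Rightarrow> (nat \<Rightarrow> 'a \<Rightarrow> real) \<Rightarrow> real \<Rightarrow> 'a \<Rightarrow> real" where
  "simple_value m \<tau> \<xi> s \<omega> = (\<Sum>k<m. \<xi> k \<omega> * indicator {\<tau> k<..\<tau> (Suc k)} s)"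

definition simple_integral_wrt ::
    "(real \<Rightarrow> 'a \<Rightarrow> real) \<Rightarrow> nat \<Rightarrow> (nat \<Rightarrow> real) \<Rightarrow> (nat \<Rightarrow> 'a \<Rightarrow> real) \<Rightarrow> real \<Rightarrow> 'a \<Rightarrow> real" where
  "simple_integral_wrt W m \<tau> \<xi> t \<omega> =
     (\<Sum>k<m. \<xi> k \<omega> * (W (min (\<tau> (Suc k)) t) \<omega> - W (min (\<tau> k) t) \<omega>))"

definition tendsto_zero_in_probability :: "'a measure \<Rightarrow> (nat \<Rightarrow> 'a \<Rightarrow> real) \<Rightarrow> bool" where
  "tendsto_zero_in_probability M R \<longleftrightarrow>
     (\<forall>k. R k \<in> borel_measurable M) \<and>
     (\<forall>\<epsilon>>0. (\<lambda>k. measure M {\<omega> \<in> space M. \<epsilon> < \<bar>R k \<omega>\<bar>}) \<longlonglongrightarrow> 0)"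

text \<open>\<open>has_ito_integral M F W H Z\<close>: the process \<open>Z t = \<integral>\<^sub>0\<^sup>t H s dW s\<close> is the Ito integral of \<open>H\<close> with
  respect to the one-dimensional Brownian motion \<open>W\<close>. The integrand has almost surely locally
  square-integrable paths, and \<open>Z\<close> is the adapted continuous process that is at each time the limit
  in probability of the integrals of simple processes \<open>G\<close> with \<open>\<integral>\<^sub>0\<^sup>t (G s - H s)\<^sup>2 ds \<rightarrow> 0\<close> in
  probability. The existence of such an approximation replaces the requirement that \<open>H\<close> be (up to
  a \<open>ds \<otimes> P\<close>-null set) progressively measurable. \<open>Z\<close> is unique up to indistinguishability and
  depends neither on the approximating sequence nor on modifications of \<open>H\<close> on a null set of
  paths. Path measurability is demanded explicitly because integrability of the square of \<open>H\<close>
  does not imply it and the Bochner integral of a non-measurable function is zero.\<close>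

definition has_ito_integral ::
    "'a measure \<Rightarrow> (real \<Rightarrow> 'a measure) \<Rightarrow> (real \<Rightarrow> 'a \<Rightarrow> real) \<Rightarrow> (real \<Rightarrow> 'a \<Rightarrow> real) \<Rightarrow>
     (real \<Rightarrow> 'a \<Rightarrow> real) \<Rightarrow> bool" where
  "has_ito_integral M F W H Z \<longleftrightarrow>
     (AE \<omega> in M. \<forall>t\<ge>0. set_borel_measurable lborel {0..t} (\<lambda>s. H s \<omega>) \<and>
                       set_integrable lborel {0..t} (\<lambda>s. (H s \<omega>)\<^sup>2)) \<and>
     adapted_continuous M F Z \<and>
     (\<exists>m \<tau> \<xi>. (\<forall>k. simple_process F (m k) (\<tau> k) (\<xi> k)) \<and>
        (\<forall>t\<ge>0.
           tendsto_zero_in_probability M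
             (\<lambda>k \<omega>. LBINT s:{0..t}. (simple_value (m k) (\<tau> k) (\<xi> k) s \<omega> - H s \<omega>)\<^sup>2) \<and>
           tendsto_zero_in_probability M
             (\<lambda>k \<omega>. simple_integral_wrt W (m k) (\<tau> k) (\<xi> k) t \<omega> - Z t \<omega>)))"

section \<open>The differential equations\<close>

text \<open>The real process \<open>Z\<close> satisfies \<open>dZ = b dt + \<Sum>j. \<sigma> j dB j\<close>, \<open>Z 0 = z\<close>, in integral form.\<close>

definition has_ito_differential ::
    "'a measure \<Rightarrow> (real \<Rightarrow> 'a measure) \<Rightarrow> (real \<Rightarrow> 'a \<Rightarrow> real ^ 'n) \<Rightarrow> (real \<Rightarrow> 'a \<Rightarrow> real) \<Rightarrow>
     real \<Rightarrow> (real \<Rightarrow> 'a \<Rightarrow> real) \<Rightarrow> ('n \<Rightarrow> real \<Rightarrow> 'a \<Rightarrow> real) \<Rightarrow> bool" where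
  "has_ito_differential M F B Z z b \<sigma> \<longleftrightarrow>
     (AE \<omega> in M. \<forall>t\<ge>0. set_integrable lborel {0..t} (\<lambda>s. b s \<omega>)) \<and>
     (\<exists>I. (\<forall>j. has_ito_integral M F (\<lambda>t \<omega>. B t \<omega> $ j) (\<sigma> j) (I j)) \<and>
        (AE \<omega> in M. \<forall>t\<ge>0.
           Z t \<omega> = z + (LBINT s:{0..t}. b s \<omega>) + (\<Sum>j\<in>UNIV. I j t \<omega>)))"

definition solves_sde ::
    "'a measure \<Rightarrow> (real \<Rightarrow> 'a measure) \<Rightarrow> (real \<Rightarrow> 'a \<Rightarrow> real ^ 'n) \<Rightarrow> (real \<Rightarrow> real ^ 'n ^ 'n) \<Rightarrow>
     (real \<Rightarrow> real ^ 'n \<Rightarrow> real ^ 'n) \<Rightarrow> real ^ 'n \<Rightarrow> (real \<Rightarrow> 'a \<Rightarrow> real ^ 'n) \<Rightarrow> bool" where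
  "solves_sde M F B C f x X \<longleftrightarrow>
     adapted_continuous M F X \<and>
     (\<forall>i. has_ito_differential M F B (\<lambda>t \<omega>. X t \<omega> $ i) (x $ i)
            (\<lambda>s \<omega>. f s (X s \<omega>) $ i) (\<lambda>j s \<omega>. C s $ i $ j * X s \<omega> $ j))"

definition solves_linear_matrix_sde ::
    "'a measure \<Rightarrow> (real \<Rightarrow> 'a measure) \<Rightarrow> (real \<Rightarrow> 'a \<Rightarrow> real ^ 'n) \<Rightarrow> (real \<Rightarrow> real ^ 'n ^ 'n) \<Rightarrow>
     (real \<Rightarrow> 'a \<Rightarrow> real ^ 'n ^ 'n) \<Rightarrow> bool" where
  "solves_linear_matrix_sde M F B C U \<longleftrightarrow>
     adapted_continuous M F U \<and>
     (\<forall>i j. has_ito_differential M F B (\<lambda>t \<omega>. U t \<omega> $ i $ j) (if i = j then 1 else 0)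
              (\<lambda>s \<omega>. 0) (\<lambda>k s \<omega>. C s $ i $ k * U s \<omega> $ k $ j))"

definition satisfies_random_de ::
    "'a measure \<Rightarrow> (real \<Rightarrow> 'a \<Rightarrow> real ^ 'n ^ 'n) \<Rightarrow> (real \<Rightarrow> real ^ 'n \<Rightarrow> real ^ 'n) \<Rightarrow> real ^ 'n \<Rightarrow>
     (real \<Rightarrow> 'a \<Rightarrow> real ^ 'n) \<Rightarrow> bool" where
  "satisfies_random_de M U f x Y \<longleftrightarrow>
     (AE \<omega> in M. \<forall>t\<ge>0.
        set_integrable lborel {0..t} (\<lambda>s. matrix_inv (U s \<omega>) *v f s (U s \<omega> *v Y s \<omega>)) \<and>
        Y t \<omega> = x + (LBINT s:{0..t}. matrix_inv (U s \<omega>) *v f s (U s \<omega> *v Y s \<omega>)))"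

end

theory Submission
  imports Defs
begin

text \<open>
  The proof avoids Ito's formula and stopping times. Everything about the Ito integral \<open>I\<close> of \<open>H\<close> comes
  from the exponential supermartingale: it bounds the probability that \<open>|I t|\<close> exceeds \<open>d\<close> while
  \<open>\<integral>\<^sub>0\<^sup>t H\<^sup>2\<close> stays below \<open>S\<close> by a multiple of \<open>S\<^sup>2 / d\<^sup>4\<close>.

  Invertibility of \<open>U\<close>: the matrix \<open>U t (U a)\<^sup>-\<^sup>1\<close> leaves a neighbourhood of the identity during \<open>[a, b]\<close> with
  probability at most a multiple of the square of \<open>\<eta> = \<integral>\<^sub>a\<^sup>b |C|\<^sup>2\<close>. As \<open>C\<close> is deterministic, these bounds
  sum to something arbitrarily small over a fine partition.

  Uniqueness: if \<open>Z\<close> solves the homogeneous equation with \<open>Z 0 = 0\<close>, then adding a multiple of \<open>Z\<close> to a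
  column of \<open>U\<close> gives another fundamental matrix, and one of them would be singular at some time if \<open>Z\<close> did
  not vanish identically.

  With \<open>N t = x + \<integral>\<^sub>0\<^sup>t U\<^sup>-\<^sup>1 f\<close>, a process of finite variation, integration by parts shows that \<open>U N\<close> has drift
  \<open>f\<close> and the noise of the equation. This is the converse direction, and for a solution \<open>X\<close> the difference
  \<open>X - U N\<close> solves the homogeneous equation.
\<close>

text \<open>An Ito integral is given here only through simple processes converging in probability at
  each fixed time. The textbook proof differentiates \<open>U\<^sup>-\<^sup>1\<close> by Ito's
  formula, which needs covariations and localisation. Both are avoidable: the only integration by
  parts has a factor of finite variation, and a process is stopped only on a grid, by multiplying
  its increments by indicators known at the left end points.

  The order of the tail bound is decisive. Chebyshev's inequality and the Ito isometry give a bound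
  linear in \<open>S\<close>; summed over a partition it yields the total of
  \<open>|C|\<^sup>2\<close>, which does not shrink. Squares sum to at most the largest cell times
  that total. The total must be a number, not a random variable, and this is where a deterministic
  \<open>C\<close> enters.

  For a given solution \<open>X\<close> the process \<open>N\<close> has to be shown adapted. The
  integral of \<open>f s (X s)\<close> is adapted because the equation expresses it by
  \<open>X\<close> and Ito integrals; Riemann-Stieltjes sums carry this over to the integral with
  the factor \<open>U\<^sup>-\<^sup>1\<close>.\<close>

subsection \<open>Completeness of the filtration\<close>

context stochastic_basis
begin

lemma space_F: "0 \<le> t \<Longrightarrow> space (F t) = space M"
  using subalgebra_F by (auto simp: subalgebra_def)

lemma sets_F: "0 \<le> t \<Longrightarrow> A \<in> sets (F t) \<Longrightarrow> A \<in> sets M"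
  using subalgebra_F by (auto simp: subalgebra_def)

lemma measurable_F_M: "0 \<le> t \<Longrightarrow> g \<in> F t \<rightarrow>\<^sub>M N \<Longrightarrow> g \<in> M \<rightarrow>\<^sub>M N"
  using subalgebra_F measurable_from_subalg by blast

lemma measurable_F_mono:
  assumes "g \<in> F s \<rightarrow>\<^sub>M N" "0 \<le> s" "s \<le> t"
  shows "g \<in> F t \<rightarrow>\<^sub>M N"
  using assms F_mono[of s t] by (auto simp: measurable_def space_F)

lemma null_sets_F: "0 \<le> t \<Longrightarrow> A \<in> null_sets M \<Longrightarrow> A \<in> sets (F t)"
  using F_null_sets F_mono[of 0 t] by auto

text \<open>Completeness makes the set where the two maps differ, and each of its subsets, a null
  set of \<open>M\<close>; the usual conditions put all null sets into \<open>F t\<close>. This is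
  how adaptedness survives changes on null sets.\<close>

lemma measurable_F_AE_eq:
  assumes t: "0 \<le> t" and g: "g \<in> F t \<rightarrow>\<^sub>M N" and eq: "AE \<omega> in M. g \<omega> = h \<omega>"
    and h: "\<And>\<omega>. \<omega> \<in> space M \<Longrightarrow> h \<omega> \<in> space N"
  shows "h \<in> F t \<rightarrow>\<^sub>M N"
proof (rule measurableI)
  fix A assume A: "A \<in> sets N"
  let ?g = "g -` A \<inter> space M" and ?h = "h -` A \<inter> space M"
  have "{\<omega> \<in> space M. g \<omega> \<noteq> h \<omega>} \<in> null_sets M"
    using eq by (simp add: AE_iff_null_sets)
  then have null: "?h - ?g \<in> null_sets M" "?g - ?h \<in> null_sets M"
    by (auto elim!: complete2[rotated])
  have "?g \<in> sets (F t)"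
    using measurable_sets[OF g A] t by (simp add: space_F)
  then have "?g \<union> (?h - ?g) - (?g - ?h) \<in> sets (F t)"
    using null_sets_F[OF t null(1)] null_sets_F[OF t null(2)] by blast
  moreover have "?g \<union> (?h - ?g) - (?g - ?h) = ?h" by auto
  ultimately show "h -` A \<inter> space (F t) \<in> sets (F t)" using t by (simp add: space_F)
qed (use t h space_F in auto)

lemma measurable_AE_eq:
  assumes g: "g \<in> M \<rightarrow>\<^sub>M N" and eq: "AE \<omega> in M. g \<omega> = h \<omega>"
    and h: "\<And>\<omega>. \<omega> \<in> space M \<Longrightarrow> h \<omega> \<in> space N"
  shows "h \<in> M \<rightarrow>\<^sub>M N"
proof (rule measurableI)
  fix A assume A: "A \<in> sets N"
  have "g -` A \<inter> space M \<in> sets M" using measurable_sets[OF g A] .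
  moreover have "AE \<omega> in M. \<omega> \<in> g -` A \<inter> space M \<longleftrightarrow> \<omega> \<in> h -` A \<inter> space M"
    using eq by eventually_elim auto
  ultimately show "h -` A \<inter> space M \<in> sets M" using in_sets_AE[of "g -` A \<inter> space M" "h -` A \<inter> space M"] by auto
qed (use h in auto)

lemma measurable_F_AE_LIMSEQ:
  fixes u :: "nat \<Rightarrow> 'a \<Rightarrow> real"
  assumes t: "0 \<le> t" and u: "\<And>n. u n \<in> borel_measurable (F t)"
    and lim: "AE \<omega> in M. (\<lambda>n. u n \<omega>) \<longlonglongrightarrow> g \<omega>"
  shows "g \<in> borel_measurable (F t)"
proof (rule measurable_F_AE_eq[OF t])
  \<comment> \<open>Where the sequence diverges, \<open>lim\<close> has an unspecified value, but
    this happens only on a null set.\<close>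
  show "(\<lambda>\<omega>. lim (\<lambda>n. u n \<omega>)) \<in> borel_measurable (F t)"
    using u by measurable
  show "AE \<omega> in M. lim (\<lambda>n. u n \<omega>) = g \<omega>"
    using lim by eventually_elim (rule limI)
qed auto

end

subsection \<open>Convergence in probability\<close>

context prob_space
begin

abbreviation tzip :: "(nat \<Rightarrow> 'a \<Rightarrow> real) \<Rightarrow> bool" where
  "tzip \<equiv> tendsto_zero_in_probability M"

lemma integrable_min_1_abs:
  assumes "R \<in> borel_measurable M"
  shows "integrable M (\<lambda>\<omega>. min 1 \<bar>R \<omega> :: real\<bar>)"
  by (rule integrable_const_bound[where B=1]) (use assms in auto)

lemma prob_gt_le_expectation:
  assumes R: "R \<in> borel_measurable M" and e: "0 < e"
  shows "prob {\<omega> \<in> space M. e < \<bar>R \<omega>\<bar>} \<le> expectation (\<lambda>\<omega>. min 1 \<bar>R \<omega>\<bar>) / min 1 e"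
proof -
  have "prob {\<omega> \<in> space M. e < \<bar>R \<omega>\<bar>} \<le> prob {\<omega> \<in> space M. min 1 \<bar>R \<omega>\<bar> \<ge> min 1 e}"
    by (rule finite_measure_mono) (use R in auto)
  also have "\<dots> \<le> expectation (\<lambda>\<omega>. min 1 \<bar>R \<omega>\<bar>) / min 1 e"
    by (rule integral_Markov_inequality_measure[where A="{}"]) (use e in \<open>auto intro!: integrable_min_1_abs R\<close>)
  finally show ?thesis .
qed

lemma expectation_min_le:
  assumes R: "R \<in> borel_measurable M" and e: "0 < e"
  shows "expectation (\<lambda>\<omega>. min 1 \<bar>R \<omega>\<bar>) \<le> e + prob {\<omega> \<in> space M. e < \<bar>R \<omega>\<bar>}"
proof -
  have m: "{\<omega> \<in> space M. e < \<bar>R \<omega>\<bar>} \<in> sets M" using R by auto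
  have i: "integrable M (indicator {\<omega> \<in> space M. e < \<bar>R \<omega>\<bar>} :: _ \<Rightarrow> real)"
    by (rule integrable_real_indicator[OF m]) (simp add: less_top[symmetric])
  have "expectation (\<lambda>\<omega>. min 1 \<bar>R \<omega>\<bar>) \<le> expectation (\<lambda>\<omega>. e + indicator {\<omega> \<in> space M. e < \<bar>R \<omega>\<bar>} \<omega>)"
    by (rule integral_mono)
      (use i e in \<open>auto intro!: integrable_min_1_abs R Bochner_Integration.integrable_add split: split_indicator\<close>)
  also have "\<dots> = e + prob {\<omega> \<in> space M. e < \<bar>R \<omega>\<bar>}"
    using m i by (subst Bochner_Integration.integral_add) (auto simp: prob_space)
  finally show ?thesis .
qed

text \<open>The truncated mean metrises convergence in probability. Comparison becomes a sandwich
  argument on real sequences, almost sure subsequences come from convergence in mean, and diagonal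
  sequences can be chosen by a single number, as in \<open>ito_closed\<close>.\<close>

lemma tendsto_zero_in_probability_iff:
  assumes R: "\<And>k. R k \<in> borel_measurable M"
  shows "tzip R \<longleftrightarrow> (\<lambda>k. expectation (\<lambda>\<omega>. min 1 \<bar>R k \<omega>\<bar>)) \<longlonglongrightarrow> 0"
    (is "?L \<longleftrightarrow> ?R")
proof
  assume L: ?L
  show ?R
  proof (rule LIMSEQ_I)
    fix r :: real assume r: "0 < r"
    have "(\<lambda>k. prob {\<omega> \<in> space M. r/2 < \<bar>R k \<omega>\<bar>}) \<longlonglongrightarrow> 0"
      using L half_gt_zero[OF r] unfolding tendsto_zero_in_probability_def by blast
    then have "eventually (\<lambda>k. prob {\<omega> \<in> space M. r/2 < \<bar>R k \<omega>\<bar>} < r/2) sequentially"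
      using r by (intro order_tendstoD) auto
    then obtain N where N: "\<And>k. k \<ge> N \<Longrightarrow> prob {\<omega> \<in> space M. r/2 < \<bar>R k \<omega>\<bar>} < r/2"
      by (auto simp: eventually_sequentially)
    have "norm (expectation (\<lambda>\<omega>. min 1 \<bar>R k \<omega>\<bar>) - 0) < r" if "k \<ge> N" for k
    proof -
      have "0 \<le> expectation (\<lambda>\<omega>. min 1 \<bar>R k \<omega>\<bar>)" by (rule Bochner_Integration.integral_nonneg) auto
      then show ?thesis using expectation_min_le[OF R, of "r/2" k] N[OF that] r by auto
    qed
    then show "\<exists>no. \<forall>n\<ge>no. norm (expectation (\<lambda>\<omega>. min 1 \<bar>R n \<omega>\<bar>) - 0) < r" by blast
  qed
next
  assume r: ?R
  show ?L unfolding tendsto_zero_in_probability_def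
  proof (intro conjI allI impI R)
    fix e :: real assume e: "0 < e"
    show "(\<lambda>k. prob {\<omega> \<in> space M. e < \<bar>R k \<omega>\<bar>}) \<longlonglongrightarrow> 0"
    proof (rule tendsto_sandwich[where f="\<lambda>_. 0"])
      show "(\<lambda>k. expectation (\<lambda>\<omega>. min 1 \<bar>R k \<omega>\<bar>) / min 1 e) \<longlonglongrightarrow> 0"
        using tendsto_divide[OF r tendsto_const, of "min 1 e"] e by auto
    qed (use prob_gt_le_expectation[OF R e] in \<open>auto intro!: always_eventually\<close>)
  qed
qed

lemma tzip_borel: "tzip R \<Longrightarrow> R k \<in> borel_measurable M"
  by (auto simp: tendsto_zero_in_probability_def)

lemma tzip_bound:
  assumes S: "tzip S" and T: "tzip T"
    and R: "\<And>k. R k \<in> borel_measurable M"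
    and le: "\<And>k. AE \<omega> in M. \<bar>R k \<omega>\<bar> \<le> \<bar>S k \<omega>\<bar> + \<bar>T k \<omega>\<bar>"
  shows "tzip R"
proof -
  have S': "\<And>k. S k \<in> borel_measurable M" and T': "\<And>k. T k \<in> borel_measurable M"
    using S T by (auto simp: tendsto_zero_in_probability_def)
  have le': "expectation (\<lambda>\<omega>. min 1 \<bar>R k \<omega>\<bar>) \<le>
      expectation (\<lambda>\<omega>. min 1 \<bar>S k \<omega>\<bar>) + expectation (\<lambda>\<omega>. min 1 \<bar>T k \<omega>\<bar>)" for k
  proof -
    have "expectation (\<lambda>\<omega>. min 1 \<bar>R k \<omega>\<bar>) \<le> expectation (\<lambda>\<omega>. min 1 \<bar>S k \<omega>\<bar> + min 1 \<bar>T k \<omega>\<bar>)"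
      by (rule integral_mono_AE)
        (use le[of k] in \<open>auto intro!: Bochner_Integration.integrable_add integrable_min_1_abs R S' T' elim!: eventually_mono\<close>)
    then show ?thesis
      by (simp add: Bochner_Integration.integral_add integrable_min_1_abs S' T')
  qed
  have "(\<lambda>k. expectation (\<lambda>\<omega>. min 1 \<bar>R k \<omega>\<bar>)) \<longlonglongrightarrow> 0"
  proof (rule tendsto_sandwich[where f="\<lambda>_. 0"])
    show "(\<lambda>k. expectation (\<lambda>\<omega>. min 1 \<bar>S k \<omega>\<bar>) + expectation (\<lambda>\<omega>. min 1 \<bar>T k \<omega>\<bar>)) \<longlonglongrightarrow> 0"
      using tendsto_add[of _ 0 sequentially _ 0] S T S' T' by (auto simp: tendsto_zero_in_probability_iff)
  qed (use le' in \<open>auto intro!: always_eventually\<close>)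
  then show ?thesis by (simp add: tendsto_zero_in_probability_iff R)
qed

lemma tzip_cmult:
  assumes S: "tzip S"
    and R: "\<And>k. R k \<in> borel_measurable M"
    and le: "\<And>k. AE \<omega> in M. \<bar>R k \<omega>\<bar> \<le> c * \<bar>S k \<omega>\<bar>"
  shows "tzip R"
  unfolding tendsto_zero_in_probability_def
proof (intro conjI allI impI R)
  fix e :: real assume e: "0 < e"
  have S': "\<And>k. S k \<in> borel_measurable M"
    using S by (auto simp: tendsto_zero_in_probability_def)
  \<comment> \<open>The maximum with 1 gives a positive divisor also when \<open>c\<close> is zero
    or negative.\<close>
  define d where "d = max 1 c"
  have d: "0 < d" "c \<le> d" by (auto simp: d_def)
  show "(\<lambda>k. prob {\<omega> \<in> space M. e < \<bar>R k \<omega>\<bar>}) \<longlonglongrightarrow> 0"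
  proof (rule tendsto_sandwich[where f="\<lambda>_. 0"])
    show "(\<lambda>k. prob {\<omega> \<in> space M. e / d < \<bar>S k \<omega>\<bar>}) \<longlonglongrightarrow> 0"
      using S e d by (auto simp: tendsto_zero_in_probability_def)
    have "prob {\<omega> \<in> space M. e < \<bar>R k \<omega>\<bar>} \<le> prob {\<omega> \<in> space M. e / d < \<bar>S k \<omega>\<bar>}" for k
    proof (rule finite_measure_mono_AE)
      show "AE \<omega> in M. \<omega> \<in> {\<omega> \<in> space M. e < \<bar>R k \<omega>\<bar>} \<longrightarrow> \<omega> \<in> {\<omega> \<in> space M. e / d < \<bar>S k \<omega>\<bar>}"
        using le[of k]
      proof eventually_elim
        case (elim \<omega>)
        have "c * \<bar>S k \<omega>\<bar> \<le> d * \<bar>S k \<omega>\<bar>" using d by (intro mult_right_mono) auto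
        then show ?case using elim d by (auto simp: pos_divide_less_eq mult.commute)
      qed
    qed (use S' in auto)
    then show "\<forall>\<^sub>F k in sequentially. prob {\<omega> \<in> space M. e < \<bar>R k \<omega>\<bar>} \<le> prob {\<omega> \<in> space M. e / d < \<bar>S k \<omega>\<bar>}"
      by auto
  qed auto
qed

lemma tzip_zero: "tzip (\<lambda>_ _. 0)"
  by (simp add: tendsto_zero_in_probability_def)

lemma tzip_add:
  assumes "tzip S" "tzip T"
  shows "tzip (\<lambda>k \<omega>. S k \<omega> + T k \<omega>)"
  by (rule tzip_bound[OF assms]) (use assms[THEN tzip_borel] in auto)

lemma tzip_AE:
  assumes R: "\<And>k. R k \<in> borel_measurable M" and lim: "AE \<omega> in M. (\<lambda>k. R k \<omega>) \<longlonglongrightarrow> 0"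
  shows "tzip R"
  unfolding tendsto_zero_in_probability_iff[OF R]
proof -
  have "(\<lambda>k. expectation (\<lambda>\<omega>. min 1 \<bar>R k \<omega>\<bar>)) \<longlonglongrightarrow> expectation (\<lambda>\<omega>. 0)"
  proof (rule integral_dominated_convergence[where w="\<lambda>_. 1"])
    show "AE \<omega> in M. (\<lambda>k. min 1 \<bar>R k \<omega>\<bar>) \<longlonglongrightarrow> 0"
      using lim
    proof eventually_elim
      case (elim \<omega>)
      then have "(\<lambda>k. min 1 \<bar>R k \<omega>\<bar>) \<longlonglongrightarrow> min 1 \<bar>0\<bar>" by (intro tendsto_intros)
      then show ?case by simp
    qed
  qed (use R in auto)
  then show "(\<lambda>k. expectation (\<lambda>\<omega>. min 1 \<bar>R k \<omega>\<bar>)) \<longlonglongrightarrow> 0" by simp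
qed

lemma tzip_subseq:
  assumes "tzip R" "strict_mono r"
  shows "tzip (\<lambda>k. R (r k))"
  using assms LIMSEQ_subseq_LIMSEQ[OF _ assms(2)]
  unfolding tendsto_zero_in_probability_def o_def by fast

lemma tzip_AE_subseq:
  assumes R: "tzip R"
  obtains r :: "nat \<Rightarrow> nat" where "strict_mono r" "AE \<omega> in M. (\<lambda>k. R (r k) \<omega>) \<longlonglongrightarrow> 0"
proof -
  have R': "\<And>k. R k \<in> borel_measurable M" using R by (rule tzip_borel)
  have "\<exists>r::nat\<Rightarrow>nat. strict_mono r \<and> (AE \<omega> in M. (\<lambda>k. min 1 \<bar>R (r k) \<omega>\<bar>) \<longlonglongrightarrow> 0)"
    by (rule tendsto_L1_AE_subseq)
      (use R R' in \<open>auto simp: integrable_min_1_abs tendsto_zero_in_probability_iff\<close>)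
  then obtain r :: "nat \<Rightarrow> nat" where r: "strict_mono r"
    and ae: "AE \<omega> in M. (\<lambda>k. min 1 \<bar>R (r k) \<omega>\<bar>) \<longlonglongrightarrow> 0" by auto
  have "AE \<omega> in M. (\<lambda>k. R (r k) \<omega>) \<longlonglongrightarrow> 0"
    using ae
  proof eventually_elim
    case (elim \<omega>)
    \<comment> \<open>Once the truncated value is below 1 the truncation is inactive, so the limit
      is that of \<open>R\<close> itself.\<close>
    have "eventually (\<lambda>k. min 1 \<bar>R (r k) \<omega>\<bar> < 1) sequentially"
      by (rule order_tendstoD(2)[OF elim]) simp
    then have "eventually (\<lambda>k. min 1 \<bar>R (r k) \<omega>\<bar> = \<bar>R (r k) \<omega>\<bar>) sequentially"
      by eventually_elim auto
    then have "(\<lambda>k. \<bar>R (r k) \<omega>\<bar>) \<longlonglongrightarrow> 0"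
      using elim by (rule Lim_transform_eventually[rotated])
    then show ?case by (simp add: tendsto_rabs_zero_iff)
  qed
  with r show ?thesis using that by blast
qed

end

subsection \<open>Simple processes\<close>

text \<open>Couples an integrand with its integral and hides the partition. Linear combinations and
  products with step factors can then be formed on the pair, without tracking times and
  coefficients.\<close>

definition is_simple ::
    "(real \<Rightarrow> 'a measure) \<Rightarrow> (real \<Rightarrow> 'a \<Rightarrow> real) \<Rightarrow> (real \<Rightarrow> 'a \<Rightarrow> real) \<Rightarrow> (real \<Rightarrow> 'a \<Rightarrow> real) \<Rightarrow> bool" where
  "is_simple F W g J \<longleftrightarrow> (\<exists>m \<tau> \<xi>. simple_process F m \<tau> \<xi> \<and>
     g = simple_value m \<tau> \<xi> \<and> J = simple_integral_wrt W m \<tau> \<xi>)"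

lemma simple_process_times:
  assumes "simple_process F m \<tau> \<xi>" "k \<le> m"
  shows "0 \<le> \<tau> k"
  using assms(2)
proof (induction k)
  case (Suc k)
  then have "\<tau> k \<le> \<tau> (Suc k)" using assms(1) by (auto simp: simple_process_def)
  then show ?case using Suc by auto
qed (use assms in \<open>auto simp: simple_process_def\<close>)

lemma telescope_between:
  fixes w :: "real \<Rightarrow> real" and \<tau> :: "nat \<Rightarrow> real"
  assumes mono: "\<And>i j. i < j \<Longrightarrow> j \<le> m \<Longrightarrow> \<tau> i < \<tau> j" and ij: "i \<le> j" "j \<le> m"
  shows "(\<Sum>k<m. (if \<tau> i \<le> \<tau> k \<and> \<tau> (Suc k) \<le> \<tau> j then w (\<tau> (Suc k)) - w (\<tau> k) else 0)) = w (\<tau> j) - w (\<tau> i)"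
proof -
  have le: "\<tau> p \<le> \<tau> q \<longleftrightarrow> p \<le> q" if "p \<le> m" "q \<le> m" for p q
    using mono[of p q] mono[of q p] that by (cases p q rule: linorder_cases) auto
  have "(\<Sum>k<m. (if \<tau> i \<le> \<tau> k \<and> \<tau> (Suc k) \<le> \<tau> j then w (\<tau> (Suc k)) - w (\<tau> k) else 0)) =
        (\<Sum>k<m. (if k \<in> {i..<j} then w (\<tau> (Suc k)) - w (\<tau> k) else 0))"
    using ij by (intro sum.cong refl) (auto simp: le)
  also have "\<dots> = (\<Sum>k\<in>{..<m} \<inter> {i..<j}. w (\<tau> (Suc k)) - w (\<tau> k))"
    by (subst sum.inter_restrict) auto
  also have "{..<m} \<inter> {i..<j} = {i..<j}" using ij by auto
  also have "(\<Sum>k\<in>{i..<j}. w (\<tau> (Suc k)) - w (\<tau> k)) = w (\<tau> j) - w (\<tau> i)"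
    using sum_Suc_diff'[of i j "\<lambda>k. w (\<tau> k)"] ij by simp
  finally show ?thesis .
qed

lemma indicator_Ioc_eq_diff:
  "a \<le> b \<Longrightarrow> indicator {a<..b} s = (of_bool (s \<le> b) - of_bool (s \<le> a) :: real)" for a b s :: real
  by (auto simp: indicator_def)

text \<open>The interval from \<open>max a x\<close> to \<open>max (max a x) (min b y)\<close> is
  the intersection of the two half-open intervals; the outer maximum makes it degenerate, with
  ordered end points, when they are disjoint. The right-hand side is what an integral over the
  second interval gains between \<open>min a t\<close> and \<open>min b t\<close>.\<close>

lemma step_increment:
  fixes w :: "real \<Rightarrow> real"
  assumes "a \<le> b" "x \<le> y"
  shows "w (min (max (max a x) (min b y)) t) - w (min (max a x) t) =
    (w (min y (min b t)) - w (min x (min b t))) - (w (min y (min a t)) - w (min x (min a t)))"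
proof -
  consider "t \<le> a" | "a \<le> t" "t \<le> b" | "b \<le> t" using assms by linarith
  then show ?thesis
  proof cases
    case 1
    then have *: "min b t = t" "min a t = t" "min (max a x) t = t" "min (max (max a x) (min b y)) t = t" using assms by auto
    show ?thesis unfolding * by simp
  next
    case 2
    then have *: "min b t = t" "min a t = a" by auto
    consider "y \<le> a" | "x \<le> a" "a \<le> y" | "a \<le> x" using assms by linarith
    then show ?thesis unfolding * by cases (use assms 2 in \<open>smt (verit) min_def max_def\<close>)+
  next
    case 3
    then have *: "min b t = b" "min a t = a" using assms by auto
    consider "y \<le> a" | "x \<le> a" "a \<le> y" | "a \<le> x" "x \<le> b" | "b \<le> x" using assms by linarith
    then show ?thesis unfolding * by cases (use assms 3 in \<open>smt (verit) min_def max_def\<close>)+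
  qed
qed
lemma step_indicator:
  fixes a b x y :: real
  shows "indicator {max a x<..max (max a x) (min b y)} s = (indicator {a<..b} s * indicator {x<..y} s :: real)"
  by (simp add: indicator_def) linarith

context stochastic_basis
begin

text \<open>The common refinement of finitely many intervals is given by the sorted list of their end
  points.\<close>

lemma is_simple_family:
  fixes a b :: "'i \<Rightarrow> real"
  assumes fin: "finite A"
    and ab: "\<And>p. p \<in> A \<Longrightarrow> 0 \<le> a p \<and> a p \<le> b p"
    and \<xi>: "\<And>p. p \<in> A \<Longrightarrow> \<xi> p \<in> borel_measurable (F (a p))"
    and bd: "\<And>p. p \<in> A \<Longrightarrow> bounded (\<xi> p ` space M)"
  shows "is_simple F W (\<lambda>s \<omega>. \<Sum>p\<in>A. \<xi> p \<omega> * indicator {a p<..b p} s)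
    (\<lambda>t \<omega>. \<Sum>p\<in>A. \<xi> p \<omega> * (W (min (b p) t) \<omega> - W (min (a p) t) \<omega>))"
proof -
  \<comment> \<open>The point 0 keeps the list of end points non-empty when \<open>A\<close> is
    empty.\<close>
  define P where "P = insert 0 (a ` A \<union> b ` A)"
  define L where "L = sorted_list_of_set P"
  define m where "m = length L - 1"
  define \<tau> where "\<tau> k = L ! k" for k
  \<comment> \<open>A cell carries the coefficients of all intervals that contain it. Such an
    interval starts no later than the cell, so its coefficient is already known at the start of the
    cell.\<close>
  define \<zeta> where "\<zeta> k \<omega> = (\<Sum>p\<in>A. if a p \<le> \<tau> k \<and> \<tau> (Suc k) \<le> b p then \<xi> p \<omega> else 0)" for k \<omega>
  have finP: "finite P" using fin by (auto simp: P_def)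
  have setL: "set L = P" and sL: "sorted_wrt (<) L"
    using finP by (auto simp: L_def)
  have "L \<noteq> []" using setL by (auto simp: P_def)
  then have lenL: "length L = Suc m" by (cases L) (auto simp: m_def)
  have mono: "\<tau> i < \<tau> j" if "i < j" "j \<le> m" for i j
    using sorted_wrt_nth_less[OF sL] that lenL by (auto simp: \<tau>_def)
  have le: "\<tau> i \<le> \<tau> j \<longleftrightarrow> i \<le> j" if "i \<le> m" "j \<le> m" for i j
    using mono[of i j] mono[of j i] that by (cases i j rule: linorder_cases) auto
  have ex: "\<exists>i\<le>m. x = \<tau> i" if "x \<in> P" for x
    using that setL lenL unfolding \<tau>_def in_set_conv_nth[of x L, symmetric]
    by (metis in_set_conv_nth less_Suc_eq_le)
  have pos: "0 \<le> x" if "x \<in> P" for x using that ab by (fastforce simp: P_def)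
  have posr: "0 \<le> \<tau> k" if "k \<le> m" for k
    using pos setL nth_mem[of k L] that lenL by (auto simp: \<tau>_def)
  have key: "(\<Sum>k<m. if a p \<le> \<tau> k \<and> \<tau> (Suc k) \<le> b p then w (\<tau> (Suc k)) - w (\<tau> k) else 0) = w (b p) - w (a p)"
    if p: "p \<in> A" for p and w :: "real \<Rightarrow> real"
  proof -
    obtain i where i: "i \<le> m" "a p = \<tau> i" using ex[of "a p"] p by (auto simp: P_def)
    obtain j where j: "j \<le> m" "b p = \<tau> j" using ex[of "b p"] p by (auto simp: P_def)
    have "i \<le> j" using ab[OF p] i j le by auto
    show ?thesis using telescope_between[of m \<tau> i j w] mono \<open>i \<le> j\<close> i j by auto
  qed
  \<comment> \<open>The path \<open>w\<close> is arbitrary so that one identity serves twice: with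
    \<open>w\<close> a stopped path of \<open>W\<close> it gives the integrals, with
    \<open>w\<close> the truth value of \<open>s \<le> _\<close> it gives the values of the
    process.\<close>
  have key2: "(\<Sum>k<m. \<zeta> k \<omega> * (w (\<tau> (Suc k)) - w (\<tau> k))) = (\<Sum>p\<in>A. \<xi> p \<omega> * (w (b p) - w (a p)))"
    for w :: "real \<Rightarrow> real" and \<omega>
  proof -
    have "(\<Sum>k<m. \<zeta> k \<omega> * (w (\<tau> (Suc k)) - w (\<tau> k))) =
      (\<Sum>k<m. \<Sum>p\<in>A. \<xi> p \<omega> * (if a p \<le> \<tau> k \<and> \<tau> (Suc k) \<le> b p then w (\<tau> (Suc k)) - w (\<tau> k) else 0))"
      unfolding \<zeta>_def sum_distrib_right by (intro sum.cong refl) auto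
    also have "\<dots> = (\<Sum>p\<in>A. \<Sum>k<m. \<xi> p \<omega> * (if a p \<le> \<tau> k \<and> \<tau> (Suc k) \<le> b p then w (\<tau> (Suc k)) - w (\<tau> k) else 0))"
      by (rule sum.swap)
    also have "\<dots> = (\<Sum>p\<in>A. \<xi> p \<omega> * (w (b p) - w (a p)))"
      unfolding sum_distrib_left[symmetric] by (intro sum.cong refl) (simp add: key)
    finally show ?thesis .
  qed
  have "simple_process F m \<tau> \<zeta>"
    unfolding simple_process_def
  proof (intro conjI allI impI)
    show "0 \<le> \<tau> 0" using posr by auto
    fix k assume k: "k < m"
    show "\<tau> k \<le> \<tau> (Suc k)" using mono[of k "Suc k"] k by auto
    have tk: "0 \<le> \<tau> k" using posr k by auto
    show "\<zeta> k \<in> borel_measurable (F (\<tau> k))"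
      unfolding \<zeta>_def
    proof (rule borel_measurable_sum)
      fix p assume p: "p \<in> A"
      show "(\<lambda>\<omega>. if a p \<le> \<tau> k \<and> \<tau> (Suc k) \<le> b p then \<xi> p \<omega> else 0) \<in> borel_measurable (F (\<tau> k))"
        using measurable_F_mono[OF \<xi>[OF p]] ab[OF p] by (cases "a p \<le> \<tau> k \<and> \<tau> (Suc k) \<le> b p") auto
    qed
    have "\<exists>c. \<forall>p\<in>A. \<forall>\<omega>\<in>space M. \<bar>\<xi> p \<omega>\<bar> \<le> c p"
      using bd unfolding bounded_iff by (auto intro!: bchoice)
    then obtain c where c: "\<And>p \<omega>. p \<in> A \<Longrightarrow> \<omega> \<in> space M \<Longrightarrow> \<bar>\<xi> p \<omega>\<bar> \<le> c p" by blast
    show "bounded (\<zeta> k ` space (F (\<tau> k)))"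
      unfolding bounded_iff
    proof (intro exI ballI)
      fix x assume "x \<in> \<zeta> k ` space (F (\<tau> k))"
      then obtain \<omega> where \<omega>: "\<omega> \<in> space M" "x = \<zeta> k \<omega>" using tk by (auto simp: space_F)
      show "norm x \<le> (\<Sum>p\<in>A. c p)"
        unfolding \<omega>(2) \<zeta>_def
      proof (rule sum_norm_le)
        fix p assume "p \<in> A"
        then show "norm (if a p \<le> \<tau> k \<and> \<tau> (Suc k) \<le> b p then \<xi> p \<omega> else 0) \<le> c p"
          using c[of p \<omega>] \<omega> abs_ge_zero[of "\<xi> p \<omega>"] by (auto simp del: abs_ge_zero)
      qed
    qed
  qed
  moreover have "(\<lambda>s \<omega>. \<Sum>p\<in>A. \<xi> p \<omega> * indicator {a p<..b p} s) = simple_value m \<tau> \<zeta>"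
  proof (intro ext)
    fix s \<omega>
    have "simple_value m \<tau> \<zeta> s \<omega> = (\<Sum>k<m. \<zeta> k \<omega> * (of_bool (s \<le> \<tau> (Suc k)) - of_bool (s \<le> \<tau> k)))"
      unfolding simple_value_def
      by (intro sum.cong refl, subst indicator_Ioc_eq_diff) (auto simp: le)
    also have "\<dots> = (\<Sum>p\<in>A. \<xi> p \<omega> * (of_bool (s \<le> b p) - of_bool (s \<le> a p)))"
      by (rule key2)
    also have "\<dots> = (\<Sum>p\<in>A. \<xi> p \<omega> * indicator {a p<..b p} s)"
      using ab by (intro sum.cong refl, subst indicator_Ioc_eq_diff) auto
    finally show "(\<Sum>p\<in>A. \<xi> p \<omega> * indicator {a p<..b p} s) = simple_value m \<tau> \<zeta> s \<omega>" by simp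
  qed
  moreover have "(\<lambda>t \<omega>. \<Sum>p\<in>A. \<xi> p \<omega> * (W (min (b p) t) \<omega> - W (min (a p) t) \<omega>)) = simple_integral_wrt W m \<tau> \<zeta>"
    unfolding simple_integral_wrt_def
    by (intro ext) (rule key2[symmetric])
  ultimately show ?thesis unfolding is_simple_def by blast
qed

lemma simple_process_iff:
  "simple_process F m \<tau> \<xi> \<longleftrightarrow> 0 \<le> \<tau> 0 \<and> (\<forall>k<m. 0 \<le> \<tau> k \<and> \<tau> k \<le> \<tau> (Suc k) \<and>
     \<xi> k \<in> borel_measurable (F (\<tau> k)) \<and> bounded (\<xi> k ` space M))"
proof
  assume s: "simple_process F m \<tau> \<xi>"
  show "0 \<le> \<tau> 0 \<and> (\<forall>k<m. 0 \<le> \<tau> k \<and> \<tau> k \<le> \<tau> (Suc k) \<and>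
     \<xi> k \<in> borel_measurable (F (\<tau> k)) \<and> bounded (\<xi> k ` space M))"
  proof (intro conjI allI impI)
    fix k assume k: "k < m"
    show t: "0 \<le> \<tau> k" using simple_process_times[OF s, of k] k by simp
    show "bounded (\<xi> k ` space M)"
      using s k space_F[OF t] unfolding simple_process_def by metis
  qed (use s in \<open>simp_all add: simple_process_def\<close>)
next
  assume *: "0 \<le> \<tau> 0 \<and> (\<forall>k<m. 0 \<le> \<tau> k \<and> \<tau> k \<le> \<tau> (Suc k) \<and>
     \<xi> k \<in> borel_measurable (F (\<tau> k)) \<and> bounded (\<xi> k ` space M))"
  then show "simple_process F m \<tau> \<xi>"
    unfolding simple_process_def using space_F by metis
qed

lemma simple_processD:
  assumes "simple_process F m \<tau> \<xi>" "k < m"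
  shows "0 \<le> \<tau> k" "\<tau> k \<le> \<tau> (Suc k)" "0 \<le> \<tau> (Suc k)"
    "\<xi> k \<in> borel_measurable (F (\<tau> k))" "bounded (\<xi> k ` space M)"
  using assms unfolding simple_process_iff by (blast intro: order_trans)+

lemma is_simple_lincomb:
  assumes "is_simple F W g J" "is_simple F W g' J'"
  shows "is_simple F W (\<lambda>s \<omega>. c * g s \<omega> + c' * g' s \<omega>) (\<lambda>t \<omega>. c * J t \<omega> + c' * J' t \<omega>)"
proof -
  obtain m \<tau> \<xi> m' \<tau>' \<xi>' where s: "simple_process F m \<tau> \<xi>" "simple_process F m' \<tau>' \<xi>'"
    and e: "g = simple_value m \<tau> \<xi>" "J = simple_integral_wrt W m \<tau> \<xi>"
      "g' = simple_value m' \<tau>' \<xi>'" "J' = simple_integral_wrt W m' \<tau>' \<xi>'"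
    using assms unfolding is_simple_def by blast
  \<comment> \<open>Both families are indexed over the disjoint sum of their index sets; the common
    refinement is left to \<open>is_simple_family\<close>.\<close>
  define a where "a = case_sum \<tau> \<tau>'"
  define b where "b = case_sum (\<lambda>k. \<tau> (Suc k)) (\<lambda>k. \<tau>' (Suc k))"
  define z where "z = case_sum (\<lambda>k \<omega>. c * \<xi> k \<omega>) (\<lambda>k \<omega>. c' * \<xi>' k \<omega>)"
  have bd: "bounded ((\<lambda>\<omega>. c * h \<omega>) ` space M)" if "bounded (h ` space M)" for c and h :: "'a \<Rightarrow> real"
    using bounded_scaling[OF that, of c] by (simp add: image_image)
  have "is_simple F W (\<lambda>s \<omega>. \<Sum>p\<in>{..<m} <+> {..<m'}. z p \<omega> * indicator {a p<..b p} s)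
    (\<lambda>t \<omega>. \<Sum>p\<in>{..<m} <+> {..<m'}. z p \<omega> * (W (min (b p) t) \<omega> - W (min (a p) t) \<omega>))"
  proof (rule is_simple_family)
    fix p assume "p \<in> {..<m} <+> {..<m'}"
    then consider k where "p = Inl k" "k < m" | k where "p = Inr k" "k < m'" by auto
    then have "0 \<le> a p \<and> a p \<le> b p \<and> z p \<in> borel_measurable (F (a p)) \<and> bounded (z p ` space M)"
      using s by cases (simp_all add: a_def b_def z_def simple_process_iff bd borel_measurable_times)
    then show "0 \<le> a p \<and> a p \<le> b p" "z p \<in> borel_measurable (F (a p))" "bounded (z p ` space M)"
      by blast+
  qed simp
  also have "(\<lambda>s \<omega>. \<Sum>p\<in>{..<m} <+> {..<m'}. z p \<omega> * indicator {a p<..b p} s) = (\<lambda>s \<omega>. c * g s \<omega> + c' * g' s \<omega>)"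
    by (simp only: sum.Plus finite_lessThan e simple_value_def a_def b_def z_def sum_distrib_left sum.case mult.assoc o_def)
  also have "(\<lambda>t \<omega>. \<Sum>p\<in>{..<m} <+> {..<m'}. z p \<omega> * (W (min (b p) t) \<omega> - W (min (a p) t) \<omega>)) =
      (\<lambda>t \<omega>. c * J t \<omega> + c' * J' t \<omega>)"
    by (simp only: sum.Plus finite_lessThan e simple_integral_wrt_def a_def b_def z_def sum_distrib_left sum.case mult.assoc o_def)
  finally show ?thesis .
qed

lemma is_simple_step:
  assumes "is_simple F W g J" and ab: "0 \<le> a" "a \<le> b"
    and \<phi>: "\<phi> \<in> borel_measurable (F a)" "bounded (\<phi> ` space M)"
  shows "is_simple F W (\<lambda>s \<omega>. \<phi> \<omega> * indicator {a<..b} s * g s \<omega>)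
    (\<lambda>t \<omega>. \<phi> \<omega> * (J (min b t) \<omega> - J (min a t) \<omega>))"
proof -
  obtain m \<tau> \<xi> where s: "simple_process F m \<tau> \<xi>"
    and e: "g = simple_value m \<tau> \<xi>" "J = simple_integral_wrt W m \<tau> \<xi>"
    using assms unfolding is_simple_def by blast
  \<comment> \<open>The intersection of the cell with the step interval starts after both
    \<open>a\<close> and \<open>\<tau> k\<close>, so the product of \<open>\<phi>\<close> and
    \<open>\<xi> k\<close> is known at its left end.\<close>
  define a' where "a' k = max a (\<tau> k)" for k
  define b' where "b' k = max (a' k) (min b (\<tau> (Suc k)))" for k
  define z where "z k \<omega> = \<phi> \<omega> * \<xi> k \<omega>" for k \<omega>
  have m1: "\<xi> k \<in> borel_measurable (F (a' k))" if "k < m" for k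
    by (rule measurable_F_mono[where s="\<tau> k"]) (simp_all add: a'_def simple_processD[OF s that])
  have m2: "\<phi> \<in> borel_measurable (F (a' k))" for k
    by (rule measurable_F_mono[OF \<phi>(1)]) (use ab in \<open>auto simp: a'_def\<close>)
  have bd: "bounded (z k ` space M)" if "k < m" for k
  proof -
    have "bounded (\<xi> k ` space M)" using simple_processD[OF s that] by simp
    then obtain c where c: "\<And>\<omega>. \<omega> \<in> space M \<Longrightarrow> \<bar>\<xi> k \<omega>\<bar> \<le> c" by (auto simp: bounded_iff)
    obtain d where d: "\<And>\<omega>. \<omega> \<in> space M \<Longrightarrow> \<bar>\<phi> \<omega>\<bar> \<le> d" using \<phi> by (auto simp: bounded_iff)
    show ?thesis unfolding bounded_iff
      by (rule exI[of _ "d * c"]) (auto simp: z_def abs_mult intro!: mult_mono c d abs_ge_zero order_trans[OF abs_ge_zero d])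
  qed
  have "is_simple F W (\<lambda>s \<omega>. \<Sum>k<m. z k \<omega> * indicator {a' k<..b' k} s)
    (\<lambda>t \<omega>. \<Sum>k<m. z k \<omega> * (W (min (b' k) t) \<omega> - W (min (a' k) t) \<omega>))"
  proof (rule is_simple_family)
    show "z p \<in> borel_measurable (F (a' p))" if "p \<in> {..<m}" for p
      unfolding z_def by (intro borel_measurable_times m1 m2) (use that in auto)
  qed (use bd ab in \<open>auto simp: a'_def b'_def\<close>)
  also have "(\<lambda>s \<omega>. \<Sum>k<m. z k \<omega> * indicator {a' k<..b' k} s) = (\<lambda>s \<omega>. \<phi> \<omega> * indicator {a<..b} s * g s \<omega>)"
    unfolding e simple_value_def sum_distrib_left z_def
    by (intro ext sum.cong refl) (simp add: a'_def b'_def step_indicator)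
  also have "(\<lambda>t \<omega>. \<Sum>k<m. z k \<omega> * (W (min (b' k) t) \<omega> - W (min (a' k) t) \<omega>)) =
      (\<lambda>t \<omega>. \<phi> \<omega> * (J (min b t) \<omega> - J (min a t) \<omega>))"
    unfolding e simple_integral_wrt_def sum_distrib_left sum_subtractf[symmetric] z_def mult.assoc
      right_diff_distrib[symmetric]
  proof (intro ext sum.cong refl)
    fix t \<omega> k assume "k \<in> {..<m}"
    then have "\<tau> k \<le> \<tau> (Suc k)" using simple_processD(2)[OF s, of k] by simp
    then have "W (min (b' k) t) \<omega> - W (min (a' k) t) \<omega> =
      (W (min (\<tau> (Suc k)) (min b t)) \<omega> - W (min (\<tau> k) (min b t)) \<omega>) -
      (W (min (\<tau> (Suc k)) (min a t)) \<omega> - W (min (\<tau> k) (min a t)) \<omega>)"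
      unfolding a'_def b'_def using step_increment[OF ab(2), of "\<tau> k" "\<tau> (Suc k)" "\<lambda>r. W r \<omega>" t] by simp
    then show "\<phi> \<omega> * (\<xi> k \<omega> * (W (min (b' k) t) \<omega> - W (min (a' k) t) \<omega>)) =
         \<phi> \<omega> * (\<xi> k \<omega> * ((W (min (\<tau> (Suc k)) (min b t)) \<omega> - W (min (\<tau> k) (min b t)) \<omega>) -
               (W (min (\<tau> (Suc k)) (min a t)) \<omega> - W (min (\<tau> k) (min a t)) \<omega>)))"
      by simp
  qed
  finally show ?thesis .
qed

lemma is_simple_adapted:
  assumes g: "is_simple F W g J" and W: "adapted_continuous M F W"
  shows "adapted_continuous M F J"
proof -
  obtain m \<tau> \<xi> where s: "simple_process F m \<tau> \<xi>" and e: "J = simple_integral_wrt W m \<tau> \<xi>"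
    using g unfolding is_simple_def by blast
  have W1: "\<And>t. 0 \<le> t \<Longrightarrow> W t \<in> borel_measurable (F t)"
    and W2: "AE \<omega> in M. continuous_on {0..} (\<lambda>t. W t \<omega>)"
    using W by (auto simp: adapted_continuous_def)
  have t: "0 \<le> \<tau> k" "0 \<le> \<tau> (Suc k)" "\<tau> k \<le> \<tau> (Suc k)" if "k < m" for k
    using simple_processD[OF s that] by auto
  show ?thesis unfolding adapted_continuous_def
  proof (intro conjI allI impI)
    fix t :: real assume t0: "0 \<le> t"
    have Wm: "W (min x t) \<in> borel_measurable (F t)" if "0 \<le> x" for x
      by (rule measurable_F_mono[OF W1]) (use that t0 in auto)
    show "J t \<in> borel_measurable (F t)" unfolding e simple_integral_wrt_def
    proof (rule borel_measurable_sum)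
      fix k assume k: "k \<in> {..<m}"
      show "(\<lambda>\<omega>. \<xi> k \<omega> * (W (min (\<tau> (Suc k)) t) \<omega> - W (min (\<tau> k) t) \<omega>)) \<in> borel_measurable (F t)"
      proof (cases "\<tau> k \<le> t")
        case True
        have "\<xi> k \<in> borel_measurable (F t)"
          by (rule measurable_F_mono[where s="\<tau> k"]) (use simple_processD[OF s] k True in auto)
        then show ?thesis using Wm t[of k] k by (intro borel_measurable_times borel_measurable_diff) auto
      next
        case False
        \<comment> \<open>A coefficient from after time \<open>t\<close> need not be
          \<open>F t\<close>-measurable, but its increment is still zero.\<close>
        then have "min (\<tau> (Suc k)) t = t" "min (\<tau> k) t = t" using t[of k] k by auto
        then show ?thesis by simp
      qed
    qed
  next
    show "AE \<omega> in M. continuous_on {0..} (\<lambda>t. J t \<omega>)"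
      using W2
    proof eventually_elim
      case (elim \<omega>)
      have "continuous_on {0..} (\<lambda>t. W (min x t) \<omega>)" if "0 \<le> x" for x
        by (rule continuous_on_compose2[OF elim]) (use that in \<open>auto intro!: continuous_intros\<close>)
      then show ?case unfolding e simple_integral_wrt_def using t by (intro continuous_intros) auto
    qed
  qed
qed

lemma is_simple_measurable:
  assumes g: "is_simple F W g J"
  shows "(\<lambda>(\<omega>, s). g s \<omega>) \<in> borel_measurable (M \<Otimes>\<^sub>M lborel)"
proof -
  obtain m \<tau> \<xi> where s: "simple_process F m \<tau> \<xi>" and e: "g = simple_value m \<tau> \<xi>"
    using g unfolding is_simple_def by blast
  have [measurable]: "\<xi> k \<in> borel_measurable M" if "k < m" for k
    by (rule measurable_F_M[of "\<tau> k"]) (use simple_processD[OF s that] in auto)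
  show ?thesis unfolding e simple_value_def split_beta
    by (intro borel_measurable_sum borel_measurable_times) auto
qed

lemma is_simple_bounded:
  assumes g: "is_simple F W g J" and \<omega>: "\<omega> \<in> space M"
  shows "\<exists>c. \<forall>s. \<bar>g s \<omega>\<bar> \<le> c"
proof -
  obtain m \<tau> \<xi> where s: "simple_process F m \<tau> \<xi>" and e: "g = simple_value m \<tau> \<xi>"
    using g unfolding is_simple_def by blast
  have "\<bar>g s \<omega>\<bar> \<le> (\<Sum>k<m. \<bar>\<xi> k \<omega>\<bar>)" for s
    unfolding e simple_value_def
    by (rule order_trans[OF sum_abs], rule sum_mono) (auto simp: indicator_def)
  then show ?thesis by blast
qed

lemma is_simple_at_0:
  assumes "is_simple F W g J"
  shows "J 0 \<omega> = 0"
proof -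
  obtain m \<tau> \<xi> where s: "simple_process F m \<tau> \<xi>" and e: "J = simple_integral_wrt W m \<tau> \<xi>"
    using assms unfolding is_simple_def by blast
  have "0 \<le> \<tau> k" "0 \<le> \<tau> (Suc k)" if "k < m" for k
    using simple_processD[OF s that] by auto
  then show ?thesis by (auto simp: e simple_integral_wrt_def)
qed

end

subsection \<open>The exponential supermartingale\<close>

text \<open>Completing the square: exponential tilting only shifts the mean. Hence the tilted
  density still has mass one, which is the source of every exponential moment below.\<close>

lemma normal_density_exp_tilt:
  assumes "0 < \<sigma>"
  shows "normal_density 0 \<sigma> u * exp (x * u - x\<^sup>2 * \<sigma>\<^sup>2 / 2) = normal_density (x * \<sigma>\<^sup>2) \<sigma> u"
proof -
  have "- (u - 0)\<^sup>2 / (2 * \<sigma>\<^sup>2) + (x * u - x\<^sup>2 * \<sigma>\<^sup>2 / 2) = - (u - x * \<sigma>\<^sup>2)\<^sup>2 / (2 * \<sigma>\<^sup>2)"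
    using assms by (simp add: field_simps power2_eq_square)
  then show ?thesis by (simp add: normal_density_def exp_add[symmetric] mult.assoc)
qed

lemma nn_integral_normal_density:
  assumes "0 < \<sigma>"
  shows "(\<integral>\<^sup>+u. ennreal (normal_density \<mu> \<sigma> u) \<partial>lborel) = 1"
  using prob_space.emeasure_space_1[OF prob_space_normal_density[OF assms, of \<mu>]]
  by (simp add: emeasure_density)

lemma nn_integral_normal_exp:
  assumes "0 < \<sigma>"
  shows "(\<integral>\<^sup>+u. ennreal (exp (x * u - x\<^sup>2 * \<sigma>\<^sup>2 / 2)) \<partial>density lborel (\<lambda>u. ennreal (normal_density 0 \<sigma> u))) = 1"
proof -
  have "(\<integral>\<^sup>+u. ennreal (exp (x * u - x\<^sup>2 * \<sigma>\<^sup>2 / 2)) \<partial>density lborel (\<lambda>u. ennreal (normal_density 0 \<sigma> u))) =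
    (\<integral>\<^sup>+u. ennreal (normal_density 0 \<sigma> u) * ennreal (exp (x * u - x\<^sup>2 * \<sigma>\<^sup>2 / 2)) \<partial>lborel)"
    by (rule nn_integral_density) auto
  also have "\<dots> = (\<integral>\<^sup>+u. ennreal (normal_density (x * \<sigma>\<^sup>2) \<sigma> u) \<partial>lborel)"
    by (simp add: ennreal_mult'[symmetric] normal_density_exp_tilt[OF assms])
  finally show ?thesis by (simp add: nn_integral_normal_density[OF assms])
qed

lemma borel_measurable_vec_nth: "(\<lambda>v::real^'n. v $ j) \<in> borel_measurable borel"
  by (intro borel_measurable_continuous_onI continuous_intros)

lemma emeasure_lborel_Ioc_eq: "emeasure lborel {a<..b::real} = ennreal (if a \<le> b then b - a else 0)"
  by (cases "a \<le> b") auto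

section \<open>Squares and energies of simple processes\<close>

lemma simple_process_mono:
  assumes "simple_process F m \<tau> \<xi>" "i \<le> j" "j \<le> m"
  shows "\<tau> i \<le> \<tau> j"
  using assms(2,3)
proof (induction j rule: dec_induct)
  case (step n)
  then show ?case using assms(1) by (auto simp: simple_process_def intro: order_trans)
qed auto

text \<open>The case distinction is uniform in the coefficients \<open>z\<close>, so a step function
  and its square, or several step functions on one partition, are evaluated by the same
  case.\<close>

lemma step_sum_cases:
  fixes \<tau> :: "nat \<Rightarrow> real"
  assumes "\<And>k. k < m \<Longrightarrow> \<tau> k \<le> \<tau> (Suc k)"
  obtains k where "k < m" "\<tau> k < s" "s \<le> \<tau> (Suc k)" "\<And>z. (\<Sum>i<m. z i * indicator {\<tau> i<..\<tau> (Suc i)} s) = (z k :: real)"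
  | "\<And>z. (\<Sum>i<m. z i * indicator {\<tau> i<..\<tau> (Suc i)} s) = (0 :: real)"
proof (cases "\<exists>k<m. s \<in> {\<tau> k<..\<tau> (Suc k)}")
  case True
  then obtain k where k: "k < m" "\<tau> k < s" "s \<le> \<tau> (Suc k)" by auto
  have mono: "\<tau> p \<le> \<tau> q" if "p \<le> q" "q \<le> m" for p q
    using that
  proof (induction q rule: dec_induct)
    case (step r)
    then show ?case using assms[of r] by simp
  qed simp
  have other: "s \<notin> {\<tau> i<..\<tau> (Suc i)}" if "i < m" "i \<noteq> k" for i
  proof (cases "i < k")
    case True
    then show ?thesis using mono[of "Suc i" k] k by auto
  next
    case False
    then show ?thesis using mono[of "Suc k" i] k that by auto
  qed
  have "(\<Sum>i<m. z i * indicator {\<tau> i<..\<tau> (Suc i)} s) = z k" for z :: "nat \<Rightarrow> real"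
  proof -
    have "(\<Sum>i<m. z i * indicator {\<tau> i<..\<tau> (Suc i)} s) = (\<Sum>i<m. if i = k then z k else 0)"
      using k other by (intro sum.cong refl) (auto simp: indicator_def)
    then show ?thesis using k by simp
  qed
  then show ?thesis using that(1) k by blast
next
  case False
  have "(\<Sum>i<m. z i * indicator {\<tau> i<..\<tau> (Suc i)} s) = 0" for z :: "nat \<Rightarrow> real"
    by (rule sum.neutral) (use False in \<open>auto simp: indicator_def\<close>)
  then show ?thesis using that(2) by blast
qed

lemma simple_value_square:
  assumes "simple_process F m \<tau> \<xi>"
  shows "(simple_value m \<tau> \<xi> s \<omega>)\<^sup>2 = (\<Sum>k<m. (\<xi> k \<omega>)\<^sup>2 * indicator {\<tau> k<..\<tau> (Suc k)} s)"
proof (rule step_sum_cases[of m \<tau> s])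
  show "\<tau> k \<le> \<tau> (Suc k)" if "k < m" for k
    using assms that by (simp add: simple_process_def)
next
  fix k assume "\<And>z. (\<Sum>i<m. z i * indicator {\<tau> i<..\<tau> (Suc i)} s) = (z k :: real)"
  then show ?thesis by (simp only: simple_value_def)
next
  assume "\<And>z. (\<Sum>i<m. z i * indicator {\<tau> i<..\<tau> (Suc i)} s) = (0 :: real)"
  then show ?thesis by (simp only: simple_value_def zero_power2)
qed

lemma simple_value_square_integral:
  assumes s: "simple_process F m \<tau> \<xi>" and t: "0 \<le> t"
  shows "(LBINT s:{0..t}. (simple_value m \<tau> \<xi> s \<omega>)\<^sup>2) =
    (\<Sum>k<m. (\<xi> k \<omega>)\<^sup>2 * (min (\<tau> (Suc k)) t - min (\<tau> k) t))"
proof -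
  have b: "0 \<le> \<tau> k" "\<tau> k \<le> \<tau> (Suc k)" if "k < m" for k
    using simple_process_times[OF s, of k] simple_process_mono[OF s, of k "Suc k"] that by auto
  have 1: "indicator {0..t} s * indicator {\<tau> k<..\<tau> (Suc k)} s = (indicator {\<tau> k<..min (\<tau> (Suc k)) t} s :: real)"
    if "k < m" for k s
    using b[OF that] by (auto simp: indicator_def)
  have i: "integrable lborel (indicator {\<tau> k<..min (\<tau> (Suc k)) t} :: real \<Rightarrow> real)" for k
    by (rule integrable_real_indicator) (auto simp: emeasure_lborel_Ioc_eq)
  have "(LBINT s:{0..t}. (simple_value m \<tau> \<xi> s \<omega>)\<^sup>2) =
    (LBINT s. (\<Sum>k<m. (\<xi> k \<omega>)\<^sup>2 * indicator {\<tau> k<..min (\<tau> (Suc k)) t} s))"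
    unfolding set_lebesgue_integral_def simple_value_square[OF s]
  proof (intro Bochner_Integration.integral_cong refl)
    fix s :: real
    show "indicator {0..t} s *\<^sub>R (\<Sum>k<m. (\<xi> k \<omega>)\<^sup>2 * indicator {\<tau> k<..\<tau> (Suc k)} s) =
      (\<Sum>k<m. (\<xi> k \<omega>)\<^sup>2 * indicator {\<tau> k<..min (\<tau> (Suc k)) t} s)"
      unfolding real_scaleR_def sum_distrib_left
    proof (intro sum.cong refl)
      fix k assume "k \<in> {..<m}"
      then show "indicator {0..t} s * ((\<xi> k \<omega>)\<^sup>2 * indicator {\<tau> k<..\<tau> (Suc k)} s) =
        (\<xi> k \<omega>)\<^sup>2 * indicator {\<tau> k<..min (\<tau> (Suc k)) t} s"
        using 1[of k s] by (metis lessThan_iff mult.left_commute)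
    qed
  qed
  also have "\<dots> = (\<Sum>k<m. (\<xi> k \<omega>)\<^sup>2 * measure lborel {\<tau> k<..min (\<tau> (Suc k)) t})"
    using i by (subst Bochner_Integration.integral_sum) auto
  also have "\<dots> = (\<Sum>k<m. (\<xi> k \<omega>)\<^sup>2 * (min (\<tau> (Suc k)) t - min (\<tau> k) t))"
  proof (intro sum.cong refl arg_cong2[where f="(*)"])
    fix k assume "k \<in> {..<m}"
    then show "measure lborel {\<tau> k<..min (\<tau> (Suc k)) t} = min (\<tau> (Suc k)) t - min (\<tau> k) t"
      using b[of k] by (cases "\<tau> k \<le> t") (auto simp: measure_def emeasure_lborel_Ioc_eq)
  qed
  finally show ?thesis .
qed

section \<open>Exponential moments of simple integrals\<close>

context brownian_motion
begin

lemma increment_measurable: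
  assumes "0 \<le> s" "s \<le> t"
  shows "(\<lambda>\<omega>. B t \<omega> $ j - B s \<omega> $ j) \<in> borel_measurable M"
proof -
  have "(\<lambda>\<omega>. B u \<omega> $ j) \<in> borel_measurable M" if "0 \<le> u" for u
    by (rule measurable_compose[OF measurable_F_M[OF that] borel_measurable_vec_nth])
      (use B_adapted_continuous that in \<open>simp add: adapted_continuous_def\<close>)
  then show ?thesis using assms by (intro borel_measurable_diff) auto
qed

text \<open>The past is encoded by the identity map into \<open>F s\<close>. Its joint law with the
  increment is a product, so Fubini's theorem can freeze every \<open>F s\<close>-measurable factor
  at once; this takes the place of conditional expectations.\<close>

lemma increment_indep:
  assumes st: "0 \<le> s" "s < t"
  shows "(\<lambda>\<omega>. \<omega>) \<in> M \<rightarrow>\<^sub>M F s"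
    and "distr M (F s) (\<lambda>\<omega>. \<omega>) \<Otimes>\<^sub>M distr M borel (\<lambda>\<omega>. B t \<omega> $ j - B s \<omega> $ j) =
      distr M (F s \<Otimes>\<^sub>M borel) (\<lambda>\<omega>. (\<omega>, B t \<omega> $ j - B s \<omega> $ j))"
proof -
  let ?D = "\<lambda>\<omega>. B t \<omega> $ j - B s \<omega> $ j"
  show id: "(\<lambda>\<omega>. \<omega>) \<in> M \<rightarrow>\<^sub>M F s"
  proof (rule measurableI)
    show "\<omega> \<in> space (F s)" if "\<omega> \<in> space M" for \<omega> using that st by (simp add: space_F)
    show "(\<lambda>\<omega>. \<omega>) -` A \<inter> space M \<in> sets M" if "A \<in> sets (F s)" for A
      using sets.Int[OF sets_F[OF st(1) that] sets.top] by simp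
  qed
  have D: "?D \<in> borel_measurable M"
    using increment_measurable st by auto
  have ind: "indep_set (sets (F s)) {(\<lambda>\<omega>. B t \<omega> - B s \<omega>) -` A \<inter> space M | A. A \<in> sets borel}"
    using B_indep_past[OF st] .
  interpret X: prob_space "distr M (F s) (\<lambda>\<omega>. \<omega>)" by (rule prob_space_distr[OF id])
  interpret Y: prob_space "distr M borel ?D" by (rule prob_space_distr[OF D])
  have pair: "(\<lambda>\<omega>. (\<omega>, ?D \<omega>)) \<in> M \<rightarrow>\<^sub>M F s \<Otimes>\<^sub>M borel"
    using id D by (rule measurable_Pair)
  show "distr M (F s) (\<lambda>\<omega>. \<omega>) \<Otimes>\<^sub>M distr M borel ?D = distr M (F s \<Otimes>\<^sub>M borel) (\<lambda>\<omega>. (\<omega>, ?D \<omega>))"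
  proof (rule pair_measure_eqI)
    show "sets (distr M (F s) (\<lambda>\<omega>. \<omega>) \<Otimes>\<^sub>M distr M borel ?D) = sets (distr M (F s \<Otimes>\<^sub>M borel) (\<lambda>\<omega>. (\<omega>, ?D \<omega>)))"
      by (simp add: sets_pair_measure_cong[OF sets_distr sets_distr])
    fix A C assume "A \<in> sets (distr M (F s) (\<lambda>\<omega>. \<omega>))" "C \<in> sets (distr M borel ?D)"
    then have A: "A \<in> sets (F s)" and C: "C \<in> sets borel" by auto
    have Asp: "A \<subseteq> space M" using sets.sets_into_space[OF A] st by (simp add: space_F)
    have C': "(\<lambda>v::real^'n. v $ j) -` C \<in> sets borel"
      using measurable_sets[OF borel_measurable_vec_nth C] by simp
    have "?D -` C \<inter> space M \<in> {(\<lambda>\<omega>. B t \<omega> - B s \<omega>) -` A \<inter> space M | A. A \<in> sets borel}"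
      using C' by (intro CollectI exI[of _ "(\<lambda>v. v $ j) -` C"]) auto
    then have "prob (A \<inter> (?D -` C \<inter> space M)) = prob A * prob (?D -` C \<inter> space M)"
      using ind A unfolding indep_sets2_eq by blast
    moreover have "(\<lambda>\<omega>. (\<omega>, ?D \<omega>)) -` (A \<times> C) \<inter> space M = A \<inter> (?D -` C \<inter> space M)"
      using Asp by auto
    moreover have "(\<lambda>\<omega>. \<omega>) -` A \<inter> space M = A" using Asp by auto
    ultimately show "emeasure (distr M (F s) (\<lambda>\<omega>. \<omega>)) A * emeasure (distr M borel ?D) C =
        emeasure (distr M (F s \<Otimes>\<^sub>M borel) (\<lambda>\<omega>. (\<omega>, ?D \<omega>))) (A \<times> C)"
      using A C pair id D by (simp add: emeasure_distr emeasure_eq_measure ennreal_mult'')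
  qed unfold_locales
qed

text \<open>With \<open>\<omega>\<close> frozen in \<open>\<Phi>\<close> and \<open>x\<close>, the
  inner integral over the Gaussian increment is the exponential moment with deterministic
  \<open>x\<close>, which equals one.\<close>

lemma exp_increment:
  assumes st: "0 \<le> s" "s \<le> t"
    and \<Phi>: "\<Phi> \<in> borel_measurable (F s)" and x: "x \<in> borel_measurable (F s)"
  shows "(\<integral>\<^sup>+\<omega>. \<Phi> \<omega> * ennreal (exp (x \<omega> * (B t \<omega> $ j - B s \<omega> $ j) - (x \<omega>)\<^sup>2 * (t - s) / 2)) \<partial>M) =
    (\<integral>\<^sup>+\<omega>. \<Phi> \<omega> \<partial>M)"
proof (cases "s = t")
  case False
  then have st': "s < t" using st by simp
  let ?D = "\<lambda>\<omega>. B t \<omega> $ j - B s \<omega> $ j"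
  let ?f = "\<lambda>(\<omega>, u). \<Phi> \<omega> * ennreal (exp (x \<omega> * u - (x \<omega>)\<^sup>2 * (t - s) / 2))"
  note [measurable] = \<Phi> x
  have f: "?f \<in> borel_measurable (F s \<Otimes>\<^sub>M borel)" by measurable
  have iv: "(\<lambda>\<omega>. \<omega>) \<in> M \<rightarrow>\<^sub>M F s" "?D \<in> borel_measurable M"
     "distr M (F s) (\<lambda>\<omega>. \<omega>) \<Otimes>\<^sub>M distr M borel ?D = distr M (F s \<Otimes>\<^sub>M borel) (\<lambda>\<omega>. (\<omega>, ?D \<omega>))"
    using increment_indep[OF st(1) st'] increment_measurable[OF st, of j] by auto
  have D: "distr M borel ?D = density lborel (\<lambda>u. ennreal (normal_density 0 (sqrt (t - s)) u))"
  proof -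
    have "distr M borel ?D = distr M lborel ?D" by (rule distr_cong) auto
    then show ?thesis using B_normal[OF st(1) st', of j] unfolding distributed_def by simp
  qed
  interpret D: prob_space "distr M borel ?D" by (rule prob_space_distr) (rule iv)
  have inner: "(\<integral>\<^sup>+u. ?f (\<omega>, u) \<partial>distr M borel ?D) = \<Phi> \<omega>" for \<omega>
  proof -
    have "(\<integral>\<^sup>+u. ?f (\<omega>, u) \<partial>distr M borel ?D) =
      \<Phi> \<omega> * (\<integral>\<^sup>+u. ennreal (exp (x \<omega> * u - (x \<omega>)\<^sup>2 * (t - s) / 2)) \<partial>distr M borel ?D)"
      by (simp add: nn_integral_cmult)
    also have "(\<integral>\<^sup>+u. ennreal (exp (x \<omega> * u - (x \<omega>)\<^sup>2 * (t - s) / 2)) \<partial>distr M borel ?D) = 1"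
      unfolding D using nn_integral_normal_exp[of "sqrt (t - s)" "x \<omega>"] st' by simp
    finally show ?thesis by simp
  qed
  have "(\<integral>\<^sup>+\<omega>. \<Phi> \<omega> * ennreal (exp (x \<omega> * ?D \<omega> - (x \<omega>)\<^sup>2 * (t - s) / 2)) \<partial>M) =
      (\<integral>\<^sup>+p. ?f p \<partial>distr M (F s \<Otimes>\<^sub>M borel) (\<lambda>\<omega>. (\<omega>, ?D \<omega>)))"
    by (subst nn_integral_distr[OF measurable_Pair[OF iv(1,2)]]) (unfold measurable_distr_eq1, rule f, simp)
  also have "\<dots> = (\<integral>\<^sup>+p. ?f p \<partial>(distr M (F s) (\<lambda>\<omega>. \<omega>) \<Otimes>\<^sub>M distr M borel ?D))"
    by (simp only: iv(3))
  also have "\<dots> = (\<integral>\<^sup>+\<omega>. (\<integral>\<^sup>+u. ?f (\<omega>, u) \<partial>distr M borel ?D) \<partial>distr M (F s) (\<lambda>\<omega>. \<omega>))"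
    by (rule D.nn_integral_fst[symmetric]) (unfold iv(3) measurable_distr_eq1, rule f)
  also have "\<dots> = (\<integral>\<^sup>+\<omega>. \<Phi> \<omega> \<partial>distr M (F s) (\<lambda>\<omega>. \<omega>))" by (simp only: inner)
  also have "\<dots> = (\<integral>\<^sup>+\<omega>. \<Phi> \<omega> \<partial>M)"
    by (rule nn_integral_distr[OF iv(1)]) (unfold measurable_distr_eq1, rule \<Phi>)
  finally show ?thesis .
qed simp

text \<open>The induction runs over initial segments \<open>p\<close> of a fixed partition and peels
  off the last factor, which has mean one given the past and leaves the earlier factors
  unchanged.\<close>

lemma simple_exp_expectation:
  assumes s: "simple_process F m \<tau> \<xi>" and t: "0 \<le> t" and p: "p \<le> m"
  shows "(\<integral>\<^sup>+\<omega>. ennreal (exp (\<Sum>k<p. l * \<xi> k \<omega> * (B (min (\<tau> (Suc k)) t) \<omega> $ j - B (min (\<tau> k) t) \<omega> $ j)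
      - (l * \<xi> k \<omega>)\<^sup>2 * (min (\<tau> (Suc k)) t - min (\<tau> k) t) / 2)) \<partial>M) = 1"
  using p
proof (induction p)
  case 0
  then show ?case by (simp add: emeasure_space_1)
next
  case (Suc p)
  note b = simple_processD[OF s, of p]
  let ?T = "\<lambda>k \<omega>. l * \<xi> k \<omega> * (B (min (\<tau> (Suc k)) t) \<omega> $ j - B (min (\<tau> k) t) \<omega> $ j)
      - (l * \<xi> k \<omega>)\<^sup>2 * (min (\<tau> (Suc k)) t - min (\<tau> k) t) / 2"
  show ?case
  proof (cases "\<tau> p < t")
    case False
    \<comment> \<open>A cell beginning at or after \<open>t\<close> contributes the factor
      \<open>exp 0\<close>.\<close>
    then have "min (\<tau> p) t = t" "min (\<tau> (Suc p)) t = t" using b Suc by auto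
    then show ?thesis using Suc by simp
  next
    case True
    let ?\<Phi> = "\<lambda>\<omega>. ennreal (exp (\<Sum>k<p. ?T k \<omega>))"
    have Bm: "(\<lambda>\<omega>. B u \<omega> $ j) \<in> borel_measurable (F (\<tau> p))" if "0 \<le> u" "u \<le> \<tau> p" for u
      by (rule measurable_compose[OF _ borel_measurable_vec_nth], rule measurable_F_mono[of _ u])
        (use B_adapted_continuous that in \<open>auto simp: adapted_continuous_def\<close>)
    have "?T k \<in> borel_measurable (F (\<tau> p))" if k: "k < p" for k
    proof -
      have km: "k < m" using k Suc by simp
      have "\<tau> (Suc k) \<le> \<tau> p" by (rule simple_process_mono[OF s]) (use k Suc in auto)
      then have [measurable]: "(\<lambda>\<omega>. B (min (\<tau> (Suc k)) t) \<omega> $ j) \<in> borel_measurable (F (\<tau> p))"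
          "(\<lambda>\<omega>. B (min (\<tau> k) t) \<omega> $ j) \<in> borel_measurable (F (\<tau> p))"
        using simple_processD[OF s km] t by (auto intro!: Bm)
      have [measurable]: "\<xi> k \<in> borel_measurable (F (\<tau> p))"
        using simple_processD[OF s km] \<open>\<tau> (Suc k) \<le> \<tau> p\<close> by (auto intro!: measurable_F_mono[of "\<xi> k" "\<tau> k"])
      show ?thesis by measurable
    qed
    then have \<Phi>: "?\<Phi> \<in> borel_measurable (F (\<tau> p))"
      by (intro measurable_compose[OF _ measurable_ennreal] measurable_compose[OF _ borel_measurable_exp] borel_measurable_sum) auto
    have x: "(\<lambda>\<omega>. l * \<xi> p \<omega>) \<in> borel_measurable (F (\<tau> p))"
      using b Suc by (intro borel_measurable_times) auto
    have mp: "min (\<tau> p) t = \<tau> p" using True by auto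
    have "(\<integral>\<^sup>+\<omega>. ennreal (exp (\<Sum>k<Suc p. ?T k \<omega>)) \<partial>M) = (\<integral>\<^sup>+\<omega>. ?\<Phi> \<omega> * ennreal (exp (?T p \<omega>)) \<partial>M)"
      by (simp only: sum.lessThan_Suc exp_add ennreal_mult' exp_ge_zero)
    also have "\<dots> = (\<integral>\<^sup>+\<omega>. ?\<Phi> \<omega> \<partial>M)"
      unfolding mp by (rule exp_increment[OF _ _ \<Phi> x]) (use b Suc True in auto)
    finally show ?thesis using Suc by simp
  qed
qed

lemma simple_exp_moment:
  assumes s: "simple_process F m \<tau> \<xi>" and t: "0 \<le> t"
  shows "(\<integral>\<^sup>+\<omega>. ennreal (exp (l * simple_integral_wrt (\<lambda>t \<omega>. B t \<omega> $ j) m \<tau> \<xi> t \<omega>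
      - l\<^sup>2 * (LBINT s:{0..t}. (simple_value m \<tau> \<xi> s \<omega>)\<^sup>2) / 2)) \<partial>M) = 1"
  using simple_exp_expectation[OF s t order_refl, of l j]
  unfolding simple_value_square_integral[OF s t] simple_integral_wrt_def
  by (simp add: sum_subtractf sum_distrib_left sum_divide_distrib power_mult_distrib mult.assoc)

end

subsection \<open>Measurable versions of integrands\<close>

text \<open>Adapted processes here are continuous only almost surely and arbitrary at negative
  times, so they need not be jointly measurable. A jointly measurable version suffices for path
  integrals to be random variables, because \<open>M\<close> is complete.\<close>

definition has_measurable_version :: "'a measure \<Rightarrow> (real \<Rightarrow> 'a \<Rightarrow> real) \<Rightarrow> bool" where
  "has_measurable_version M H \<longleftrightarrow> (\<exists>H'. (\<lambda>(\<omega>, s). H' s \<omega>) \<in> borel_measurable (M \<Otimes>\<^sub>M lborel) \<and>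
     (AE \<omega> in M. \<forall>s\<ge>0. H s \<omega> = H' s \<omega>))"

lemma has_measurable_versionI:
  "(\<lambda>(\<omega>, s). H s \<omega>) \<in> borel_measurable (M \<Otimes>\<^sub>M lborel) \<Longrightarrow> has_measurable_version M H"
  unfolding has_measurable_version_def by blast

lemma has_measurable_version_binop:
  assumes G: "has_measurable_version M G" and H: "has_measurable_version M H"
    and h: "(\<lambda>(x, y). h x y) \<in> borel_measurable (borel \<Otimes>\<^sub>M borel)"
  shows "has_measurable_version M (\<lambda>s \<omega>. h (G s \<omega>) (H s \<omega>))"
proof -
  obtain G' where G': "(\<lambda>(\<omega>, s). G' s \<omega>) \<in> borel_measurable (M \<Otimes>\<^sub>M lborel)"
    "AE \<omega> in M. \<forall>s\<ge>0. G s \<omega> = G' s \<omega>" using G unfolding has_measurable_version_def by blast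
  obtain H' where H': "(\<lambda>(\<omega>, s). H' s \<omega>) \<in> borel_measurable (M \<Otimes>\<^sub>M lborel)"
    "AE \<omega> in M. \<forall>s\<ge>0. H s \<omega> = H' s \<omega>" using H unfolding has_measurable_version_def by blast
  have "(\<lambda>p. (\<lambda>(x, y). h x y) ((\<lambda>(\<omega>, s). G' s \<omega>) p, (\<lambda>(\<omega>, s). H' s \<omega>) p)) \<in> borel_measurable (M \<Otimes>\<^sub>M lborel)"
    by (rule measurable_compose[OF measurable_Pair[OF G'(1) H'(1)] h])
  then have "(\<lambda>(\<omega>, s). h (G' s \<omega>) (H' s \<omega>)) \<in> borel_measurable (M \<Otimes>\<^sub>M lborel)"
    by (simp add: split_beta')
  moreover have "AE \<omega> in M. \<forall>s\<ge>0. h (G s \<omega>) (H s \<omega>) = h (G' s \<omega>) (H' s \<omega>)"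
    using G'(2) H'(2) by eventually_elim simp
  ultimately show ?thesis
    unfolding has_measurable_version_def by (intro exI[of _ "\<lambda>s \<omega>. h (G' s \<omega>) (H' s \<omega>)"]) simp
qed

lemma has_measurable_version_diff:
  "has_measurable_version M G \<Longrightarrow> has_measurable_version M H \<Longrightarrow> has_measurable_version M (\<lambda>s \<omega>. G s \<omega> - H s \<omega>)"
  by (rule has_measurable_version_binop) measurable

lemma has_measurable_version_mult:
  "has_measurable_version M G \<Longrightarrow> has_measurable_version M H \<Longrightarrow> has_measurable_version M (\<lambda>s \<omega>. G s \<omega> * H s \<omega>)"
  by (rule has_measurable_version_binop) measurable

lemma has_measurable_version_power2:
  "has_measurable_version M G \<Longrightarrow> has_measurable_version M (\<lambda>s \<omega>. (G s \<omega>)\<^sup>2)"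
  unfolding power2_eq_square by (rule has_measurable_version_mult)

lemma has_measurable_version_random_variable:
  "\<phi> \<in> borel_measurable M \<Longrightarrow> has_measurable_version M (\<lambda>s \<omega>. \<phi> \<omega>)"
  unfolding split_beta' by (rule has_measurable_versionI) (use measurable_compose[OF measurable_fst] in \<open>simp add: split_beta'\<close>)

lemma has_measurable_version_deterministic:
  assumes "c \<in> borel_measurable (restrict_space borel {0..})"
  shows "has_measurable_version M (\<lambda>s \<omega>. c s)"
proof -
  \<comment> \<open>The function is known to be measurable on the half-line only; extension by zero
    makes it Borel everywhere.\<close>
  have "(\<lambda>s. indicator {0..} s *\<^sub>R c s) \<in> borel_measurable borel"
    using assms by (subst (asm) borel_measurable_restrict_space_iff) (auto simp: scaleR_conv_of_real)
  then have "(\<lambda>(\<omega>, s). indicator {0..} s *\<^sub>R c s) \<in> borel_measurable (M \<Otimes>\<^sub>M lborel)"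
    unfolding split_beta' by (intro measurable_compose[OF measurable_snd]) simp
  then show ?thesis
    unfolding has_measurable_version_def
    by (intro exI[of _ "\<lambda>s \<omega>. indicator {0..} s *\<^sub>R c s"]) (auto simp: indicator_def)
qed

lemma floor_grid_tendsto: "(\<lambda>n. real_of_int \<lfloor>real (Suc n) * s\<rfloor> / real (Suc n)) \<longlonglongrightarrow> s"
proof (rule LIMSEQ_I)
  fix r :: real assume "0 < r"
  then obtain N where N: "1 / real (Suc N) < r" using nat_approx_posE by blast
  have "norm (real_of_int \<lfloor>real (Suc n) * s\<rfloor> / real (Suc n) - s) < r" if "n \<ge> N" for n
  proof -
    have "norm (real_of_int \<lfloor>real (Suc n) * s\<rfloor> / real (Suc n) - s) =
      \<bar>real_of_int \<lfloor>real (Suc n) * s\<rfloor> - real (Suc n) * s\<bar> / real (Suc n)"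
      by (simp add: field_simps abs_divide[symmetric] del: of_nat_Suc)
    also have "\<dots> \<le> 1 / real (Suc n)"
      by (rule divide_right_mono) linarith+
    also have "\<dots> \<le> 1 / real (Suc N)" using that by (simp add: field_simps)
    finally show ?thesis using N by simp
  qed
  then show "\<exists>no. \<forall>n\<ge>no. norm (real_of_int \<lfloor>real (Suc n) * s\<rfloor> / real (Suc n) - s) < r" by blast
qed

context stochastic_basis
begin

lemma has_measurable_version_adapted_continuous:
  assumes Z: "adapted_continuous M F Z"
  shows "has_measurable_version M Z"
proof -
  have c: "AE \<omega> in M. continuous_on {0..} (\<lambda>t. Z t \<omega>)" and
    m: "\<And>t. 0 \<le> t \<Longrightarrow> Z t \<in> borel_measurable M"
    using Z measurable_F_M by (auto simp: adapted_continuous_def)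
  obtain N where N: "{\<omega> \<in> space M. \<not> continuous_on {0..} (\<lambda>t. Z t \<omega>)} \<subseteq> N" "N \<in> null_sets M"
    using c by (auto elim!: AE_E intro: null_setsI)
  \<comment> \<open>Bad paths are replaced by zero and negative times by time 0, so that every path
    is continuous on the whole line. Rounding time down to a grid gives countably many values of
    time, hence joint measurability, and continuity passes to the limit.\<close>
  define Z' where "Z' s \<omega> = (if \<omega> \<in> N then 0 else Z (max 0 s) \<omega>)" for s \<omega>
  have mZ': "Z' s \<in> borel_measurable M" for s
    unfolding Z'_def using N m[of "max 0 s"] by (intro measurable_If_set) auto
  have "(\<lambda>(\<omega>, s). Z' s \<omega>) \<in> borel_measurable (M \<Otimes>\<^sub>M lborel)"
  proof (rule borel_measurable_LIMSEQ_real[where u="\<lambda>n (\<omega>, s). Z' (real_of_int \<lfloor>real (Suc n) * s\<rfloor> / real (Suc n)) \<omega>"])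
    fix n
    have "(\<lambda>p. (\<lambda>i p. Z' (real_of_int i / real (Suc n)) (fst p)) \<lfloor>real (Suc n) * snd p\<rfloor> p)
      \<in> borel_measurable (M \<Otimes>\<^sub>M lborel)"
    proof (rule measurable_compose_countable[where f="\<lambda>i p. Z' (real_of_int i / real (Suc n)) (fst p)" and g="\<lambda>p. \<lfloor>real (Suc n) * snd p\<rfloor>"])
      show "(\<lambda>p. Z' (real_of_int i / real (Suc n)) (fst p)) \<in> borel_measurable (M \<Otimes>\<^sub>M lborel)" for i
        by (rule measurable_compose[OF measurable_fst mZ'])
    qed measurable
    then show "(\<lambda>(\<omega>, s). Z' (real_of_int \<lfloor>real (Suc n) * s\<rfloor> / real (Suc n)) \<omega>) \<in> borel_measurable (M \<Otimes>\<^sub>M lborel)"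
      by (simp add: split_beta')
  next
    fix p :: "'a \<times> real" assume "p \<in> space (M \<Otimes>\<^sub>M lborel)"
    then obtain \<omega> s where p: "p = (\<omega>, s)" "\<omega> \<in> space M" by (auto simp: space_pair_measure)
    have "isCont (\<lambda>s. Z' s \<omega>) s"
    proof (cases "\<omega> \<in> N")
      case False
      then have "continuous_on {0..} (\<lambda>t. Z t \<omega>)" using N p by auto
      then have "continuous_on UNIV (\<lambda>s. Z (max 0 s) \<omega>)"
        by (rule continuous_on_compose2) (auto intro!: continuous_intros)
      then show ?thesis using False by (simp add: Z'_def continuous_on_eq_continuous_at)
    qed (simp add: Z'_def)
    then have "(\<lambda>n. Z' (real_of_int \<lfloor>real (Suc n) * s\<rfloor> / real (Suc n)) \<omega>) \<longlonglongrightarrow> Z' s \<omega>"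
      by (rule isCont_tendsto_compose) (rule floor_grid_tendsto)
    then show "(\<lambda>n. case p of (\<omega>, s) \<Rightarrow> Z' (real_of_int \<lfloor>real (Suc n) * s\<rfloor> / real (Suc n)) \<omega>) \<longlonglongrightarrow> (case p of (\<omega>, s) \<Rightarrow> Z' s \<omega>)"
      using p by simp
  qed
  moreover have "AE \<omega> in M. \<forall>s\<ge>0. Z s \<omega> = Z' s \<omega>"
    using AE_not_in[OF N(2)] by eventually_elim (auto simp: Z'_def)
  ultimately show ?thesis unfolding has_measurable_version_def by blast
qed

lemma has_measurable_version_integral:
  assumes "has_measurable_version M H"
  shows "(\<lambda>\<omega>. LBINT s:{0..t}. H s \<omega>) \<in> borel_measurable M"
proof -
  obtain H' where H': "(\<lambda>(\<omega>, s). H' s \<omega>) \<in> borel_measurable (M \<Otimes>\<^sub>M lborel)"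
    "AE \<omega> in M. \<forall>s\<ge>0. H s \<omega> = H' s \<omega>" using assms unfolding has_measurable_version_def by blast
  note [measurable] = H'(1)
  have "(\<lambda>\<omega>. LBINT s:{0..t}. H' s \<omega>) \<in> borel_measurable M"
    unfolding set_lebesgue_integral_def by measurable
  moreover have "AE \<omega> in M. (LBINT s:{0..t}. H' s \<omega>) = (LBINT s:{0..t}. H s \<omega>)"
    using H'(2) by eventually_elim (auto intro!: set_lebesgue_integral_cong)
  ultimately show ?thesis by (rule measurable_AE_eq) simp
qed

lemma has_measurable_version_path:
  assumes "has_measurable_version M H"
  shows "AE \<omega> in M. \<forall>t. set_borel_measurable lborel {0..t} (\<lambda>s. H s \<omega>)"
proof -
  obtain H' where H': "(\<lambda>(\<omega>, s). H' s \<omega>) \<in> borel_measurable (M \<Otimes>\<^sub>M lborel)"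
    "AE \<omega> in M. \<forall>s\<ge>0. H s \<omega> = H' s \<omega>" using assms unfolding has_measurable_version_def by blast
  show ?thesis using H'(2) AE_space
  proof eventually_elim
    case (elim \<omega>)
    have "(\<lambda>s. H' s \<omega>) \<in> borel_measurable lborel"
      using measurable_Pair2[OF H'(1) elim(2)] by simp
    then have "set_borel_measurable lborel {0..t} (\<lambda>s. H' s \<omega>)" for t
      unfolding set_borel_measurable_def by measurable
    moreover have "set_borel_measurable lborel {0..t} (\<lambda>s. H' s \<omega>) = set_borel_measurable lborel {0..t} (\<lambda>s. H s \<omega>)" for t
      unfolding set_borel_measurable_def
      by (rule arg_cong[where f="\<lambda>h. h \<in> borel_measurable lborel"]) (use elim in \<open>auto simp: indicator_def fun_eq_iff\<close>)
    ultimately show ?case by simp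
  qed
qed

lemma has_measurable_version_simple:
  "is_simple F W g J \<Longrightarrow> has_measurable_version M g"
  by (rule has_measurable_versionI) (rule is_simple_measurable)

end

subsection \<open>Square-integrable functions\<close>

definition sq_int :: "real \<Rightarrow> (real \<Rightarrow> real) \<Rightarrow> bool" where
  "sq_int t u \<longleftrightarrow> set_borel_measurable lborel {0..t} u \<and> set_integrable lborel {0..t} (\<lambda>s. (u s)\<^sup>2)"

text \<open>This is the square of the norm of \<open>L\<^sup>2\<close> on the interval; the triangle
  inequality therefore appears with factors 2 and scaling with a square.\<close>

abbreviation sq_norm :: "real \<Rightarrow> (real \<Rightarrow> real) \<Rightarrow> real" where
  "sq_norm t u \<equiv> (LBINT s:{0..t}. (u s)\<^sup>2)"

lemma sq_int_iff:
  "sq_int t u \<longleftrightarrow> (\<lambda>s. indicator {0..t} s * u s) \<in> borel_measurable lborel \<and>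
     integrable lborel (\<lambda>s. (indicator {0..t} s * u s)\<^sup>2)"
proof -
  have "indicator {0..t} s *\<^sub>R (u s)\<^sup>2 = (indicator {0..t} s * u s)\<^sup>2" for s
    by (auto simp: indicator_def)
  then show ?thesis by (simp add: sq_int_def set_borel_measurable_def set_integrable_def)
qed

lemma sq_norm_eq: "sq_norm t u = (LBINT s. (indicator {0..t} s * u s)\<^sup>2)"
  unfolding set_lebesgue_integral_def
  by (rule Bochner_Integration.integral_cong) (auto simp: indicator_def)

lemma sq_norm_nonneg: "0 \<le> sq_norm t u"
  unfolding sq_norm_eq by (rule Bochner_Integration.integral_nonneg) simp

lemma sq_int_dominated:
  assumes v: "sq_int t v" and u: "set_borel_measurable lborel {0..t} u"
    and le: "\<And>s. 0 \<le> s \<Longrightarrow> s \<le> t \<Longrightarrow> \<bar>u s\<bar> \<le> c * \<bar>v s\<bar>"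
  shows "sq_int t u" "sq_norm t u \<le> c\<^sup>2 * sq_norm t v"
proof -
  have um: "(\<lambda>s. indicator {0..t} s * u s) \<in> borel_measurable lborel"
    using u by (simp add: set_borel_measurable_def)
  have vi: "integrable lborel (\<lambda>s. c\<^sup>2 * (indicator {0..t} s * v s)\<^sup>2)"
    using v by (simp add: sq_int_iff)
  have b: "(indicator {0..t} s * u s)\<^sup>2 \<le> c\<^sup>2 * (indicator {0..t} s * v s)\<^sup>2" for s
  proof (cases "s \<in> {0..t}")
    case True
    then have "\<bar>u s\<bar>\<^sup>2 \<le> (c * \<bar>v s\<bar>)\<^sup>2" using le[of s] by (intro power_mono) auto
    then show ?thesis using True by (simp add: power_mult_distrib)
  qed simp
  have ui: "integrable lborel (\<lambda>s. (indicator {0..t} s * u s)\<^sup>2)"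
    by (rule Bochner_Integration.integrable_bound[OF vi]) (use um b in auto)
  show "sq_int t u" using um ui by (simp add: sq_int_iff)
  have "sq_norm t u \<le> (LBINT s. c\<^sup>2 * (indicator {0..t} s * v s)\<^sup>2)"
    unfolding sq_norm_eq by (rule integral_mono[OF ui vi b])
  then show "sq_norm t u \<le> c\<^sup>2 * sq_norm t v" by (simp add: sq_norm_eq)
qed

lemma sq_int_add:
  assumes u: "sq_int t u" and v: "sq_int t v"
  shows "sq_int t (\<lambda>s. u s + v s)" "sq_norm t (\<lambda>s. u s + v s) \<le> 2 * sq_norm t u + 2 * sq_norm t v"
proof -
  have um: "(\<lambda>s. indicator {0..t} s * u s) \<in> borel_measurable lborel"
    and vm: "(\<lambda>s. indicator {0..t} s * v s) \<in> borel_measurable lborel"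
    and ui: "integrable lborel (\<lambda>s. (indicator {0..t} s * u s)\<^sup>2)"
    and vi: "integrable lborel (\<lambda>s. (indicator {0..t} s * v s)\<^sup>2)"
    using u v by (auto simp: sq_int_iff)
  have wm: "(\<lambda>s. indicator {0..t} s * (u s + v s)) \<in> borel_measurable lborel"
    using borel_measurable_add[OF um vm] by (simp add: distrib_left)
  have di: "integrable lborel (\<lambda>s. 2 * (indicator {0..t} s * u s)\<^sup>2 + 2 * (indicator {0..t} s * v s)\<^sup>2)"
    using ui vi by simp
  have b: "(indicator {0..t} s * (u s + v s))\<^sup>2 \<le> 2 * (indicator {0..t} s * u s)\<^sup>2 + 2 * (indicator {0..t} s * v s)\<^sup>2" for s
  proof -
    have "(a + b)\<^sup>2 \<le> 2 * a\<^sup>2 + 2 * b\<^sup>2" for a b :: real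
      using sum_squares_ge_zero[of "a - b" 0] by (simp add: power2_eq_square algebra_simps)
    then show ?thesis by (simp only: distrib_left)
  qed
  have wi: "integrable lborel (\<lambda>s. (indicator {0..t} s * (u s + v s))\<^sup>2)"
    by (rule Bochner_Integration.integrable_bound[OF di]) (use wm b in auto)
  show "sq_int t (\<lambda>s. u s + v s)" using wm wi by (simp add: sq_int_iff)
  have "sq_norm t (\<lambda>s. u s + v s) \<le> (LBINT s. 2 * (indicator {0..t} s * u s)\<^sup>2 + 2 * (indicator {0..t} s * v s)\<^sup>2)"
    unfolding sq_norm_eq by (rule integral_mono[OF wi di b])
  then show "sq_norm t (\<lambda>s. u s + v s) \<le> 2 * sq_norm t u + 2 * sq_norm t v"
    using ui vi by (simp add: sq_norm_eq)
qed

lemma sq_int_cmult: 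
  assumes "sq_int t u" shows "sq_int t (\<lambda>s. c * u s)"
proof -
  have "(\<lambda>s. c * (indicator {0..t} s * u s)) \<in> borel_measurable lborel"
    using assms by (intro borel_measurable_times[OF borel_measurable_const]) (simp add: sq_int_iff)
  then have "set_borel_measurable lborel {0..t} (\<lambda>s. c * u s)"
    by (simp only: set_borel_measurable_def real_scaleR_def mult.left_commute[of c])
  then show ?thesis
    by (rule sq_int_dominated(1)[OF assms, where c="\<bar>c\<bar>"]) (simp add: abs_mult)
qed

lemma sq_int_diff:
  assumes u: "sq_int t u" and v: "sq_int t v"
  shows "sq_int t (\<lambda>s. u s - v s)"
  using sq_int_add(1)[OF u sq_int_cmult[OF v, of "-1"]] by simp

lemma sq_norm_mono:
  assumes "sq_int t' u" "t \<le> t'"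
  shows "sq_int t u" "sq_norm t u \<le> sq_norm t' u"
proof -
  have e: "indicator {0..t} s * u s = indicator {0..t} s * (indicator {0..t'} s * u s)" for s
    using assms by (auto simp: indicator_def)
  have um: "(\<lambda>s. indicator {0..t'} s * u s) \<in> borel_measurable lborel"
    and ui: "integrable lborel (\<lambda>s. (indicator {0..t'} s * u s)\<^sup>2)"
    using assms by (auto simp: sq_int_iff)
  have m: "(\<lambda>s. indicator {0..t} s * u s) \<in> borel_measurable lborel"
    unfolding e using um by measurable
  have b: "(indicator {0..t} s * u s)\<^sup>2 \<le> (indicator {0..t'} s * u s)\<^sup>2" for s
    using assms(2) by (auto simp: indicator_def)
  have i: "integrable lborel (\<lambda>s. (indicator {0..t} s * u s)\<^sup>2)"
    by (rule Bochner_Integration.integrable_bound[OF ui]) (use m b in auto)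
  show "sq_int t u" using m i by (simp add: sq_int_iff)
  show "sq_norm t u \<le> sq_norm t' u"
    unfolding sq_norm_eq by (rule integral_mono[OF i ui b])
qed

lemma sq_int_bounded:
  assumes "set_borel_measurable lborel {0..t} u" "\<And>s. \<bar>u s\<bar> \<le> c"
  shows "sq_int t u"
proof (rule sq_int_dominated(1))
  have *: "(indicator {0..t} s * 1)\<^sup>2 = (indicator {0..t} s :: real)" for s by (auto simp: indicator_def)
  show "sq_int t (\<lambda>_. 1)"
    unfolding sq_int_iff * by (cases "0 \<le> t") (auto intro!: integrable_real_indicator)
qed (use assms in auto)

subsection \<open>Adapted processes\<close>

context stochastic_basis
begin

lemma adapted_measurable:
  assumes "adapted_continuous M F Z" "0 \<le> t"
  shows "Z t \<in> borel_measurable M"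
  using assms measurable_F_M[of t "Z t"] by (simp add: adapted_continuous_def)

lemma adapted_continuous_lincomb:
  fixes I I' :: "real \<Rightarrow> 'a \<Rightarrow> real"
  assumes "adapted_continuous M F I" "adapted_continuous M F I'"
  shows "adapted_continuous M F (\<lambda>t \<omega>. c * I t \<omega> + c' * I' t \<omega>)"
  unfolding adapted_continuous_def
proof (intro conjI allI impI)
  show "(\<lambda>\<omega>. c * I t \<omega> + c' * I' t \<omega>) \<in> borel_measurable (F t)" if "0 \<le> t" for t
    using assms that by (intro borel_measurable_add borel_measurable_times) (auto simp: adapted_continuous_def)
  have "AE \<omega> in M. continuous_on {0..} (\<lambda>t. I t \<omega>)" "AE \<omega> in M. continuous_on {0..} (\<lambda>t. I' t \<omega>)"
    using assms by (auto simp: adapted_continuous_def)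
  then show "AE \<omega> in M. continuous_on {0..} (\<lambda>t. c * I t \<omega> + c' * I' t \<omega>)"
    by eventually_elim (intro continuous_intros)
qed

lemma stopped_measurable:
  assumes I: "adapted_continuous M F I" and x: "0 \<le> x" "0 \<le> t"
  shows "(I (min x t) :: 'a \<Rightarrow> real) \<in> borel_measurable (F t)"
  by (rule measurable_F_mono[of _ "min x t"]) (use I x in \<open>auto simp: adapted_continuous_def\<close>)

lemma increment_adapted_continuous:
  fixes I :: "real \<Rightarrow> 'a \<Rightarrow> real"
  assumes I: "adapted_continuous M F I" and ab: "0 \<le> a" "a \<le> b" and \<phi>: "\<phi> \<in> borel_measurable (F a)"
  shows "adapted_continuous M F (\<lambda>t \<omega>. \<phi> \<omega> * (I (min b t) \<omega> - I (min a t) \<omega>))"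
  unfolding adapted_continuous_def
proof (intro conjI allI impI)
  fix t :: real assume t: "0 \<le> t"
  show "(\<lambda>\<omega>. \<phi> \<omega> * (I (min b t) \<omega> - I (min a t) \<omega>)) \<in> borel_measurable (F t)"
  proof (cases "a \<le> t")
    case True
    then have "\<phi> \<in> borel_measurable (F t)" using measurable_F_mono[OF \<phi>] ab by auto
    then show ?thesis
      by (rule borel_measurable_times[OF _ borel_measurable_diff[OF stopped_measurable[OF I] stopped_measurable[OF I]]])
        (use ab t in simp_all)
  next
    case False
    \<comment> \<open>Before time \<open>a\<close> the factor \<open>\<phi>\<close> may be unknown,
      but both stopped values agree and the product vanishes.\<close>
    then have "min b t = t" "min a t = t" using ab by auto
    then show ?thesis by simp
  qed
next
  have "AE \<omega> in M. continuous_on {0..} (\<lambda>t. I t \<omega>)" using I by (simp add: adapted_continuous_def)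
  then show "AE \<omega> in M. continuous_on {0..} (\<lambda>t. \<phi> \<omega> * (I (min b t) \<omega> - I (min a t) \<omega>))"
  proof eventually_elim
    case (elim \<omega>)
    have "continuous_on {0..} (\<lambda>t. I (min x t) \<omega>)" if "0 \<le> x" for x
      by (rule continuous_on_compose2[OF elim]) (use that in \<open>auto intro!: continuous_intros\<close>)
    then show ?case using ab by (intro continuous_intros) auto
  qed
qed

lemma adapted_AE_LIMSEQ:
  fixes Z :: "real \<Rightarrow> 'a \<Rightarrow> real"
  assumes K: "\<And>m. adapted_continuous M F (K m)"
    and lim: "AE \<omega> in M. \<forall>t\<ge>0. (\<lambda>m. K m t \<omega>) \<longlonglongrightarrow> Z t \<omega>"
    and c: "AE \<omega> in M. continuous_on {0..} (\<lambda>t. Z t \<omega>)"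
  shows "adapted_continuous M F Z"
  unfolding adapted_continuous_def
proof (intro conjI allI impI c)
  fix t :: real assume t: "0 \<le> t"
  show "Z t \<in> borel_measurable (F t)"
  proof (rule measurable_F_AE_LIMSEQ[OF t])
    show "K m t \<in> borel_measurable (F t)" for m using K[of m] t by (simp add: adapted_continuous_def)
    show "AE \<omega> in M. (\<lambda>m. K m t \<omega>) \<longlonglongrightarrow> Z t \<omega>" using lim by eventually_elim (use t in auto)
  qed
qed

lemma is_simple_sq_int:
  assumes g: "is_simple F W g J"
  shows "AE \<omega> in M. \<forall>t. sq_int t (\<lambda>s. g s \<omega>)"
  using has_measurable_version_path[OF has_measurable_version_simple[OF g]] AE_space
proof eventually_elim
  case (elim \<omega>)
  then show ?case using is_simple_bounded[OF g, of \<omega>] by (blast intro: sq_int_bounded)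
qed

lemma sq_norm_measurable:
  "has_measurable_version M H \<Longrightarrow> (\<lambda>\<omega>. sq_norm t (\<lambda>s. H s \<omega>)) \<in> borel_measurable M"
  by (intro has_measurable_version_integral has_measurable_version_power2)

end

subsection \<open>Calculus of Ito integrals\<close>

text \<open>Trades exponential decay for the quadratic decay that produces the power
  \<open>S\<^sup>2 / d ^ 4\<close> in the tail bounds.\<close>

lemma exp_minus_le:
  assumes "0 < x"
  shows "exp (- x) \<le> 2 / (x::real)\<^sup>2"
proof -
  have "x\<^sup>2 / 2 \<le> exp x"
    using exp_lower_Taylor_quadratic[of x] assms by simp
  then have "inverse (exp x) \<le> inverse (x\<^sup>2 / 2)"
    using assms by (intro le_imp_inverse_le) auto
  then show ?thesis by (simp add: exp_minus)
qed

context brownian_motion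
begin

text \<open>The measurable version is carried along so that \<open>sq_norm\<close> of an integrand,
  or of a difference of integrands, is a random variable and convergence in probability of it makes
  sense.\<close>

definition ito :: "'n \<Rightarrow> (real \<Rightarrow> 'a \<Rightarrow> real) \<Rightarrow> (real \<Rightarrow> 'a \<Rightarrow> real) \<Rightarrow> bool" where
  "ito j H I \<longleftrightarrow> has_measurable_version M H \<and> has_ito_integral M F (\<lambda>t \<omega>. B t \<omega> $ j) H I"

lemma B_component_adapted: "adapted_continuous M F (\<lambda>t \<omega>. B t \<omega> $ j)"
  unfolding adapted_continuous_def
proof (intro conjI allI impI)
  show "(\<lambda>\<omega>. B t \<omega> $ j) \<in> borel_measurable (F t)" if "0 \<le> t" for t
    by (rule measurable_compose[OF _ borel_measurable_vec_nth])
      (use B_adapted_continuous that in \<open>simp add: adapted_continuous_def\<close>)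
  have "AE \<omega> in M. continuous_on {0..} (\<lambda>t. B t \<omega>)"
    using B_adapted_continuous by (simp add: adapted_continuous_def)
  then show "AE \<omega> in M. continuous_on {0..} (\<lambda>t. B t \<omega> $ j)"
    by eventually_elim (intro continuous_intros)
qed

lemma itoD:
  assumes "ito j H I"
  shows "has_measurable_version M H" "AE \<omega> in M. \<forall>t\<ge>0. sq_int t (\<lambda>s. H s \<omega>)"
    "adapted_continuous M F I" "\<And>t. 0 \<le> t \<Longrightarrow> I t \<in> borel_measurable M"
  using assms measurable_F_M unfolding ito_def has_ito_integral_def sq_int_def adapted_continuous_def
  by auto

lemma ito_approx:
  assumes "ito j H I"
  obtains g J where "\<And>k. is_simple F (\<lambda>t \<omega>. B t \<omega> $ j) (g k) (J k)"
    "\<And>t. 0 \<le> t \<Longrightarrow> tzip (\<lambda>k \<omega>. sq_norm t (\<lambda>s. g k s \<omega> - H s \<omega>))"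
    "\<And>t. 0 \<le> t \<Longrightarrow> tzip (\<lambda>k \<omega>. J k t \<omega> - I t \<omega>)"
proof -
  obtain m \<tau> \<xi> where *: "\<forall>k. simple_process F (m k) (\<tau> k) (\<xi> k)" "\<forall>t\<ge>0.
           tzip
             (\<lambda>k \<omega>. LBINT s:{0..t}. (simple_value (m k) (\<tau> k) (\<xi> k) s \<omega> - H s \<omega>)\<^sup>2) \<and>
           tzip
             (\<lambda>k \<omega>. simple_integral_wrt (\<lambda>t \<omega>. B t \<omega> $ j) (m k) (\<tau> k) (\<xi> k) t \<omega> - I t \<omega>)"
    using assms unfolding ito_def has_ito_integral_def by blast
  show ?thesis
    by (rule that[of "\<lambda>k. simple_value (m k) (\<tau> k) (\<xi> k)" "\<lambda>k. simple_integral_wrt (\<lambda>t \<omega>. B t \<omega> $ j) (m k) (\<tau> k) (\<xi> k)"])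
      (use * in \<open>auto simp: is_simple_def\<close>)
qed

lemma itoI:
  assumes "has_measurable_version M H" "AE \<omega> in M. \<forall>t\<ge>0. sq_int t (\<lambda>s. H s \<omega>)"
    "adapted_continuous M F I" and s: "\<And>k. is_simple F (\<lambda>t \<omega>. B t \<omega> $ j) (g k) (J k)"
    and "\<And>t. 0 \<le> t \<Longrightarrow> tzip (\<lambda>k \<omega>. sq_norm t (\<lambda>s. g k s \<omega> - H s \<omega>))"
    "\<And>t. 0 \<le> t \<Longrightarrow> tzip (\<lambda>k \<omega>. J k t \<omega> - I t \<omega>)"
  shows "ito j H I"
proof -
  have "\<forall>k. \<exists>m \<tau> \<xi>. simple_process F m \<tau> \<xi> \<and> g k = simple_value m \<tau> \<xi> \<and>
     J k = simple_integral_wrt (\<lambda>t \<omega>. B t \<omega> $ j) m \<tau> \<xi>"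
    using s unfolding is_simple_def by blast
  then obtain m \<tau> \<xi> where *: "\<And>k. simple_process F (m k) (\<tau> k) (\<xi> k)"
     "\<And>k. g k = simple_value (m k) (\<tau> k) (\<xi> k)"
     "\<And>k. J k = simple_integral_wrt (\<lambda>t \<omega>. B t \<omega> $ j) (m k) (\<tau> k) (\<xi> k)" by metis
  show ?thesis
    unfolding ito_def has_ito_integral_def
    using assms(1-3,5-6) *(1) unfolding *(2,3) sq_int_def by blast
qed

text \<open>The factor \<open>l\<^sup>2\<close> in place of \<open>l\<^sup>2 / 2\<close> pays for the passage to the limit through
  \<open>g\<^sup>2 \<le> 2 H\<^sup>2 + 2 (g - H)\<^sup>2\<close>.\<close>

lemma ito_exp_moment:
  assumes I: "ito j H I" and t: "0 \<le> t"
  shows "(\<integral>\<^sup>+\<omega>. ennreal (exp (l * I t \<omega> - l\<^sup>2 * sq_norm t (\<lambda>s. H s \<omega>))) \<partial>M) \<le> 1"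
proof -
  obtain g J where s: "\<And>k. is_simple F (\<lambda>t \<omega>. B t \<omega> $ j) (g k) (J k)"
    and D: "\<And>t. 0 \<le> t \<Longrightarrow> tzip (\<lambda>k \<omega>. sq_norm t (\<lambda>s. g k s \<omega> - H s \<omega>))"
    and J: "\<And>t. 0 \<le> t \<Longrightarrow> tzip (\<lambda>k \<omega>. J k t \<omega> - I t \<omega>)"
    using ito_approx[OF I] by blast
  \<comment> \<open>Two successive extractions give one subsequence along which both the integrands
    and the integrals converge almost surely.\<close>
  obtain r where r: "strict_mono r" "AE \<omega> in M. (\<lambda>k. sq_norm t (\<lambda>s. g (r k) s \<omega> - H s \<omega>)) \<longlonglongrightarrow> 0"
    using tzip_AE_subseq[OF D[OF t]] by blast
  obtain q where q: "strict_mono q" "AE \<omega> in M. (\<lambda>k. J (r (q k)) t \<omega> - I t \<omega>) \<longlonglongrightarrow> 0"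
    using tzip_AE_subseq[OF tzip_subseq[OF J[OF t] r(1)]] by blast
  define p where "p k = r (q k)" for k
  have D': "AE \<omega> in M. (\<lambda>k. sq_norm t (\<lambda>s. g (p k) s \<omega> - H s \<omega>)) \<longlonglongrightarrow> 0"
    using r(2) by eventually_elim (auto simp: p_def dest: LIMSEQ_subseq_LIMSEQ[OF _ q(1)] simp: o_def)
  have J': "AE \<omega> in M. (\<lambda>k. J (p k) t \<omega> - I t \<omega>) \<longlonglongrightarrow> 0"
    using q(2) by (simp add: p_def)
  have mJ: "J k t \<in> borel_measurable M" for k
    using is_simple_adapted[OF s[of k] B_component_adapted] t measurable_F_M
    by (auto simp: adapted_continuous_def)
  have mg: "(\<lambda>\<omega>. sq_norm t (\<lambda>s. g k s \<omega>)) \<in> borel_measurable M" for k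
    by (intro sq_norm_measurable has_measurable_version_simple[OF s])
  let ?f = "\<lambda>k \<omega>. ennreal (exp (l * J (p k) t \<omega> - l\<^sup>2 * sq_norm t (\<lambda>s. g (p k) s \<omega>) / 2))"
  have one: "(\<integral>\<^sup>+\<omega>. ?f k \<omega> \<partial>M) = 1" for k
  proof -
    obtain m \<tau> \<xi> where *: "simple_process F m \<tau> \<xi>" "g (p k) = simple_value m \<tau> \<xi>"
        "J (p k) = simple_integral_wrt (\<lambda>t \<omega>. B t \<omega> $ j) m \<tau> \<xi>"
      using s[of "p k"] unfolding is_simple_def by blast
    show ?thesis using simple_exp_moment[OF *(1) t] by (simp add: *(2,3))
  qed
  have "AE \<omega> in M. ennreal (exp (l * I t \<omega> - l\<^sup>2 * sq_norm t (\<lambda>s. H s \<omega>))) \<le> liminf (\<lambda>k. ?f k \<omega>)"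
  proof -
    have "AE \<omega> in M. \<forall>k. \<forall>t. sq_int t (\<lambda>s. g k s \<omega>)"
      using is_simple_sq_int[OF s] by (simp add: AE_all_countable)
    then show ?thesis using D' J' itoD(2)[OF I]
    proof eventually_elim
      case (elim \<omega>)
      let ?D = "\<lambda>k. sq_norm t (\<lambda>s. g (p k) s \<omega> - H s \<omega>)"
      \<comment> \<open>A lower bound for the integrand of mean one in which everything random in
        \<open>k\<close> converges; its limit is the exponential of the claim, so Fatou's lemma
        finishes the proof.\<close>
      let ?h = "\<lambda>k. exp (l * (J (p k) t \<omega> - I t \<omega>) + l * I t \<omega> - l\<^sup>2 * sq_norm t (\<lambda>s. H s \<omega>) - l\<^sup>2 * ?D k)"
      have "sq_norm t (\<lambda>s. g (p k) s \<omega>) \<le> 2 * ?D k + 2 * sq_norm t (\<lambda>s. H s \<omega>)" for k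
      proof -
        have "sq_int t (\<lambda>s. H s \<omega>)" "sq_int t (\<lambda>s. g (p k) s \<omega>)" using elim t by auto
        then show ?thesis
          using sq_int_add(2)[of t "\<lambda>s. g (p k) s \<omega> - H s \<omega>" "\<lambda>s. H s \<omega>"] sq_int_diff by simp
      qed
      then have q: "l\<^sup>2 * sq_norm t (\<lambda>s. g (p k) s \<omega>) \<le> l\<^sup>2 * (2 * ?D k + 2 * sq_norm t (\<lambda>s. H s \<omega>))" for k
        by (intro mult_left_mono) auto
      have "l * (x - y) + l * y - l\<^sup>2 * a - l\<^sup>2 * b \<le> l * x - l\<^sup>2 * c / 2"
        if "l\<^sup>2 * c \<le> l\<^sup>2 * (2 * b + 2 * a)" for x y a b c :: real
        using that by (simp add: algebra_simps)
      from this[OF q] have le: "ennreal (?h k) \<le> ?f k \<omega>" for k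
        by (intro ennreal_leI) (simp only: exp_le_cancel_iff)
      have "?h \<longlonglongrightarrow> exp (l * 0 + l * I t \<omega> - l\<^sup>2 * sq_norm t (\<lambda>s. H s \<omega>) - l\<^sup>2 * 0)"
        by (intro tendsto_intros elim)
      then have "(\<lambda>k. ennreal (?h k)) \<longlonglongrightarrow> ennreal (exp (l * I t \<omega> - l\<^sup>2 * sq_norm t (\<lambda>s. H s \<omega>)))"
        by (intro tendsto_ennrealI) simp
      then have "ennreal (exp (l * I t \<omega> - l\<^sup>2 * sq_norm t (\<lambda>s. H s \<omega>))) = liminf (\<lambda>k. ennreal (?h k))"
        by (intro lim_imp_Liminf[symmetric]) auto
      also have "\<dots> \<le> liminf (\<lambda>k. ?f k \<omega>)"
        by (rule Liminf_mono) (use le in auto)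
      finally show ?case .
    qed
  qed
  then have "(\<integral>\<^sup>+\<omega>. ennreal (exp (l * I t \<omega> - l\<^sup>2 * sq_norm t (\<lambda>s. H s \<omega>))) \<partial>M) \<le> (\<integral>\<^sup>+\<omega>. liminf (\<lambda>k. ?f k \<omega>) \<partial>M)"
    by (rule nn_integral_mono_AE)
  also have "\<dots> \<le> liminf (\<lambda>k. \<integral>\<^sup>+\<omega>. ?f k \<omega> \<partial>M)"
    by (rule nn_integral_liminf) (use mJ mg in measurable)
  also have "\<dots> = 1" by (simp add: one Liminf_const)
  finally show ?thesis .
qed

lemma ito_tail_one_sided:
  assumes I: "ito j H I" and t: "0 \<le> t" and d: "0 < d" and S: "0 < S" and \<sigma>: "\<bar>\<sigma>\<bar> = 1"
  shows "prob {\<omega> \<in> space M. d < \<sigma> * I t \<omega> \<and> sq_norm t (\<lambda>s. H s \<omega>) \<le> S} \<le> 32 * S\<^sup>2 / d ^ 4"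
proof -
  \<comment> \<open>This \<open>l\<close> maximises \<open>l * d - l\<^sup>2 * S\<close>; the
    maximum is \<open>d\<^sup>2 / (4 * S)\<close>, the exponent in Markov's inequality below. The
    factor 32 is \<open>2 * 4\<^sup>2\<close> from \<open>exp_minus_le\<close>.\<close>
  define l where "l = d / (2 * S)"
  let ?A = "{\<omega> \<in> space M. d < \<sigma> * I t \<omega> \<and> sq_norm t (\<lambda>s. H s \<omega>) \<le> S}"
  have [measurable]: "I t \<in> borel_measurable M" "(\<lambda>\<omega>. sq_norm t (\<lambda>s. H s \<omega>)) \<in> borel_measurable M"
    using itoD[OF I] t by (auto intro: sq_norm_measurable)
  have A: "?A \<in> sets M" by measurable
  let ?x = "d\<^sup>2 / (4 * S)"
  have x: "0 < ?x" using d S by simp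
  have sg: "\<sigma>\<^sup>2 = 1" using \<sigma> by (metis one_power2 power2_abs)
  have "ennreal (exp ?x) * indicator ?A \<omega> \<le> ennreal (exp ((l * \<sigma>) * I t \<omega> - (l * \<sigma>)\<^sup>2 * sq_norm t (\<lambda>s. H s \<omega>)))" for \<omega>
  proof (cases "\<omega> \<in> ?A")
    case True
    have "l * d \<le> l * (\<sigma> * I t \<omega>)" using True d S by (intro mult_left_mono) (auto simp: l_def)
    moreover have "l\<^sup>2 * sq_norm t (\<lambda>s. H s \<omega>) \<le> l\<^sup>2 * S" using True by (intro mult_left_mono) auto
    moreover have "l * d - l\<^sup>2 * S = ?x" using S by (simp add: l_def field_simps power2_eq_square)
    ultimately show ?thesis using True by (simp add: ennreal_leI power_mult_distrib sg mult.assoc)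
  qed simp
  then have "(\<integral>\<^sup>+\<omega>. ennreal (exp ?x) * indicator ?A \<omega> \<partial>M) \<le> 1"
    by (intro order_trans[OF nn_integral_mono ito_exp_moment[OF I t, of "l * \<sigma>"]]) auto
  then have "ennreal (exp ?x * prob ?A) \<le> ennreal 1"
    using A by (simp add: nn_integral_cmult_indicator emeasure_eq_measure ennreal_mult')
  then have "exp ?x * prob ?A \<le> 1"
    by (subst (asm) ennreal_le_iff) auto
  then have "prob ?A \<le> exp (- ?x)"
    by (simp add: exp_minus field_simps)
  also have "\<dots> \<le> 2 / ?x\<^sup>2" by (rule exp_minus_le[OF x])
  also have "\<dots> = 32 * S\<^sup>2 / d ^ 4"
    using d S by (simp add: field_simps power2_eq_square power4_eq_xxxx)
  finally show ?thesis .
qed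

text \<open>The quadratic dependence on \<open>S\<close> is what makes the exceptional probabilities below summable
  over a partition with vanishing mesh.\<close>

lemma ito_tail:
  assumes I: "ito j H I" and t: "0 \<le> t" and d: "0 < d" and S: "0 < S"
  shows "prob {\<omega> \<in> space M. d < \<bar>I t \<omega>\<bar> \<and> sq_norm t (\<lambda>s. H s \<omega>) \<le> S} \<le> 64 * S\<^sup>2 / d ^ 4"
proof -
  have [measurable]: "I t \<in> borel_measurable M" "(\<lambda>\<omega>. sq_norm t (\<lambda>s. H s \<omega>)) \<in> borel_measurable M"
    using itoD[OF I] t by (auto intro: sq_norm_measurable)
  have "prob {\<omega> \<in> space M. d < \<bar>I t \<omega>\<bar> \<and> sq_norm t (\<lambda>s. H s \<omega>) \<le> S} \<le>
    prob ({\<omega> \<in> space M. d < 1 * I t \<omega> \<and> sq_norm t (\<lambda>s. H s \<omega>) \<le> S} \<union>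
      {\<omega> \<in> space M. d < (-1) * I t \<omega> \<and> sq_norm t (\<lambda>s. H s \<omega>) \<le> S})"
    by (rule finite_measure_mono) auto
  also have "\<dots> \<le> prob {\<omega> \<in> space M. d < 1 * I t \<omega> \<and> sq_norm t (\<lambda>s. H s \<omega>) \<le> S} +
     prob {\<omega> \<in> space M. d < (-1) * I t \<omega> \<and> sq_norm t (\<lambda>s. H s \<omega>) \<le> S}"
    by (rule measure_Un_le) auto
  also have "\<dots> \<le> 32 * S\<^sup>2 / d ^ 4 + 32 * S\<^sup>2 / d ^ 4"
    by (intro add_mono ito_tail_one_sided[OF I t d S]) auto
  finally show ?thesis by simp
qed

text \<open>The continuity of the Ito integral in probability. Splitting off the event that the
  energy exceeds \<open>S\<close> reduces it to \<open>ito_tail\<close>, so neither moments of the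
  integrands nor stopping are needed.\<close>

lemma ito_tendsto_zero:
  assumes I: "\<And>k. ito j (H k) (I k)" and t: "0 \<le> t"
    and D: "tzip (\<lambda>k \<omega>. sq_norm t (\<lambda>s. H k s \<omega>))"
  shows "tzip (\<lambda>k. I k t)"
  unfolding tendsto_zero_in_probability_def
proof (intro conjI allI impI)
  show Im: "I k t \<in> borel_measurable M" for k using itoD[OF I] t by auto
  fix e :: real assume e: "0 < e"
  have Dm: "(\<lambda>\<omega>. sq_norm t (\<lambda>s. H k s \<omega>)) \<in> borel_measurable M" for k
    using D by (rule tzip_borel)
  note [measurable] = Im Dm
  show "(\<lambda>k. prob {\<omega> \<in> space M. e < \<bar>I k t \<omega>\<bar>}) \<longlonglongrightarrow> 0"
  proof (rule LIMSEQ_I)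
    fix r :: real assume r: "0 < r"
    define S where "S = sqrt (r * e ^ 4 / 128)"
    have S: "0 < S" "64 * S\<^sup>2 / e ^ 4 = r / 2" using r e by (auto simp: S_def)
    have "(\<lambda>k. prob {\<omega> \<in> space M. S < \<bar>sq_norm t (\<lambda>s. H k s \<omega>)\<bar>}) \<longlonglongrightarrow> 0"
      using D S unfolding tendsto_zero_in_probability_def by blast
    then have "eventually (\<lambda>k. prob {\<omega> \<in> space M. S < \<bar>sq_norm t (\<lambda>s. H k s \<omega>)\<bar>} < r / 2) sequentially"
      using r by (intro order_tendstoD) auto
    then obtain N where N: "\<And>k. k \<ge> N \<Longrightarrow> prob {\<omega> \<in> space M. S < \<bar>sq_norm t (\<lambda>s. H k s \<omega>)\<bar>} < r / 2"
      by (auto simp: eventually_sequentially)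
    have "norm (prob {\<omega> \<in> space M. e < \<bar>I k t \<omega>\<bar>} - 0) < r" if "k \<ge> N" for k
    proof -
      have "prob {\<omega> \<in> space M. e < \<bar>I k t \<omega>\<bar>} \<le>
        prob ({\<omega> \<in> space M. e < \<bar>I k t \<omega>\<bar> \<and> sq_norm t (\<lambda>s. H k s \<omega>) \<le> S} \<union>
          {\<omega> \<in> space M. S < \<bar>sq_norm t (\<lambda>s. H k s \<omega>)\<bar>})"
        by (rule finite_measure_mono) auto
      also have "\<dots> \<le> prob {\<omega> \<in> space M. e < \<bar>I k t \<omega>\<bar> \<and> sq_norm t (\<lambda>s. H k s \<omega>) \<le> S} +
          prob {\<omega> \<in> space M. S < \<bar>sq_norm t (\<lambda>s. H k s \<omega>)\<bar>}"
        by (rule measure_Un_le) auto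
      also have "\<dots> < r"
        using ito_tail[OF I t e S(1), of k] N[OF that] S(2) by simp
      finally show ?thesis by simp
    qed
    then show "\<exists>no. \<forall>k\<ge>no. norm (prob {\<omega> \<in> space M. e < \<bar>I k t \<omega>\<bar>} - 0) < r" by blast
  qed
qed

lemma ito_simple:
  assumes g: "is_simple F (\<lambda>t \<omega>. B t \<omega> $ j) g J"
  shows "ito j g J"
proof (rule itoI[OF has_measurable_version_simple[OF g] _ is_simple_adapted[OF g B_component_adapted] g])
  show "AE \<omega> in M. \<forall>t\<ge>0. sq_int t (\<lambda>s. g s \<omega>)"
    using is_simple_sq_int[OF g] by eventually_elim auto
  show "tzip (\<lambda>k \<omega>. sq_norm t (\<lambda>s. g s \<omega> - g s \<omega>))" for t
    using tzip_zero by (simp add: set_lebesgue_integral_def)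
  show "tzip (\<lambda>k \<omega>. J t \<omega> - J t \<omega>)" for t
    using tzip_zero by simp
qed

lemma ito_lincomb:
  assumes I: "ito j H I" and I': "ito j H' I'"
  shows "ito j (\<lambda>s \<omega>. c * H s \<omega> + c' * H' s \<omega>) (\<lambda>t \<omega>. c * I t \<omega> + c' * I' t \<omega>)"
proof -
  obtain g J where s: "\<And>k. is_simple F (\<lambda>t \<omega>. B t \<omega> $ j) (g k) (J k)"
    and D: "\<And>t. 0 \<le> t \<Longrightarrow> tzip (\<lambda>k \<omega>. sq_norm t (\<lambda>s. g k s \<omega> - H s \<omega>))"
    and J: "\<And>t. 0 \<le> t \<Longrightarrow> tzip (\<lambda>k \<omega>. J k t \<omega> - I t \<omega>)"
    using ito_approx[OF I] by blast
  obtain g' J' where s': "\<And>k. is_simple F (\<lambda>t \<omega>. B t \<omega> $ j) (g' k) (J' k)"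
    and D': "\<And>t. 0 \<le> t \<Longrightarrow> tzip (\<lambda>k \<omega>. sq_norm t (\<lambda>s. g' k s \<omega> - H' s \<omega>))"
    and J': "\<And>t. 0 \<le> t \<Longrightarrow> tzip (\<lambda>k \<omega>. J' k t \<omega> - I' t \<omega>)"
    using ito_approx[OF I'] by blast
  have hmv: "has_measurable_version M (\<lambda>s \<omega>. c * G s \<omega> + c' * G' s \<omega>)"
    if "has_measurable_version M G" "has_measurable_version M G'" for G G'
    using that by (rule has_measurable_version_binop) measurable
  have Hm: "has_measurable_version M (\<lambda>s \<omega>. c * H s \<omega> + c' * H' s \<omega>)"
    by (rule hmv) (use itoD[OF I] itoD[OF I'] in auto)
  have gm: "has_measurable_version M (\<lambda>s \<omega>. c * g k s \<omega> + c' * g' k s \<omega>)" for k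
    by (intro hmv has_measurable_version_simple[OF s] has_measurable_version_simple[OF s'])
  have Jm: "J k t \<in> borel_measurable M" "J' k t \<in> borel_measurable M" if "0 \<le> t" for k t
    using itoD(4)[OF ito_simple[OF s]] itoD(4)[OF ito_simple[OF s']] that by auto
  show ?thesis
  proof (rule itoI[OF Hm _ adapted_continuous_lincomb is_simple_lincomb[OF s s']])
    show "AE \<omega> in M. \<forall>t\<ge>0. sq_int t (\<lambda>s. c * H s \<omega> + c' * H' s \<omega>)"
      using itoD(2)[OF I] itoD(2)[OF I'] by eventually_elim (auto intro!: sq_int_add(1) sq_int_cmult)
    show "adapted_continuous M F I" "adapted_continuous M F I'"
      using itoD(3)[OF I] itoD(3)[OF I'] by auto
    fix t :: real assume t: "0 \<le> t"
    show "tzip (\<lambda>k \<omega>. sq_norm t (\<lambda>s. c * g k s \<omega> + c' * g' k s \<omega> - (c * H s \<omega> + c' * H' s \<omega>)))"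
    proof (rule tzip_bound)
      show "tzip (\<lambda>k \<omega>. 2 * c\<^sup>2 * sq_norm t (\<lambda>s. g k s \<omega> - H s \<omega>))"
        by (rule tzip_cmult[OF D[OF t], where c="2 * c\<^sup>2"])
          (use tzip_borel[OF D[OF t]] in \<open>auto simp: abs_mult\<close>)
      show "tzip (\<lambda>k \<omega>. 2 * c'\<^sup>2 * sq_norm t (\<lambda>s. g' k s \<omega> - H' s \<omega>))"
        by (rule tzip_cmult[OF D'[OF t], where c="2 * c'\<^sup>2"])
          (use tzip_borel[OF D'[OF t]] in \<open>auto simp: abs_mult\<close>)
      show "(\<lambda>\<omega>. sq_norm t (\<lambda>s. c * g k s \<omega> + c' * g' k s \<omega> - (c * H s \<omega> + c' * H' s \<omega>))) \<in> borel_measurable M" for k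
        by (intro sq_norm_measurable has_measurable_version_diff gm Hm)
      show "AE \<omega> in M. \<bar>sq_norm t (\<lambda>s. c * g k s \<omega> + c' * g' k s \<omega> - (c * H s \<omega> + c' * H' s \<omega>))\<bar>
         \<le> \<bar>2 * c\<^sup>2 * sq_norm t (\<lambda>s. g k s \<omega> - H s \<omega>)\<bar> + \<bar>2 * c'\<^sup>2 * sq_norm t (\<lambda>s. g' k s \<omega> - H' s \<omega>)\<bar>" for k
        using itoD(2)[OF I] itoD(2)[OF I'] is_simple_sq_int[OF s[of k]] is_simple_sq_int[OF s'[of k]]
      proof eventually_elim
        case (elim \<omega>)
        have a: "sq_int t (\<lambda>s. g k s \<omega> - H s \<omega>)" "sq_int t (\<lambda>s. g' k s \<omega> - H' s \<omega>)"
          using elim t by (auto intro: sq_int_diff)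
        have b: "sq_norm t (\<lambda>s. x * u s) = x\<^sup>2 * sq_norm t u" for x u
          by (simp add: power_mult_distrib)
        have "sq_norm t (\<lambda>s. c * (g k s \<omega> - H s \<omega>) + c' * (g' k s \<omega> - H' s \<omega>)) \<le>
          2 * sq_norm t (\<lambda>s. c * (g k s \<omega> - H s \<omega>)) + 2 * sq_norm t (\<lambda>s. c' * (g' k s \<omega> - H' s \<omega>))"
          by (intro sq_int_add sq_int_cmult a)
        then have le: "sq_norm t (\<lambda>s. c * (g k s \<omega> - H s \<omega>) + c' * (g' k s \<omega> - H' s \<omega>)) \<le>
          2 * c\<^sup>2 * sq_norm t (\<lambda>s. g k s \<omega> - H s \<omega>) + 2 * c'\<^sup>2 * sq_norm t (\<lambda>s. g' k s \<omega> - H' s \<omega>)"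
          unfolding b by simp
        have eq: "(\<lambda>s. c * g k s \<omega> + c' * g' k s \<omega> - (c * H s \<omega> + c' * H' s \<omega>)) =
          (\<lambda>s. c * (g k s \<omega> - H s \<omega>) + c' * (g' k s \<omega> - H' s \<omega>))"
          by (auto simp: algebra_simps)
        show ?case
          using arg_cong[OF eq, of "sq_norm t"] le by (simp add: abs_mult sq_norm_nonneg)
      qed
    qed
    show "tzip (\<lambda>k \<omega>. c * J k t \<omega> + c' * J' k t \<omega> - (c * I t \<omega> + c' * I' t \<omega>))"
    proof (rule tzip_bound)
      show "tzip (\<lambda>k \<omega>. c * (J k t \<omega> - I t \<omega>))"
        by (rule tzip_cmult[OF J[OF t], where c="\<bar>c\<bar>"])
          (use tzip_borel[OF J[OF t]] in \<open>auto simp: abs_mult\<close>)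
      show "tzip (\<lambda>k \<omega>. c' * (J' k t \<omega> - I' t \<omega>))"
        by (rule tzip_cmult[OF J'[OF t], where c="\<bar>c'\<bar>"])
          (use tzip_borel[OF J'[OF t]] in \<open>auto simp: abs_mult\<close>)
      show "(\<lambda>\<omega>. c * J k t \<omega> + c' * J' k t \<omega> - (c * I t \<omega> + c' * I' t \<omega>)) \<in> borel_measurable M" for k
        using Jm[OF t, of k] itoD(4)[OF I t] itoD(4)[OF I' t] by measurable
      have "c * J k t \<omega> + c' * J' k t \<omega> - (c * I t \<omega> + c' * I' t \<omega>) = c * (J k t \<omega> - I t \<omega>) + c' * (J' k t \<omega> - I' t \<omega>)" for k \<omega>
        by (simp add: algebra_simps)
      then show "AE \<omega> in M. \<bar>c * J k t \<omega> + c' * J' k t \<omega> - (c * I t \<omega> + c' * I' t \<omega>)\<bar>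
          \<le> \<bar>c * (J k t \<omega> - I t \<omega>)\<bar> + \<bar>c' * (J' k t \<omega> - I' t \<omega>)\<bar>" for k
        by (simp add: abs_triangle_ineq)
    qed
  qed
qed

lemma ito_zero: "ito j (\<lambda>s \<omega>. 0) (\<lambda>t \<omega>. 0)"
proof -
  have "is_simple F (\<lambda>t \<omega>. B t \<omega> $ j) (\<lambda>s \<omega>. 0) (\<lambda>t \<omega>. 0)"
    using is_simple_family[of "{}::nat set" "\<lambda>_. 0" "\<lambda>_. 0" undefined "\<lambda>t \<omega>. B t \<omega> $ j"] by simp
  then show ?thesis by (rule ito_simple)
qed

lemma ito_add: "ito j H I \<Longrightarrow> ito j H' I' \<Longrightarrow> ito j (\<lambda>s \<omega>. H s \<omega> + H' s \<omega>) (\<lambda>t \<omega>. I t \<omega> + I' t \<omega>)"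
  using ito_lincomb[of j H I H' I' 1 1] by simp

lemma ito_diff: "ito j H I \<Longrightarrow> ito j H' I' \<Longrightarrow> ito j (\<lambda>s \<omega>. H s \<omega> - H' s \<omega>) (\<lambda>t \<omega>. I t \<omega> - I' t \<omega>)"
  using ito_lincomb[of j H I H' I' 1 "-1"] by simp

lemma ito_sum:
  assumes "finite A" "\<And>i. i \<in> A \<Longrightarrow> ito j (H i) (I i)"
  shows "ito j (\<lambda>s \<omega>. \<Sum>i\<in>A. H i s \<omega>) (\<lambda>t \<omega>. \<Sum>i\<in>A. I i t \<omega>)"
  using assms by (induction A) (auto simp: ito_zero intro!: ito_add)

end

subsection \<open>Riemann-Stieltjes sums\<close>

text \<open>The \<open>(m + 1)\<^sup>2\<close> cells of mesh \<open>1 / (m + 1)\<close> exhaust \<open>(0, m + 1]\<close>, so a single sequence of grids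
  serves all time horizons.\<close>

definition grid :: "nat \<Rightarrow> nat \<Rightarrow> real" where
  "grid m i = real i / real (Suc m)"

definition grid_step :: "nat \<Rightarrow> (nat \<Rightarrow> real) \<Rightarrow> real \<Rightarrow> real" where
  "grid_step m z s = (\<Sum>i<(Suc m)\<^sup>2. z i * indicator {grid m i<..grid m (Suc i)} s)"

lemma grid_nonneg: "0 \<le> grid m i"
  by (simp add: grid_def)

lemma grid_0: "grid m 0 = 0"
  by (simp add: grid_def)

lemma grid_Suc: "grid m (Suc i) = grid m i + 1 / real (Suc m)"
  by (simp add: grid_def add_divide_distrib)

lemma grid_mono: "i \<le> j \<Longrightarrow> grid m i \<le> grid m j"
  by (simp add: grid_def divide_right_mono)

lemma grid_end: "grid m ((Suc m)\<^sup>2) = real (Suc m)"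
  unfolding grid_def power2_eq_square of_nat_mult by (simp del: of_nat_Suc)

lemma grid_step_eq:
  assumes i: "i < (Suc m)\<^sup>2" and s: "grid m i < s" "s \<le> grid m (Suc i)"
  shows "grid_step m z s = z i"
proof -
  have other: "s \<notin> {grid m k<..grid m (Suc k)}" if "k \<noteq> i" for k
  proof (cases "k < i")
    case True
    then show ?thesis using grid_mono[of "Suc k" i m] s by auto
  next
    case False
    then show ?thesis using grid_mono[of "Suc i" k m] s that by auto
  qed
  have "grid_step m z s = (\<Sum>k<(Suc m)\<^sup>2. if k = i then z i else 0)"
    unfolding grid_step_def using s other by (intro sum.cong refl) (auto simp: indicator_def)
  then show ?thesis using i by simp
qed

lemma grid_cell:
  assumes "0 < s" "s \<le> real (Suc m)"
  obtains i where "i < (Suc m)\<^sup>2" "grid m i < s" "s \<le> grid m (Suc i)"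
proof -
  define P where "P i \<longleftrightarrow> s \<le> grid m i" for i
  define k where "k = (LEAST i. P i)"
  have "P ((Suc m)\<^sup>2)" using assms by (simp only: P_def grid_end)
  then have k: "P k" "k \<le> (Suc m)\<^sup>2" unfolding k_def by (rule LeastI, rule Least_le)
  have "k \<noteq> 0"
  proof
    assume "k = 0"
    then show False using k(1) assms(1) unfolding P_def by (simp add: grid_0)
  qed
  then obtain i where i: "k = Suc i" by (cases k) auto
  have "\<not> P i" using not_less_Least[of i P] i by (simp add: k_def[symmetric])
  then show ?thesis using that[of i] k i by (auto simp: P_def)
qed

lemma grid_step_cases:
  obtains i where "i < (Suc m)\<^sup>2" "grid m i < s" "s \<le> grid m (Suc i)" "\<And>z. grid_step m z s = z i"
  | "s \<le> 0 \<or> real (Suc m) < s" "\<And>z. grid_step m z s = 0"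
proof (cases "\<exists>i<(Suc m)\<^sup>2. s \<in> {grid m i<..grid m (Suc i)}")
  case True
  then show ?thesis using that(1) grid_step_eq by auto
next
  case False
  then have "\<And>z. grid_step m z s = 0" by (auto simp: grid_step_def indicator_def intro!: sum.neutral)
  moreover have "s \<le> 0 \<or> real (Suc m) < s" using False grid_cell[of s m] by force
  ultimately show ?thesis using that(2) by blast
qed

lemma grid_step_measurable [measurable]: "grid_step m z \<in> borel_measurable borel"
  unfolding grid_step_def by measurable

lemma continuous_on_bounded_interval:
  fixes y :: "real \<Rightarrow> real"
  assumes "continuous_on {0..t} y"
  obtains K where "0 \<le> K" "\<And>s. 0 \<le> s \<Longrightarrow> s \<le> t \<Longrightarrow> \<bar>y s\<bar> \<le> K"
proof -
  have "bounded (y ` {0..t})" using assms by (intro compact_imp_bounded compact_continuous_image) auto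
  then obtain K where "\<forall>x\<in>y ` {0..t}. norm x \<le> K" by (auto simp: bounded_iff)
  then have "\<bar>y s\<bar> \<le> max 0 K" if "0 \<le> s" "s \<le> t" for s using that by (fastforce simp: le_max_iff_disj)
  then show ?thesis using that[of "max 0 K"] by simp
qed

text \<open>The sampling point within a cell is left open and its existence is required only
  eventually: this covers arbitrary tags as well as truncated samples, whose truncation becomes
  inactive for large \<open>m\<close>.\<close>

lemma grid_step_tendsto:
  assumes y: "continuous_on {0..t} y" and s: "0 < s" "s \<le> t"
    and c: "eventually (\<lambda>m. \<forall>i. grid m i < s \<longrightarrow> s \<le> grid m (Suc i) \<longrightarrow>
      (\<exists>c\<in>{0..t}. \<bar>c - s\<bar> \<le> 1 / real (Suc m) \<and> z m i = y c)) sequentially"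
  shows "(\<lambda>m. grid_step m (z m) s) \<longlonglongrightarrow> y s"
proof (rule tendstoI)
  fix e :: real assume e: "0 < e"
  have "s \<in> {0..t}" using s by auto
  then obtain d where d: "0 < d" "\<And>c. c \<in> {0..t} \<Longrightarrow> dist c s < d \<Longrightarrow> dist (y c) (y s) < e"
    using y e unfolding continuous_on_iff by meson
  have "(\<lambda>m. 1 / real (Suc m)) \<longlonglongrightarrow> 0" using LIMSEQ_inverse_real_of_nat by (simp add: inverse_eq_divide)
  then have "eventually (\<lambda>m. 1 / real (Suc m) < d) sequentially" using d(1) by (rule order_tendstoD(2))
  moreover have "eventually (\<lambda>m. s \<le> real (Suc m)) sequentially"
    using eventually_ge_at_top[of "nat \<lceil>s\<rceil>"] by eventually_elim linarith
  ultimately show "eventually (\<lambda>m. dist (grid_step m (z m) s) (y s) < e) sequentially"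
    using c
  proof eventually_elim
    case (elim m)
    obtain i where i: "i < (Suc m)\<^sup>2" "grid m i < s" "s \<le> grid m (Suc i)"
      using grid_cell[OF s(1) elim(2)] by blast
    obtain x where "x \<in> {0..t}" "\<bar>x - s\<bar> \<le> 1 / real (Suc m)" "z m i = y x" using elim(3) i by blast
    then show ?case using d(2)[of x] elim(1) grid_step_eq[OF i] by (simp add: dist_real_def)
  qed
qed

lemma lborel_measurable_mult:
  fixes f g :: "real \<Rightarrow> real"
  shows "f \<in> borel_measurable borel \<Longrightarrow> g \<in> borel_measurable lborel \<Longrightarrow> (\<lambda>s. f s * g s) \<in> borel_measurable lborel"
  by simp

lemma set_integral_Ioc_diff:
  fixes b :: "real \<Rightarrow> real"
  assumes b: "set_integrable lborel {0..t} b" and uv: "0 \<le> u" "u \<le> v"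
  shows "(LBINT s:{0..min v t}. b s) - (LBINT s:{0..min u t}. b s) = (LBINT s:{0..t}. indicator {u<..v} s * b s)"
proof -
  have i: "set_integrable lborel {0..min x t} b" for x
    by (rule set_integrable_subset[OF b]) auto
  have "(LBINT s:{0..min v t}. b s) - (LBINT s:{0..min u t}. b s) =
    (LBINT s. indicator {0..min v t} s *\<^sub>R b s - indicator {0..min u t} s *\<^sub>R b s)"
    using i[of v] i[of u] unfolding set_lebesgue_integral_def set_integrable_def
    by (rule Bochner_Integration.integral_diff[symmetric])
  also have "\<dots> = (LBINT s:{0..t}. indicator {u<..v} s * b s)"
    unfolding set_lebesgue_integral_def
    by (rule Bochner_Integration.integral_cong) (use uv in \<open>auto simp: indicator_def\<close>)
  finally show ?thesis .
qed

text \<open>As the integrator has a density, the sum is the integral of a step function times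
  \<open>b\<close>, and dominated convergence applies. Tags are free because left ones are needed
  for adaptedness and right ones after summation by parts.\<close>

lemma riemann_stieltjes_tendsto:
  fixes y b :: "real \<Rightarrow> real" and c :: "nat \<Rightarrow> nat \<Rightarrow> real"
  assumes t: "0 \<le> t" and y: "continuous_on {0..t} y" and b: "set_integrable lborel {0..t} b"
    and c: "\<And>m i. min (grid m i) t \<le> c m i \<and> c m i \<le> min (grid m (Suc i)) t"
  shows "(\<lambda>m. \<Sum>i<(Suc m)\<^sup>2. y (c m i) *
      ((LBINT s:{0..min (grid m (Suc i)) t}. b s) - (LBINT s:{0..min (grid m i) t}. b s)))
    \<longlonglongrightarrow> (LBINT s:{0..t}. y s * b s)"
proof -
  obtain K where K: "0 \<le> K" "\<And>s. 0 \<le> s \<Longrightarrow> s \<le> t \<Longrightarrow> \<bar>y s\<bar> \<le> K"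
    using continuous_on_bounded_interval[OF y] by blast
  have c0: "0 \<le> c m i" "c m i \<le> t" for m i
    using c[of m i] grid_nonneg[of m i] t by (auto simp: min_def split: if_splits)
  define g where "g m s = grid_step m (\<lambda>i. y (c m i)) s * (indicator {0..t} s * b s)" for m s
  have bm: "(\<lambda>s. indicator {0..t} s * b s) \<in> borel_measurable lborel"
    and bi: "integrable lborel (\<lambda>s. indicator {0..t} s * b s)"
    using b by (auto simp: set_integrable_def)
  have bd: "\<bar>grid_step m (\<lambda>i. y (c m i)) s\<bar> \<le> K" for m s
    using K c0 by (cases m s rule: grid_step_cases) auto
  have eq: "(\<Sum>i<(Suc m)\<^sup>2. y (c m i) *
      ((LBINT s:{0..min (grid m (Suc i)) t}. b s) - (LBINT s:{0..min (grid m i) t}. b s))) = (LBINT s. g m s)" for m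
  proof -
    have ii: "integrable lborel (\<lambda>s. y (c m i) * (indicator {0..t} s *\<^sub>R (indicator {grid m i<..grid m (Suc i)} s * b s)))" for i
    proof -
      have "integrable lborel (\<lambda>s. indicator {grid m i<..grid m (Suc i)} s *\<^sub>R (indicator {0..t} s * b s))"
        by (rule integrable_mult_indicator[OF _ bi]) auto
      then have "integrable lborel (\<lambda>s. y (c m i) * (indicator {grid m i<..grid m (Suc i)} s *\<^sub>R (indicator {0..t} s * b s)))"
        by (rule Bochner_Integration.integrable_mult_right)
      then show ?thesis by (simp add: mult_ac)
    qed
    have "(\<Sum>i<(Suc m)\<^sup>2. y (c m i) *
      ((LBINT s:{0..min (grid m (Suc i)) t}. b s) - (LBINT s:{0..min (grid m i) t}. b s))) =
      (\<Sum>i<(Suc m)\<^sup>2. LBINT s. y (c m i) * (indicator {0..t} s *\<^sub>R (indicator {grid m i<..grid m (Suc i)} s * b s)))"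
      by (intro sum.cong refl) (subst set_integral_Ioc_diff[OF b grid_nonneg grid_mono], simp, simp add: set_lebesgue_integral_def)
    also have "\<dots> = (LBINT s. \<Sum>i<(Suc m)\<^sup>2. y (c m i) * (indicator {0..t} s *\<^sub>R (indicator {grid m i<..grid m (Suc i)} s * b s)))"
      by (rule Bochner_Integration.integral_sum[symmetric]) (rule ii)
    also have "\<dots> = (LBINT s. g m s)"
      unfolding g_def grid_step_def sum_distrib_right
      by (intro Bochner_Integration.integral_cong refl sum.cong) (simp add: mult_ac)
    finally show ?thesis .
  qed
  have "(\<lambda>m. LBINT s. g m s) \<longlonglongrightarrow> (LBINT s. y s * (indicator {0..t} s * b s))"
  proof (rule integral_dominated_convergence[where w="\<lambda>s. K * \<bar>indicator {0..t} s * b s\<bar>"])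
    have "(\<lambda>s. indicator {0..t} s *\<^sub>R y s) \<in> borel_measurable borel"
      by (rule borel_measurable_continuous_on_indicator[OF _ y]) simp
    then have "(\<lambda>s. (indicator {0..t} s *\<^sub>R y s) * (indicator {0..t} s * b s)) \<in> borel_measurable lborel"
      using bm by (rule lborel_measurable_mult)
    also have "(\<lambda>s. (indicator {0..t} s *\<^sub>R y s) * (indicator {0..t} s * b s)) = (\<lambda>s. y s * (indicator {0..t} s * b s))"
      by (auto simp: indicator_def)
    finally show "(\<lambda>s. y s * (indicator {0..t} s * b s)) \<in> borel_measurable lborel" .
    show "g m \<in> borel_measurable lborel" for m
      unfolding g_def by (rule lborel_measurable_mult[OF _ bm]) simp
    show "integrable lborel (\<lambda>s. K * \<bar>indicator {0..t} s * b s\<bar>)"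
      using bi by auto
    show "AE s in lborel. norm (g m s) \<le> K * \<bar>indicator {0..t} s * b s\<bar>" for m
      using bd by (auto simp: g_def abs_mult intro!: mult_right_mono)
    show "AE s in lborel. (\<lambda>m. g m s) \<longlonglongrightarrow> y s * (indicator {0..t} s * b s)"
      \<comment> \<open>The point 0 belongs to no left-open cell, so convergence is claimed only
        away from it.\<close>
      using AE_lborel_singleton[of 0]
    proof eventually_elim
      case (elim s)
      show ?case
      proof (cases "s \<in> {0..t}")
        case True
        then have s: "0 < s" "s \<le> t" using elim by auto
        have "(\<lambda>m. grid_step m (\<lambda>i. y (c m i)) s) \<longlonglongrightarrow> y s"
        proof (rule grid_step_tendsto[OF y s], intro always_eventually allI impI)
          fix m i assume "grid m i < s" "s \<le> grid m (Suc i)"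
          then have "\<bar>c m i - s\<bar> \<le> 1 / real (Suc m)"
            using c[of m i] s grid_Suc[of m i] by (auto simp: min_def split: if_splits)
          then show "\<exists>x\<in>{0..t}. \<bar>x - s\<bar> \<le> 1 / real (Suc m) \<and> y (c m i) = y x"
            using c0[of m i] by (intro bexI[of _ "c m i"]) auto
        qed
        then show ?thesis unfolding g_def by (intro tendsto_intros)
      qed (simp add: g_def)
    qed
  qed
  also have "(LBINT s. y s * (indicator {0..t} s * b s)) = (LBINT s:{0..t}. y s * b s)"
    by (simp add: set_lebesgue_integral_def mult_ac)
  finally show ?thesis by (simp only: eq)
qed

text \<open>Multipliers in \<open>ito_step\<close> must be bounded. Sampled values are therefore
  truncated at level \<open>m\<close> on the grid with index \<open>m\<close>; as a continuous path
  is bounded on compact intervals, the truncation disappears in the limit.\<close>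

definition clamp_abs :: "real \<Rightarrow> real \<Rightarrow> real" where
  "clamp_abs K x = max (- K) (min K x)"

lemma clamp_abs_bound: "0 \<le> K \<Longrightarrow> \<bar>clamp_abs K x\<bar> \<le> K"
  by (auto simp: clamp_abs_def)

lemma clamp_abs_le: "0 \<le> K \<Longrightarrow> \<bar>clamp_abs K x\<bar> \<le> \<bar>x\<bar>"
  by (auto simp: clamp_abs_def)

lemma clamp_abs_eq: "\<bar>x\<bar> \<le> K \<Longrightarrow> clamp_abs K x = x"
  by (auto simp: clamp_abs_def)

lemma clamp_abs_measurable [measurable]: "clamp_abs K \<in> borel_measurable borel"
  unfolding clamp_abs_def by measurable

lemma continuous_on_initial_segments:
  fixes y :: "real \<Rightarrow> 'b::topological_space"
  assumes "\<And>t. 0 \<le> t \<Longrightarrow> continuous_on {0..t} y"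
  shows "continuous_on {0..} y"
  unfolding continuous_on_eq_continuous_within
proof
  fix x :: real assume x: "x \<in> {0..}"
  have "continuous (at x within {0..x+1}) y"
    using assms[of "x + 1"] x by (auto simp: continuous_on_eq_continuous_within)
  moreover have "at x within {0..} = at x within {0..x+1}"
    by (rule at_within_nhd[where S="{..<x+1}"]) auto
  ultimately show "continuous (at x within {0..}) y" by simp
qed

lemma continuous_on_set_integral:
  fixes b :: "real \<Rightarrow> real"
  assumes b: "\<And>t. 0 \<le> t \<Longrightarrow> set_integrable lborel {0..t} b"
  shows "continuous_on {0..} (\<lambda>t. LBINT s:{0..t}. b s)"
proof (rule continuous_on_initial_segments)
  fix t :: real assume t: "0 \<le> t"
  have "continuous_on {0..t} (\<lambda>x. integral {0..x} b)"
    by (rule indefinite_integral_continuous_1) (rule set_borel_integral_eq_integral[OF b[OF t]])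
  also have "?this \<longleftrightarrow> continuous_on {0..t} (\<lambda>t. LBINT s:{0..t}. b s)"
    by (rule continuous_on_cong) (auto simp: set_borel_integral_eq_integral[OF b])
  finally show "continuous_on {0..t} (\<lambda>t. LBINT s:{0..t}. b s)" .
qed

lemma set_integrable_continuous_mult:
  fixes y b :: "real \<Rightarrow> real"
  assumes y: "continuous_on {0..t} y" and b: "set_integrable lborel {0..t} b"
  shows "set_integrable lborel {0..t} (\<lambda>s. y s * b s)"
proof -
  obtain K where K: "0 \<le> K" "\<And>s. 0 \<le> s \<Longrightarrow> s \<le> t \<Longrightarrow> \<bar>y s\<bar> \<le> K"
    using continuous_on_bounded_interval[OF y] by blast
  have bi: "integrable lborel (\<lambda>s. indicator {0..t} s * b s)"
    using b by (auto simp: set_integrable_def)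
  have "(\<lambda>s. indicator {0..t} s *\<^sub>R y s) \<in> borel_measurable borel"
    by (rule borel_measurable_continuous_on_indicator[OF _ y]) simp
  then have "(\<lambda>s. (indicator {0..t} s *\<^sub>R y s) * (indicator {0..t} s * b s)) \<in> borel_measurable lborel"
    using borel_measurable_integrable[OF bi] by (rule lborel_measurable_mult)
  also have "(\<lambda>s. (indicator {0..t} s *\<^sub>R y s) * (indicator {0..t} s * b s)) = (\<lambda>s. indicator {0..t} s *\<^sub>R (y s * b s))"
    by (auto simp: indicator_def)
  finally have m: "(\<lambda>s. indicator {0..t} s *\<^sub>R (y s * b s)) \<in> borel_measurable lborel" .
  show ?thesis unfolding set_integrable_def
  proof (rule Bochner_Integration.integrable_bound[OF _ m])
    show "integrable lborel (\<lambda>s. K * (indicator {0..t} s * b s))" using bi by simp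
    show "AE s in lborel. norm (indicator {0..t} s *\<^sub>R (y s * b s)) \<le> norm (K * (indicator {0..t} s * b s))"
      using K by (auto simp: indicator_def abs_mult intro!: mult_right_mono)
  qed
qed

lemma sq_int_continuous_mult:
  assumes y: "continuous_on {0..t} y" and h: "sq_int t h"
  shows "sq_int t (\<lambda>s. y s * h s)"
proof -
  obtain K where K: "0 \<le> K" "\<And>s. 0 \<le> s \<Longrightarrow> s \<le> t \<Longrightarrow> \<bar>y s\<bar> \<le> K"
    using continuous_on_bounded_interval[OF y] by blast
  have hm: "(\<lambda>s. indicator {0..t} s * h s) \<in> borel_measurable lborel"
    using h by (simp add: sq_int_iff)
  have "(\<lambda>s. indicator {0..t} s *\<^sub>R y s) \<in> borel_measurable borel"
    by (rule borel_measurable_continuous_on_indicator[OF _ y]) simp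
  then have "(\<lambda>s. (indicator {0..t} s *\<^sub>R y s) * (indicator {0..t} s * h s)) \<in> borel_measurable lborel"
    using hm by (rule lborel_measurable_mult)
  also have "(\<lambda>s. (indicator {0..t} s *\<^sub>R y s) * (indicator {0..t} s * h s)) = (\<lambda>s. indicator {0..t} s *\<^sub>R (y s * h s))"
    by (auto simp: indicator_def)
  finally show ?thesis
    by (intro sq_int_dominated(1)[OF h, where c=K])
      (use K in \<open>auto simp: set_borel_measurable_def abs_mult intro!: mult_right_mono\<close>)
qed

text \<open>Both \<open>y\<close> and its truncated samples stay below a common path bound
  \<open>K\<close>, so \<open>(2 * K)\<^sup>2\<close> times the square of \<open>h\<close>
  dominates. Left end points are used because a coefficient must be known when its cell
  begins.\<close>

lemma sq_norm_grid_tendsto: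
  assumes t: "0 \<le> t" and y: "continuous_on {0..t} y" and h: "sq_int t h"
  shows "(\<lambda>m. sq_norm t (\<lambda>s. grid_step m (\<lambda>i. clamp_abs (real m) (y (grid m i))) s * h s - y s * h s)) \<longlonglongrightarrow> 0"
proof -
  obtain K where K: "0 \<le> K" "\<And>s. 0 \<le> s \<Longrightarrow> s \<le> t \<Longrightarrow> \<bar>y s\<bar> \<le> K"
    using continuous_on_bounded_interval[OF y] by blast
  let ?g = "\<lambda>m s. grid_step m (\<lambda>i. clamp_abs (real m) (y (grid m i))) s"
  have hm: "(\<lambda>s. indicator {0..t} s * h s) \<in> borel_measurable lborel"
    and hi: "integrable lborel (\<lambda>s. (indicator {0..t} s * h s)\<^sup>2)"
    using h by (auto simp: sq_int_iff)
  have ym: "(\<lambda>s. indicator {0..t} s *\<^sub>R y s) \<in> borel_measurable borel"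
    by (rule borel_measurable_continuous_on_indicator[OF _ y]) simp
  have bd: "\<bar>?g m s\<bar> \<le> K" if "s \<le> t" for m s
  proof (cases m s rule: grid_step_cases)
    case (1 i)
    then have "\<bar>y (grid m i)\<bar> \<le> K" using K(2)[of "grid m i"] grid_nonneg[of m i] that by auto
    then show ?thesis using clamp_abs_le[of "real m" "y (grid m i)"] 1 by auto
  qed (use K in auto)
  have eq: "indicator {0..t} s * (?g m s * h s - y s * h s) =
      (?g m s - indicator {0..t} s *\<^sub>R y s) * (indicator {0..t} s * h s)" for m s
    by (auto simp: indicator_def left_diff_distrib)
  have "(\<lambda>m. LBINT s. (indicator {0..t} s * (?g m s * h s - y s * h s))\<^sup>2) \<longlonglongrightarrow> (LBINT s::real. 0)"
    unfolding eq
  proof (rule integral_dominated_convergence[where w="\<lambda>s. (2 * K)\<^sup>2 * (indicator {0..t} s * h s)\<^sup>2"])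
    show "(\<lambda>s. ((?g m s - indicator {0..t} s *\<^sub>R y s) * (indicator {0..t} s * h s))\<^sup>2) \<in> borel_measurable lborel" for m
      by (intro borel_measurable_power lborel_measurable_mult[OF _ hm] borel_measurable_diff[OF _ ym]) simp
    show "integrable lborel (\<lambda>s. (2 * K)\<^sup>2 * (indicator {0..t} s * h s)\<^sup>2)" using hi by simp
    show "AE s in lborel. norm (((?g m s - indicator {0..t} s *\<^sub>R y s) * (indicator {0..t} s * h s))\<^sup>2)
       \<le> (2 * K)\<^sup>2 * (indicator {0..t} s * h s)\<^sup>2" for m
    proof (intro AE_I2)
      fix s :: real
      show "norm (((?g m s - indicator {0..t} s *\<^sub>R y s) * (indicator {0..t} s * h s))\<^sup>2)
        \<le> (2 * K)\<^sup>2 * (indicator {0..t} s * h s)\<^sup>2"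
      proof (cases "s \<in> {0..t}")
        case True
        then have "\<bar>?g m s - y s\<bar> \<le> 2 * K" using bd[of s m] K(2)[of s] by auto
        then have "\<bar>?g m s - y s\<bar>\<^sup>2 \<le> (2 * K)\<^sup>2" by (intro power_mono) auto
        then have "\<bar>?g m s - y s\<bar>\<^sup>2 * (h s)\<^sup>2 \<le> (2 * K)\<^sup>2 * (h s)\<^sup>2" by (intro mult_right_mono) auto
        then show ?thesis using True by (simp add: power_mult_distrib)
      qed simp
    qed
    show "AE s in lborel. (\<lambda>m. ((?g m s - indicator {0..t} s *\<^sub>R y s) * (indicator {0..t} s * h s))\<^sup>2) \<longlonglongrightarrow> 0"
      using AE_lborel_singleton[of 0]
    proof eventually_elim
      case (elim s)
      show ?case
      proof (cases "s \<in> {0..t}")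
        case True
        then have s: "0 < s" "s \<le> t" using elim by auto
        have "(\<lambda>m. ?g m s) \<longlonglongrightarrow> y s"
        proof (rule grid_step_tendsto[OF y s])
          show "\<forall>\<^sub>F m in sequentially. \<forall>i. grid m i < s \<longrightarrow> s \<le> grid m (Suc i) \<longrightarrow>
             (\<exists>c\<in>{0..t}. \<bar>c - s\<bar> \<le> 1 / real (Suc m) \<and> clamp_abs (real m) (y (grid m i)) = y c)"
            using eventually_ge_at_top[of "nat \<lceil>K\<rceil>"]
          proof eventually_elim
            case (elim m)
            show ?case
            proof (intro allI impI)
              fix i assume i: "grid m i < s" "s \<le> grid m (Suc i)"
              have "\<bar>y (grid m i)\<bar> \<le> real m" using K(2)[of "grid m i"] grid_nonneg[of m i] i s elim by linarith
              then show "\<exists>c\<in>{0..t}. \<bar>c - s\<bar> \<le> 1 / real (Suc m) \<and> clamp_abs (real m) (y (grid m i)) = y c"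
                using i s grid_nonneg[of m i] grid_Suc[of m i]
                by (intro bexI[of _ "grid m i"]) (auto simp: clamp_abs_eq)
            qed
          qed
        qed
        then have "(\<lambda>m. ((?g m s - y s) * h s)\<^sup>2) \<longlonglongrightarrow> ((y s - y s) * h s)\<^sup>2"
          by (intro tendsto_intros)
        then show ?thesis using True by simp
      qed simp
    qed
  qed simp
  then show ?thesis by (simp add: sq_norm_eq)
qed

lemma sum_by_parts:
  fixes x w :: "nat \<Rightarrow> real"
  shows "(\<Sum>i<n. x i * (w (Suc i) - w i)) = x n * w n - x 0 * w 0 - (\<Sum>i<n. w (Suc i) * (x (Suc i) - x i))"
  by (induction n) (simp_all add: algebra_simps)

section \<open>Limits, step multipliers and integration by parts for Ito integrals\<close>

context brownian_motion
begin

lemma ito_at_0: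
  assumes "ito j H I"
  shows "AE \<omega> in M. I 0 \<omega> = 0"
proof (rule ito_approx[OF assms])
  fix g J
  assume s: "\<And>k. is_simple F (\<lambda>t \<omega>. B t \<omega> $ j) (g k) (J k)"
    and J: "\<And>t. 0 \<le> t \<Longrightarrow> tzip (\<lambda>k \<omega>. J k t \<omega> - I t \<omega>)"
  have J0: "tzip (\<lambda>k \<omega>. - I 0 \<omega>)"
    using J[OF order_refl] by (simp only: is_simple_at_0[OF s] diff_0)
  show ?thesis
  proof (rule tzip_AE_subseq[OF J0])
    assume "AE \<omega> in M. (\<lambda>k::nat. - I 0 \<omega>) \<longlonglongrightarrow> 0"
    then show ?thesis by eventually_elim (simp add: LIMSEQ_const_iff)
  qed
qed

text \<open>Limits of Ito integrals are Ito integrals. The definition demands one sequence of simple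
  processes good for all times, hence a diagonal choice on the growing horizons
  \<open>[0, m]\<close>; the corresponding integrals follow automatically by
  \<open>ito_tendsto_zero\<close>.\<close>

lemma ito_closed:
  assumes I: "\<And>m. ito j (G m) (K m)" and H: "has_measurable_version M H"
    and sq: "AE \<omega> in M. \<forall>t\<ge>0. sq_int t (\<lambda>s. H s \<omega>)"
    and Z: "adapted_continuous M F Z"
    and D: "\<And>t. 0 \<le> t \<Longrightarrow> tzip (\<lambda>m \<omega>. sq_norm t (\<lambda>s. G m s \<omega> - H s \<omega>))"
    and KZ: "\<And>t. 0 \<le> t \<Longrightarrow> tzip (\<lambda>m \<omega>. K m t \<omega> - Z t \<omega>)"
  shows "ito j H Z"
proof -
  \<comment> \<open>Only the integrands are selected to be close, and only on the horizon
    \<open>m\<close>; any fixed \<open>t\<close> lies below this horizon for all large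
    \<open>m\<close>.\<close>
  have "\<exists>g J. is_simple F (\<lambda>t \<omega>. B t \<omega> $ j) g J \<and>
      expectation (\<lambda>\<omega>. min 1 \<bar>sq_norm (real m) (\<lambda>s. g s \<omega> - G m s \<omega>)\<bar>) < 1 / real (Suc m)" for m
  proof -
    obtain g J where s: "\<And>k. is_simple F (\<lambda>t \<omega>. B t \<omega> $ j) (g k) (J k)"
      and D: "\<And>t. 0 \<le> t \<Longrightarrow> tzip (\<lambda>k \<omega>. sq_norm t (\<lambda>s. g k s \<omega> - G m s \<omega>))"
      and "\<And>t. 0 \<le> t \<Longrightarrow> tzip (\<lambda>k \<omega>. J k t \<omega> - K m t \<omega>)"
      using ito_approx[OF I[of m]] by blast
    have "(\<lambda>k. expectation (\<lambda>\<omega>. min 1 \<bar>sq_norm (real m) (\<lambda>s. g k s \<omega> - G m s \<omega>)\<bar>)) \<longlonglongrightarrow> 0"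
      using D[of "real m"] tendsto_zero_in_probability_iff[OF tzip_borel[OF D[of "real m"]]] by simp
    then have "eventually (\<lambda>k. expectation (\<lambda>\<omega>. min 1 \<bar>sq_norm (real m) (\<lambda>s. g k s \<omega> - G m s \<omega>)\<bar>) < 1 / real (Suc m)) sequentially"
      by (rule order_tendstoD) simp
    then obtain k where "expectation (\<lambda>\<omega>. min 1 \<bar>sq_norm (real m) (\<lambda>s. g k s \<omega> - G m s \<omega>)\<bar>) < 1 / real (Suc m)"
      by (rule eventually_happens'[OF sequentially_bot, THEN exE])
    then show ?thesis using s[of k] by (intro exI[of _ "g k"] exI[of _ "J k"] conjI)
  qed
  then have "\<forall>m. \<exists>g J. is_simple F (\<lambda>t \<omega>. B t \<omega> $ j) g J \<and>
      expectation (\<lambda>\<omega>. min 1 \<bar>sq_norm (real m) (\<lambda>s. g s \<omega> - G m s \<omega>)\<bar>) < 1 / real (Suc m)" by (rule allI)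
  then obtain g J where gJ: "\<forall>m. is_simple F (\<lambda>t \<omega>. B t \<omega> $ j) (g m) (J m) \<and>
      expectation (\<lambda>\<omega>. min 1 \<bar>sq_norm (real m) (\<lambda>s. g m s \<omega> - G m s \<omega>)\<bar>) < 1 / real (Suc m)"
    unfolding choice_iff by (elim exE)
  have s: "is_simple F (\<lambda>t \<omega>. B t \<omega> $ j) (g m) (J m)"
    and small: "expectation (\<lambda>\<omega>. min 1 \<bar>sq_norm (real m) (\<lambda>s. g m s \<omega> - G m s \<omega>)\<bar>) < 1 / real (Suc m)" for m
    using gJ[rule_format, of m] by simp_all
  have gG: "ito j (\<lambda>s \<omega>. g m s \<omega> - G m s \<omega>) (\<lambda>t \<omega>. J m t \<omega> - K m t \<omega>)" for m
    by (rule ito_diff[OF ito_simple[OF s] I])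
  have D': "tzip (\<lambda>m \<omega>. sq_norm t (\<lambda>s. g m s \<omega> - G m s \<omega>))" if t: "0 \<le> t" for t
  proof -
    have Dm: "(\<lambda>\<omega>. sq_norm x (\<lambda>s. g m s \<omega> - G m s \<omega>)) \<in> borel_measurable M" for m x
      by (rule sq_norm_measurable[OF itoD(1)[OF gG]])
    show ?thesis unfolding tendsto_zero_in_probability_iff[OF Dm]
    proof (rule tendsto_sandwich[where f="\<lambda>_. 0" and h="\<lambda>m. 1 / real (Suc m)"])
      show "(\<lambda>m. 1 / real (Suc m)) \<longlonglongrightarrow> 0"
        using LIMSEQ_inverse_real_of_nat by (simp add: inverse_eq_divide)
      show "eventually (\<lambda>m. expectation (\<lambda>\<omega>. min 1 \<bar>sq_norm t (\<lambda>s. g m s \<omega> - G m s \<omega>)\<bar>) \<le> 1 / real (Suc m)) sequentially"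
        using eventually_ge_at_top[of "nat \<lceil>t\<rceil>"]
      proof eventually_elim
        case (elim m)
        then have m: "t \<le> real m" by linarith
        have "expectation (\<lambda>\<omega>. min 1 \<bar>sq_norm t (\<lambda>s. g m s \<omega> - G m s \<omega>)\<bar>) \<le>
          expectation (\<lambda>\<omega>. min 1 \<bar>sq_norm (real m) (\<lambda>s. g m s \<omega> - G m s \<omega>)\<bar>)"
        proof (rule integral_mono_AE[OF integrable_min_1_abs[OF Dm] integrable_min_1_abs[OF Dm]])
          show "AE \<omega> in M. min 1 \<bar>sq_norm t (\<lambda>s. g m s \<omega> - G m s \<omega>)\<bar> \<le> min 1 \<bar>sq_norm (real m) (\<lambda>s. g m s \<omega> - G m s \<omega>)\<bar>"
            using itoD(2)[OF gG[of m]]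
          proof eventually_elim
            case (elim \<omega>)
            then show ?case using sq_norm_mono(2)[OF _ m, of "\<lambda>s. g m s \<omega> - G m s \<omega>"]
              by (auto simp: sq_norm_nonneg)
          qed
        qed
        then show ?case using small[of m] by simp
      qed
    qed (auto intro!: always_eventually Bochner_Integration.integral_nonneg)
  qed
  show ?thesis
  proof (rule itoI[OF H sq Z s])
    fix t :: real assume t: "0 \<le> t"
    show "tzip (\<lambda>k \<omega>. sq_norm t (\<lambda>s. g k s \<omega> - H s \<omega>))"
    proof (rule tzip_bound)
      show "tzip (\<lambda>m \<omega>. 2 * sq_norm t (\<lambda>s. g m s \<omega> - G m s \<omega>))"
        by (rule tzip_cmult[OF D'[OF t], where c=2]) (use tzip_borel[OF D'[OF t]] in auto)
      show "tzip (\<lambda>m \<omega>. 2 * sq_norm t (\<lambda>s. G m s \<omega> - H s \<omega>))"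
        by (rule tzip_cmult[OF D[OF t], where c=2]) (use tzip_borel[OF D[OF t]] in auto)
      show "(\<lambda>\<omega>. sq_norm t (\<lambda>s. g m s \<omega> - H s \<omega>)) \<in> borel_measurable M" for m
        by (intro sq_norm_measurable has_measurable_version_diff has_measurable_version_simple[OF s] H)
      show "AE \<omega> in M. \<bar>sq_norm t (\<lambda>s. g m s \<omega> - H s \<omega>)\<bar> \<le>
          \<bar>2 * sq_norm t (\<lambda>s. g m s \<omega> - G m s \<omega>)\<bar> + \<bar>2 * sq_norm t (\<lambda>s. G m s \<omega> - H s \<omega>)\<bar>" for m
        using itoD(2)[OF gG[of m]] itoD(2)[OF I[of m]] sq
      proof eventually_elim
        case (elim \<omega>)
        then show ?case
          using sq_int_add(2)[of t "\<lambda>s. g m s \<omega> - G m s \<omega>" "\<lambda>s. G m s \<omega> - H s \<omega>"] sq_int_diff t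
          by (simp add: sq_norm_nonneg)
      qed
    qed
    have "tzip (\<lambda>m \<omega>. (J m t \<omega> - K m t \<omega>) + (K m t \<omega> - Z t \<omega>))"
      by (rule tzip_add[OF ito_tendsto_zero[OF gG t D'[OF t]] KZ[OF t]])
    then show "tzip (\<lambda>k \<omega>. J k t \<omega> - Z t \<omega>)" by simp
  qed
qed

text \<open>A step factor turns simple approximations into simple approximations, and the bound
  \<open>c\<close> controls the error of integrands and of integrals. This is the building block for
  grid sampling and for freezing at a grid point.\<close>

lemma ito_step:
  assumes I: "ito j H I" and ab: "0 \<le> a" "a \<le> b"
    and \<phi>: "\<phi> \<in> borel_measurable (F a)" and bd: "\<And>\<omega>. \<omega> \<in> space M \<Longrightarrow> \<bar>\<phi> \<omega>\<bar> \<le> c"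
  shows "ito j (\<lambda>s \<omega>. \<phi> \<omega> * indicator {a<..b} s * H s \<omega>) (\<lambda>t \<omega>. \<phi> \<omega> * (I (min b t) \<omega> - I (min a t) \<omega>))"
proof -
  obtain g J where s: "\<And>k. is_simple F (\<lambda>t \<omega>. B t \<omega> $ j) (g k) (J k)"
    and D: "\<And>t. 0 \<le> t \<Longrightarrow> tzip (\<lambda>k \<omega>. sq_norm t (\<lambda>s. g k s \<omega> - H s \<omega>))"
    and J: "\<And>t. 0 \<le> t \<Longrightarrow> tzip (\<lambda>k \<omega>. J k t \<omega> - I t \<omega>)"
    using ito_approx[OF I] by blast
  have bd': "bounded (\<phi> ` space M)" using bd by (auto simp: bounded_iff)
  have \<phi>M: "\<phi> \<in> borel_measurable M" using measurable_F_M[OF ab(1) \<phi>] .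
  have ind: "has_measurable_version M (\<lambda>s \<omega>. \<phi> \<omega> * indicator {a<..b} s)"
    by (intro has_measurable_version_mult has_measurable_version_random_variable[OF \<phi>M] has_measurable_version_deterministic
        measurable_restrict_space1) measurable
  have Hm: "has_measurable_version M (\<lambda>s \<omega>. \<phi> \<omega> * indicator {a<..b} s * H s \<omega>)"
    by (intro has_measurable_version_mult ind itoD(1)[OF I])
  have dom: "sq_int t (\<lambda>s. \<phi> \<omega> * indicator {a<..b} s * u s)"
     "sq_norm t (\<lambda>s. \<phi> \<omega> * indicator {a<..b} s * u s) \<le> c\<^sup>2 * sq_norm t u"
    if u: "sq_int t u" and \<omega>: "\<omega> \<in> space M" for t \<omega> u
  proof -
    have "(\<lambda>s. (\<phi> \<omega> * indicator {a<..b} s) * (indicator {0..t} s * u s)) \<in> borel_measurable lborel"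
      by (rule lborel_measurable_mult) (use u in \<open>auto simp: sq_int_iff\<close>)
    then have m: "set_borel_measurable lborel {0..t} (\<lambda>s. \<phi> \<omega> * indicator {a<..b} s * u s)"
      by (simp only: set_borel_measurable_def real_scaleR_def mult.left_commute)
    have le: "\<bar>\<phi> \<omega> * indicator {a<..b} s * u s\<bar> \<le> c * \<bar>u s\<bar>" for s
      using bd[OF \<omega>] abs_ge_zero[of "\<phi> \<omega>"]
      by (auto simp: abs_mult indicator_def intro!: mult_right_mono order_trans[OF abs_ge_zero])
    show "sq_int t (\<lambda>s. \<phi> \<omega> * indicator {a<..b} s * u s)"
     "sq_norm t (\<lambda>s. \<phi> \<omega> * indicator {a<..b} s * u s) \<le> c\<^sup>2 * sq_norm t u"
      using sq_int_dominated[OF u m le] by auto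
  qed
  show ?thesis
  proof (rule itoI[OF Hm _ increment_adapted_continuous[OF itoD(3)[OF I] ab \<phi>] is_simple_step[OF s ab \<phi> bd']])
    show "AE \<omega> in M. \<forall>t\<ge>0. sq_int t (\<lambda>s. \<phi> \<omega> * indicator {a<..b} s * H s \<omega>)"
      using itoD(2)[OF I] AE_space by eventually_elim (auto intro: dom)
    fix t :: real assume t: "0 \<le> t"
    show "tzip (\<lambda>k \<omega>. sq_norm t (\<lambda>s. \<phi> \<omega> * indicator {a<..b} s * g k s \<omega> - \<phi> \<omega> * indicator {a<..b} s * H s \<omega>))"
    proof (rule tzip_cmult[OF D[OF t], where c="c\<^sup>2"])
      show "(\<lambda>\<omega>. sq_norm t (\<lambda>s. \<phi> \<omega> * indicator {a<..b} s * g k s \<omega> - \<phi> \<omega> * indicator {a<..b} s * H s \<omega>)) \<in> borel_measurable M" for k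
        by (intro sq_norm_measurable has_measurable_version_diff has_measurable_version_mult ind has_measurable_version_simple[OF s] itoD(1)[OF I])
      show "AE \<omega> in M. \<bar>sq_norm t (\<lambda>s. \<phi> \<omega> * indicator {a<..b} s * g k s \<omega> - \<phi> \<omega> * indicator {a<..b} s * H s \<omega>)\<bar>
         \<le> c\<^sup>2 * \<bar>sq_norm t (\<lambda>s. g k s \<omega> - H s \<omega>)\<bar>" for k
        using itoD(2)[OF I] is_simple_sq_int[OF s[of k]] AE_space
      proof eventually_elim
        case (elim \<omega>)
        then have "sq_int t (\<lambda>s. g k s \<omega> - H s \<omega>)" using t by (auto intro: sq_int_diff)
        then show ?case using dom(2)[of t "\<lambda>s. g k s \<omega> - H s \<omega>" \<omega>] elim
          by (simp add: sq_norm_nonneg right_diff_distrib)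
      qed
    qed
    have x: "0 \<le> min b t" "0 \<le> min a t" using ab t by auto
    show "tzip (\<lambda>k \<omega>. \<phi> \<omega> * (J k (min b t) \<omega> - J k (min a t) \<omega>) - \<phi> \<omega> * (I (min b t) \<omega> - I (min a t) \<omega>))"
    proof (rule tzip_bound)
      show "tzip (\<lambda>k \<omega>. c * (J k (min b t) \<omega> - I (min b t) \<omega>))"
        by (rule tzip_cmult[OF J[OF x(1)], where c="\<bar>c\<bar>"]) (use tzip_borel[OF J[OF x(1)]] in \<open>auto simp: abs_mult\<close>)
      show "tzip (\<lambda>k \<omega>. c * (J k (min a t) \<omega> - I (min a t) \<omega>))"
        by (rule tzip_cmult[OF J[OF x(2)], where c="\<bar>c\<bar>"]) (use tzip_borel[OF J[OF x(2)]] in \<open>auto simp: abs_mult\<close>)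
      have [measurable]: "I (min b t) \<in> borel_measurable M" "I (min a t) \<in> borel_measurable M"
         "J k (min b t) \<in> borel_measurable M" "J k (min a t) \<in> borel_measurable M" for k
        using itoD(4)[OF I] itoD(4)[OF ito_simple[OF s]] x by auto
      note [measurable] = \<phi>M
      show "(\<lambda>\<omega>. \<phi> \<omega> * (J k (min b t) \<omega> - J k (min a t) \<omega>) - \<phi> \<omega> * (I (min b t) \<omega> - I (min a t) \<omega>)) \<in> borel_measurable M" for k
        by measurable
      show "AE \<omega> in M. \<bar>\<phi> \<omega> * (J k (min b t) \<omega> - J k (min a t) \<omega>) - \<phi> \<omega> * (I (min b t) \<omega> - I (min a t) \<omega>)\<bar> \<le>
        \<bar>c * (J k (min b t) \<omega> - I (min b t) \<omega>)\<bar> + \<bar>c * (J k (min a t) \<omega> - I (min a t) \<omega>)\<bar>" for k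
      proof (rule AE_I2)
        fix \<omega> assume \<omega>: "\<omega> \<in> space M"
        let ?u = "J k (min b t) \<omega> - I (min b t) \<omega>" and ?v = "J k (min a t) \<omega> - I (min a t) \<omega>"
        have "\<phi> \<omega> * (J k (min b t) \<omega> - J k (min a t) \<omega>) - \<phi> \<omega> * (I (min b t) \<omega> - I (min a t) \<omega>) = \<phi> \<omega> * ?u - \<phi> \<omega> * ?v"
          by (simp add: algebra_simps)
        moreover have "\<bar>\<phi> \<omega> * ?u - \<phi> \<omega> * ?v\<bar> \<le> \<bar>\<phi> \<omega> * ?u\<bar> + \<bar>\<phi> \<omega> * ?v\<bar>" by (rule abs_triangle_ineq4)
        moreover have "\<bar>\<phi> \<omega> * y\<bar> \<le> \<bar>c * y\<bar>" for y
          unfolding abs_mult using bd[OF \<omega>] by (intro mult_right_mono) auto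
        ultimately show "\<bar>\<phi> \<omega> * (J k (min b t) \<omega> - J k (min a t) \<omega>) - \<phi> \<omega> * (I (min b t) \<omega> - I (min a t) \<omega>)\<bar> \<le>
          \<bar>c * ?u\<bar> + \<bar>c * ?v\<bar>" by (smt (verit))
      qed
    qed
  qed
qed

text \<open>Integration by parts against a process of finite variation: no covariation term arises.\<close>

lemma ito_product:
  assumes I: "ito j H I" and N: "adapted_continuous M F N"
    and n: "AE \<omega> in M. \<forall>t\<ge>0. set_integrable lborel {0..t} (\<lambda>s. n s \<omega>) \<and> N t \<omega> = N0 + (LBINT s:{0..t}. n s \<omega>)"
  shows "ito j (\<lambda>s \<omega>. N s \<omega> * H s \<omega>) (\<lambda>t \<omega>. N t \<omega> * I t \<omega> - (LBINT s:{0..t}. I s \<omega> * n s \<omega>))"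
proof -
  let ?a = "\<lambda>m i \<omega>. clamp_abs (real m) (N (grid m i) \<omega>)"
  \<comment> \<open>The factor \<open>N\<close> is sampled at left end points, so each summand is an
    instance of \<open>ito_step\<close> and \<open>K m\<close> is the integral of
    \<open>G m\<close>.\<close>
  define G where "G m s \<omega> = (\<Sum>i<(Suc m)\<^sup>2. ?a m i \<omega> * indicator {grid m i<..grid m (Suc i)} s * H s \<omega>)" for m s \<omega>
  define K where "K m t \<omega> = (\<Sum>i<(Suc m)\<^sup>2. ?a m i \<omega> * (I (min (grid m (Suc i)) t) \<omega> - I (min (grid m i) t) \<omega>))" for m t \<omega>
  let ?Z = "\<lambda>t \<omega>. N t \<omega> * I t \<omega> - (LBINT s:{0..t}. I s \<omega> * n s \<omega>)"
  have Nc: "AE \<omega> in M. continuous_on {0..} (\<lambda>t. N t \<omega>)" and Ic: "AE \<omega> in M. continuous_on {0..} (\<lambda>t. I t \<omega>)"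
    using N itoD(3)[OF I] by (auto simp: adapted_continuous_def)
  have GK: "ito j (G m) (K m)" for m
    unfolding G_def K_def
  proof (rule ito_sum)
    fix i
    show "ito j (\<lambda>s \<omega>. ?a m i \<omega> * indicator {grid m i<..grid m (Suc i)} s * H s \<omega>)
      (\<lambda>t \<omega>. ?a m i \<omega> * (I (min (grid m (Suc i)) t) \<omega> - I (min (grid m i) t) \<omega>))"
    proof (rule ito_step[OF I grid_nonneg grid_mono, where c="real m"])
      have "N (grid m i) \<in> borel_measurable (F (grid m i))"
        using N grid_nonneg by (simp add: adapted_continuous_def)
      then show "(\<lambda>\<omega>. clamp_abs (real m) (N (grid m i) \<omega>)) \<in> borel_measurable (F (grid m i))"
        by (rule measurable_compose[OF _ clamp_abs_measurable])
    qed (auto simp: clamp_abs_bound)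
  qed simp
  have Glim: "AE \<omega> in M. \<forall>t\<ge>0. (\<lambda>m. sq_norm t (\<lambda>s. G m s \<omega> - N s \<omega> * H s \<omega>)) \<longlonglongrightarrow> 0"
    using Nc itoD(2)[OF I]
  proof eventually_elim
    case (elim \<omega>)
    show ?case
    proof (intro allI impI)
      fix t :: real assume t: "0 \<le> t"
      have "continuous_on {0..t} (\<lambda>t. N t \<omega>)" using elim(1) by (rule continuous_on_subset) auto
      moreover have "sq_int t (\<lambda>s. H s \<omega>)" using elim(2) t by simp
      ultimately have "(\<lambda>m. sq_norm t (\<lambda>s. grid_step m (\<lambda>i. ?a m i \<omega>) s * H s \<omega> - N s \<omega> * H s \<omega>)) \<longlonglongrightarrow> 0"
        by (rule sq_norm_grid_tendsto[OF t])
      then show "(\<lambda>m. sq_norm t (\<lambda>s. G m s \<omega> - N s \<omega> * H s \<omega>)) \<longlonglongrightarrow> 0"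
        by (simp only: G_def grid_step_def sum_distrib_right)
    qed
  qed
  have Klim: "AE \<omega> in M. \<forall>t\<ge>0. (\<lambda>m. K m t \<omega>) \<longlonglongrightarrow> ?Z t \<omega>"
    using Nc Ic n ito_at_0[OF I]
  proof eventually_elim
    case (elim \<omega>)
    note elim0 = elim
    show ?case
    proof (intro allI impI)
      fix t :: real assume t: "0 \<le> t"
      have Nt: "continuous_on {0..t} (\<lambda>t. N t \<omega>)" using elim(1) by (rule continuous_on_subset) auto
      have It: "continuous_on {0..t} (\<lambda>t. I t \<omega>)" using elim(2) by (rule continuous_on_subset) auto
      obtain C where C: "0 \<le> C" "\<And>s. 0 \<le> s \<Longrightarrow> s \<le> t \<Longrightarrow> \<bar>N s \<omega>\<bar> \<le> C"
        using continuous_on_bounded_interval[OF Nt] by blast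
      let ?b = "\<lambda>r. LBINT s:{0..r}. n s \<omega>"
      \<comment> \<open>After summation by parts the increments fall on \<open>N\<close>, with
        \<open>I\<close> at right end points. These are Riemann-Stieltjes sums for the density
        \<open>n\<close>, so no quadratic term remains in the limit.\<close>
      let ?R = "\<lambda>m. \<Sum>i<(Suc m)\<^sup>2. I (min (grid m (Suc i)) t) \<omega> * (?b (min (grid m (Suc i)) t) - ?b (min (grid m i) t))"
      have R: "?R \<longlonglongrightarrow> (LBINT s:{0..t}. I s \<omega> * n s \<omega>)"
        by (rule riemann_stieltjes_tendsto[OF t It, of _ "\<lambda>m i. min (grid m (Suc i)) t"])
          (use elim(3) t grid_mono in \<open>auto simp: min_le_iff_disj\<close>)
      \<comment> \<open>For large \<open>m\<close> the grid reaches beyond \<open>t\<close> and the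
        truncation level exceeds the bound of the path of \<open>N\<close>, so the identity is
        exact.\<close>
      have "eventually (\<lambda>m. K m t \<omega> = N t \<omega> * I t \<omega> - ?R m) sequentially"
        using eventually_ge_at_top[of "nat \<lceil>C\<rceil>"] eventually_ge_at_top[of "nat \<lceil>t\<rceil>"]
      proof eventually_elim
        case (elim m)
        let ?x = "\<lambda>i. N (min (grid m i) t) \<omega>" and ?w = "\<lambda>i. I (min (grid m i) t) \<omega>"
        have m: "C \<le> real m" "t \<le> real m" using elim by linarith+
        have "K m t \<omega> = (\<Sum>i<(Suc m)\<^sup>2. ?x i * (?w (Suc i) - ?w i))"
          unfolding K_def
        proof (intro sum.cong refl)
          fix i
          show "?a m i \<omega> * (?w (Suc i) - ?w i) = ?x i * (?w (Suc i) - ?w i)"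
          proof (cases "grid m i \<le> t")
            case True
            then have "\<bar>N (grid m i) \<omega>\<bar> \<le> real m" using C(2)[OF grid_nonneg, of m i] m by simp
            then show ?thesis using True by (simp add: clamp_abs_eq)
          next
            case False
            then have "min (grid m (Suc i)) t = t" "min (grid m i) t = t" using grid_mono[of i "Suc i" m] by auto
            then show ?thesis by simp
          qed
        qed
        also have "\<dots> = ?x ((Suc m)\<^sup>2) * ?w ((Suc m)\<^sup>2) - ?x 0 * ?w 0 - (\<Sum>i<(Suc m)\<^sup>2. ?w (Suc i) * (?x (Suc i) - ?x i))"
          by (rule sum_by_parts)
        also have "?x ((Suc m)\<^sup>2) * ?w ((Suc m)\<^sup>2) = N t \<omega> * I t \<omega>"
          using m(2) by (simp add: grid_end min_absorb2 del: of_nat_Suc) 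
        also have "?w 0 = 0" using t elim0(4) by (simp add: grid_0)
        also have "(\<Sum>i<(Suc m)\<^sup>2. ?w (Suc i) * (?x (Suc i) - ?x i)) = ?R m"
        proof (intro sum.cong refl)
          fix i
          have "?x i = N0 + ?b (min (grid m i) t)" for i
            using elim0(3) grid_nonneg[of m i] t by simp
          then show "?w (Suc i) * (?x (Suc i) - ?x i) = ?w (Suc i) * (?b (min (grid m (Suc i)) t) - ?b (min (grid m i) t))"
            by simp
        qed
        finally show ?case by simp
      qed
      moreover have "(\<lambda>m. N t \<omega> * I t \<omega> - ?R m) \<longlonglongrightarrow> ?Z t \<omega>"
        using R by (intro tendsto_intros)
      ultimately show "(\<lambda>m. K m t \<omega>) \<longlonglongrightarrow> ?Z t \<omega>"
        by (rule tendsto_cong[THEN iffD2])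
    qed
  qed
  have Za: "adapted_continuous M F ?Z"
  proof (rule adapted_AE_LIMSEQ[OF itoD(3)[OF GK] Klim])
    show "AE \<omega> in M. continuous_on {0..} (\<lambda>t. ?Z t \<omega>)"
      using Nc Ic n
    proof eventually_elim
      case (elim \<omega>)
      have "set_integrable lborel {0..t} (\<lambda>s. I s \<omega> * n s \<omega>)" if "0 \<le> t" for t
        by (rule set_integrable_continuous_mult[OF continuous_on_subset[OF elim(2)]]) (use elim that in auto)
      then show ?case using elim by (intro continuous_intros continuous_on_set_integral)
    qed
  qed
  have NH: "has_measurable_version M (\<lambda>s \<omega>. N s \<omega> * H s \<omega>)"
    by (intro has_measurable_version_mult has_measurable_version_adapted_continuous[OF N] itoD(1)[OF I])
  show ?thesis
  proof (rule ito_closed[OF GK NH _ Za])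
    show "AE \<omega> in M. \<forall>t\<ge>0. sq_int t (\<lambda>s. N s \<omega> * H s \<omega>)"
      using Nc itoD(2)[OF I]
    proof eventually_elim
      case (elim \<omega>)
      show ?case
        using elim(2) by (auto intro!: sq_int_continuous_mult continuous_on_subset[OF elim(1)])
    qed
    fix t :: real assume t: "0 \<le> t"
    show "tzip (\<lambda>m \<omega>. sq_norm t (\<lambda>s. G m s \<omega> - N s \<omega> * H s \<omega>))"
    proof (rule tzip_AE)
      show "(\<lambda>\<omega>. sq_norm t (\<lambda>s. G k s \<omega> - N s \<omega> * H s \<omega>)) \<in> borel_measurable M" for k
        by (intro sq_norm_measurable has_measurable_version_diff itoD(1)[OF GK] NH)
      show "AE \<omega> in M. (\<lambda>m. sq_norm t (\<lambda>s. G m s \<omega> - N s \<omega> * H s \<omega>)) \<longlonglongrightarrow> 0"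
        using Glim by eventually_elim (use t in auto)
    qed
    show "tzip (\<lambda>m \<omega>. K m t \<omega> - ?Z t \<omega>)"
    proof (rule tzip_AE)
      have "?Z t \<in> borel_measurable M"
        by (rule adapted_measurable[OF Za t])
      then show "(\<lambda>\<omega>. K k t \<omega> - ?Z t \<omega>) \<in> borel_measurable M" for k
        by (rule borel_measurable_diff[OF itoD(4)[OF GK t]])
      show "AE \<omega> in M. (\<lambda>m. K m t \<omega> - ?Z t \<omega>) \<longlonglongrightarrow> 0"
        using Klim
      proof eventually_elim
        case (elim \<omega>)
        then show ?case using t by (subst LIM_zero_iff) auto
      qed
    qed
  qed
qed

end

subsection \<open>Escape probabilities on short intervals\<close>

context prob_space
begin

text \<open>The condition \<open>P\<close> may quantify over uncountably many times and is not
  assumed measurable, so it is covered by an event. The cover is the limit inferior of the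
  \<open>A m\<close>: tail intersections have probability at most \<open>p\<close> and increase, so
  the bound survives the union.\<close>

lemma liminf_event:
  assumes A: "\<And>m. A m \<in> sets M" "\<And>m::nat. prob (A m) \<le> p"
    and ev: "AE \<omega> in M. P \<omega> \<longrightarrow> eventually (\<lambda>m. \<omega> \<in> A m) sequentially"
  shows "\<exists>A\<in>sets M. prob A \<le> p \<and> (AE \<omega> in M. P \<omega> \<longrightarrow> \<omega> \<in> A)"
proof (intro bexI conjI)
  let ?D = "\<lambda>N. \<Inter>m\<in>{N..}. A m"
  show m: "(\<Union>N. ?D N) \<in> sets M" using A by auto
  have D: "?D N \<in> sets M" for N using A by auto
  have lim: "(\<lambda>N. prob (?D N)) \<longlonglongrightarrow> prob (\<Union>N. ?D N)"
  proof (rule finite_Lim_measure_incseq)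
    show "range ?D \<subseteq> sets M" using D by auto
    show "incseq ?D" by (rule incseq_SucI) (auto simp: Suc_le_eq)
  qed
  have le: "prob (?D N) \<le> p" for N
    by (rule order_trans[OF finite_measure_mono A(2)[of N]]) (use A in auto)
  show "prob (\<Union>N. ?D N) \<le> p" by (rule LIMSEQ_le_const2[OF lim]) (use le in auto)
  show "AE \<omega> in M. P \<omega> \<longrightarrow> \<omega> \<in> (\<Union>N. ?D N)"
    using ev by eventually_elim (auto simp: eventually_sequentially)
qed

lemma liminf_event_cover:
  assumes A: "\<And>k::nat. \<exists>A\<in>sets M. prob A \<le> p \<and> (AE \<omega> in M. P k \<omega> \<longrightarrow> \<omega> \<in> A)"
    and ev: "AE \<omega> in M. Q \<omega> \<longrightarrow> eventually (\<lambda>k. P k \<omega>) sequentially"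
  shows "\<exists>A\<in>sets M. prob A \<le> p \<and> (AE \<omega> in M. Q \<omega> \<longrightarrow> \<omega> \<in> A)"
proof -
  have "\<forall>k. \<exists>A. A \<in> sets M \<and> prob A \<le> p \<and> (AE \<omega> in M. P k \<omega> \<longrightarrow> \<omega> \<in> A)"
    using A by blast
  then obtain D where D: "\<forall>k. D k \<in> sets M \<and> prob (D k) \<le> p \<and> (AE \<omega> in M. P k \<omega> \<longrightarrow> \<omega> \<in> D k)"
    unfolding choice_iff by (elim exE)
  show ?thesis
  proof (rule liminf_event[of D])
    have "AE \<omega> in M. \<forall>k. P k \<omega> \<longrightarrow> \<omega> \<in> D k" using D by (simp add: AE_all_countable)
    then show "AE \<omega> in M. Q \<omega> \<longrightarrow> eventually (\<lambda>m. \<omega> \<in> D m) sequentially"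
      using ev by eventually_elim (auto elim!: eventually_mono)
  qed (use D in auto)
qed

lemma finite_event_cover:
  assumes "finite L" and A: "\<And>l. l \<in> L \<Longrightarrow> \<exists>A\<in>sets M. prob A \<le> p l \<and> (AE \<omega> in M. P l \<omega> \<longrightarrow> \<omega> \<in> A)"
  shows "\<exists>A\<in>sets M. prob A \<le> (\<Sum>l\<in>L. p l) \<and> (AE \<omega> in M. (\<exists>l\<in>L. P l \<omega>) \<longrightarrow> \<omega> \<in> A)"
proof -
  have "\<forall>l\<in>L. \<exists>A. A \<in> sets M \<and> prob A \<le> p l \<and> (AE \<omega> in M. P l \<omega> \<longrightarrow> \<omega> \<in> A)"
    using A by blast
  then obtain D where D: "\<forall>l\<in>L. D l \<in> sets M \<and> prob (D l) \<le> p l \<and> (AE \<omega> in M. P l \<omega> \<longrightarrow> \<omega> \<in> D l)"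
    unfolding bchoice_iff by (elim exE)
  show ?thesis
  proof (intro bexI conjI)
    have "prob (\<Union>l\<in>L. D l) \<le> (\<Sum>l\<in>L. prob (D l))"
      by (rule measure_UNION_le) (use assms(1) D in auto)
    also have "\<dots> \<le> (\<Sum>l\<in>L. p l)" using D by (intro sum_mono) auto
    finally show "prob (\<Union>l\<in>L. D l) \<le> (\<Sum>l\<in>L. p l)" .
    have "AE \<omega> in M. \<forall>l\<in>L. P l \<omega> \<longrightarrow> \<omega> \<in> D l" using D assms(1) by (simp add: AE_finite_all)
    then show "AE \<omega> in M. (\<exists>l\<in>L. P l \<omega>) \<longrightarrow> \<omega> \<in> (\<Union>l\<in>L. D l)" by eventually_elim auto
    show "(\<Union>l\<in>L. D l) \<in> sets M" using D assms(1) by auto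
  qed
qed

text \<open>Covers of probability at most \<open>1 / (k + 1)\<close> are intersected over all
  \<open>k\<close>, leaving a null set.\<close>

lemma AE_not_if_small_cover:
  assumes "\<And>e. 0 < e \<Longrightarrow> \<exists>A\<in>sets M. prob A \<le> e \<and> (AE \<omega> in M. P \<omega> \<longrightarrow> \<omega> \<in> A)"
  shows "AE \<omega> in M. \<not> P \<omega>"
proof -
  have "\<forall>k::nat. \<exists>A. A \<in> sets M \<and> prob A \<le> 1 / real (Suc k) \<and> (AE \<omega> in M. P \<omega> \<longrightarrow> \<omega> \<in> A)"
    using assms[of "1 / real (Suc k)" for k] by (auto simp: Bex_def)
  then obtain D where D: "\<forall>k. D k \<in> sets M \<and> prob (D k) \<le> 1 / real (Suc k) \<and> (AE \<omega> in M. P \<omega> \<longrightarrow> \<omega> \<in> D k)"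
    unfolding choice_iff by (elim exE)
  let ?D = "\<Inter>k. D k"
  have m: "?D \<in> sets M" using D by auto
  have "prob ?D \<le> 1 / real (Suc k)" for k
    by (rule order_trans[OF finite_measure_mono[of _ "D k"]]) (use D in auto)
  moreover have "(\<lambda>k. 1 / real (Suc k)) \<longlonglongrightarrow> 0"
    using LIMSEQ_inverse_real_of_nat by (simp add: inverse_eq_divide)
  ultimately have "prob ?D \<le> 0" by (intro LIMSEQ_le_const) auto
  then have "?D \<in> null_sets M" using m
    by (intro null_setsI) (auto simp: emeasure_eq_measure ennreal_eq_0_iff)
  then have "AE \<omega> in M. \<omega> \<notin> ?D" by (rule AE_not_in)
  moreover have "AE \<omega> in M. \<forall>k. P \<omega> \<longrightarrow> \<omega> \<in> D k" unfolding AE_all_countable using D by blast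
  ultimately show ?thesis by eventually_elim auto
qed

end

lemma exists_large_summand:
  fixes u :: "'n::finite \<Rightarrow> real"
  assumes "\<theta> < \<bar>\<Sum>j\<in>UNIV. u j\<bar>"
  shows "\<exists>j. \<theta> / real CARD('n) < \<bar>u j\<bar>"
proof (rule ccontr)
  assume "\<not> ?thesis"
  then have "\<bar>u j\<bar> \<le> \<theta> / real CARD('n)" for j by (auto simp: not_less)
  then have "(\<Sum>j\<in>UNIV. \<bar>u j\<bar>) \<le> (\<Sum>j\<in>(UNIV::'n set). \<theta> / real CARD('n))" by (intro sum_mono) auto
  then show False using assms sum_abs[of u UNIV] by simp
qed

context brownian_motion
begin

text \<open>The increments of \<open>R\<close> are frozen after the first grid point at which \<open>R\<close> has left the
  \<open>\<theta>\<close>-neighbourhood of its starting value. The frozen sum is again an Ito integral, and by uniform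
  continuity its integrand is eventually dominated by \<open>3 C\<close>.\<close>

lemma small_interval_escape:
  fixes C :: "real \<Rightarrow> real^'n^'n" and R :: "'n \<Rightarrow> real \<Rightarrow> 'a \<Rightarrow> real" and K :: "'n \<Rightarrow> 'n \<Rightarrow> real \<Rightarrow> 'a \<Rightarrow> real"
  assumes C: "\<And>i j. sq_int b (\<lambda>s. C s $ i $ j)"
    and ab: "0 \<le> a" "a < b"
    and K: "\<And>i j. ito j (\<lambda>s \<omega>. indicator {a<..b} s * C s $ i $ j * R j s \<omega>) (K i j)"
    and Rm: "\<And>j t. a \<le> t \<Longrightarrow> t \<le> b \<Longrightarrow> R j t \<in> borel_measurable (F t)"
    and Rc: "AE \<omega> in M. \<forall>j. continuous_on {a..b} (\<lambda>t. R j t \<omega>)"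
    and RK: "AE \<omega> in M. \<forall>i. \<forall>t\<in>{a..b}. R i t \<omega> - R i a \<omega> = (\<Sum>j\<in>UNIV. K i j t \<omega> - K i j a \<omega>)"
    and Ra: "AE \<omega> in M. \<forall>j. \<bar>R j a \<omega>\<bar> \<le> 1"
    and \<theta>: "0 < \<theta>" "\<theta> \<le> 1"
    and \<eta>: "0 < \<eta>" "\<And>i j. sq_norm b (\<lambda>s. indicator {a<..b} s * C s $ i $ j) \<le> \<eta>"
  shows "\<exists>A\<in>sets M. prob A \<le> (real CARD('n))\<^sup>2 * (64 * (9 * \<eta>)\<^sup>2 / (\<theta> / real CARD('n)) ^ 4) \<and>
    (AE \<omega> in M. (\<exists>t\<in>{a..b}. \<exists>i. \<theta> < \<bar>R i t \<omega> - R i a \<omega>\<bar>) \<longrightarrow> \<omega> \<in> A)"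
proof -
  let ?n = "real CARD('n)"
  \<comment> \<open>Uniform partitions of \<open>[a, b]\<close> into \<open>m + 1\<close> cells play
    the part of time for a discretised exit time.\<close>
  define \<tau> where "\<tau> m p = a + (b - a) * (real p / real (Suc m))" for m p
  \<comment> \<open>No exit has been seen at any grid point up to \<open>p\<close>. This is known at
    time \<open>\<tau> m p\<close>, so its indicator is an admissible factor for the next
    cell.\<close>
  define E where "E m p = {\<omega> \<in> space M. \<forall>q\<in>{..p}. \<forall>i\<in>UNIV. \<bar>R i (\<tau> m q) \<omega> - R i a \<omega>\<bar> \<le> \<theta>}" for m p
  define \<phi> :: "nat \<Rightarrow> nat \<Rightarrow> 'a \<Rightarrow> real" where "\<phi> m p = indicator (E m p)" for m p
  define H where "H m i j s \<omega> = (\<Sum>p<Suc m. \<phi> m p \<omega> * indicator {\<tau> m p<..\<tau> m (Suc p)} s *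
     (indicator {a<..b} s * C s $ i $ j * R j s \<omega>))" for m i j s \<omega>
  define J where "J m i j t \<omega> = (\<Sum>p<Suc m. \<phi> m p \<omega> * (K i j (min (\<tau> m (Suc p)) t) \<omega> - K i j (min (\<tau> m p) t) \<omega>))" for m i j t \<omega>
  \<comment> \<open>The component that escapes and the driving coordinate responsible for it depend
    on the path, hence the union over all pairs; their number is the factor
    \<open>?n\<^sup>2\<close> of the bound.\<close>
  define A where "A m = (\<Union>(i, j)\<in>UNIV. {\<omega> \<in> space M. \<theta> / ?n < \<bar>J m i j b \<omega>\<bar> \<and> sq_norm b (\<lambda>s. H m i j s \<omega>) \<le> 9 * \<eta>})" for m
  have \<tau>0: "\<tau> m 0 = a" and \<tau>end: "\<tau> m (Suc m) = b" for m by (simp_all add: \<tau>_def del: of_nat_Suc)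
  have \<tau>mono: "\<tau> m p \<le> \<tau> m q" if "p \<le> q" for m p q
    using that ab by (auto simp: \<tau>_def intro!: mult_left_mono divide_right_mono)
  have \<tau>a: "a \<le> \<tau> m p" for m p using \<tau>mono[of 0 p m] \<tau>0 by simp
  have \<tau>b: "\<tau> m p \<le> b" if "p \<le> Suc m" for m p using \<tau>mono[OF that, of m] \<tau>end by simp
  have \<tau>Suc: "\<tau> m (Suc p) - \<tau> m p = (b - a) / real (Suc m)" for m p
  proof -
    have "\<tau> m (Suc p) - \<tau> m p = (b - a) * (real (Suc p) / real (Suc m) - real p / real (Suc m))"
      by (simp add: \<tau>_def right_diff_distrib)
    also have "\<dots> = (b - a) / real (Suc m)" by (simp only: diff_divide_distrib[symmetric]) simp
    finally show ?thesis .
  qed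
  have Em: "E m p \<in> sets (F (\<tau> m p))" if p: "p \<le> Suc m" for m p
  proof -
    have Rp: "R i (\<tau> m q) \<in> borel_measurable (F (\<tau> m p))" if "q \<le> p" for q i
      by (rule measurable_F_mono[OF Rm]) (use \<tau>a[of m q] \<tau>b[of q m] \<tau>mono[OF that, of m] ab p that in auto)
    have Ra': "R i a \<in> borel_measurable (F (\<tau> m p))" for i
      using Rp[of 0 i] by (simp add: \<tau>0)
    have "{\<omega> \<in> space (F (\<tau> m p)). \<forall>q\<in>{..p}. \<forall>i\<in>UNIV. \<bar>R i (\<tau> m q) \<omega> - R i a \<omega>\<bar> \<le> \<theta>} \<in> sets (F (\<tau> m p))"
      by (intro sets.sets_Collect_finite_All borel_measurable_le borel_measurable_abs borel_measurable_diff Rp Ra') auto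
    moreover have "0 \<le> \<tau> m p" using \<tau>a[of m p] ab by simp
    ultimately show ?thesis by (simp add: E_def space_F)
  qed
  have HJ: "ito j (H m i j) (J m i j)" for m i j
    unfolding H_def J_def
  proof (rule ito_sum)
    fix p assume "p \<in> {..<Suc m}"
    then have p: "p \<le> Suc m" by simp
    show "ito j (\<lambda>s \<omega>. \<phi> m p \<omega> * indicator {\<tau> m p<..\<tau> m (Suc p)} s * (indicator {a<..b} s * C s $ i $ j * R j s \<omega>))
      (\<lambda>t \<omega>. \<phi> m p \<omega> * (K i j (min (\<tau> m (Suc p)) t) \<omega> - K i j (min (\<tau> m p) t) \<omega>))"
    proof (rule ito_step[OF K, where c=1])
      show "\<phi> m p \<in> borel_measurable (F (\<tau> m p))"
        unfolding \<phi>_def by (rule borel_measurable_indicator[OF Em[OF p]])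
      show "0 \<le> \<tau> m p" using \<tau>a[of m p] ab by simp
    qed (auto simp: \<phi>_def indicator_def intro: \<tau>mono)
  qed simp
  have Am: "{\<omega> \<in> space M. \<theta> / ?n < \<bar>J m i j b \<omega>\<bar> \<and> sq_norm b (\<lambda>s. H m i j s \<omega>) \<le> 9 * \<eta>} \<in> sets M" for m i j
  proof -
    have [measurable]: "J m i j b \<in> borel_measurable M" "(\<lambda>\<omega>. sq_norm b (\<lambda>s. H m i j s \<omega>)) \<in> borel_measurable M"
      using itoD(4)[OF HJ, of b] ab sq_norm_measurable[OF itoD(1)[OF HJ]] by auto
    show ?thesis by measurable
  qed
  show ?thesis
  proof (rule liminf_event[of A])
    show "A m \<in> sets M" for m unfolding A_def using Am by (intro sets.finite_UN) auto
    have n0: "0 < \<theta> / ?n" using \<theta> by simp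
    show "prob (A m) \<le> ?n\<^sup>2 * (64 * (9 * \<eta>)\<^sup>2 / (\<theta> / ?n) ^ 4)" for m
    proof -
      have "prob (A m) \<le> (\<Sum>(i, j)\<in>UNIV. prob {\<omega> \<in> space M. \<theta> / ?n < \<bar>J m i j b \<omega>\<bar> \<and> sq_norm b (\<lambda>s. H m i j s \<omega>) \<le> 9 * \<eta>})"
        unfolding A_def split_beta' by (rule measure_UNION_le) (use Am in auto)
      also have "\<dots> \<le> (\<Sum>(i::'n, j::'n)\<in>UNIV. 64 * (9 * \<eta>)\<^sup>2 / (\<theta> / ?n) ^ 4)"
        unfolding split_beta' by (intro sum_mono ito_tail[OF HJ _ n0]) (use ab \<eta> in auto)
      also have "\<dots> = ?n\<^sup>2 * (64 * (9 * \<eta>)\<^sup>2 / (\<theta> / ?n) ^ 4)"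
        by (simp add: split_beta' card_prod power2_eq_square)
      finally show ?thesis .
    qed
    have sqH: "AE \<omega> in M. \<forall>m i j. sq_int b (\<lambda>s. H m i j s \<omega>)"
      unfolding AE_all_countable
    proof (intro allI)
      fix m i j
      show "AE \<omega> in M. sq_int b (\<lambda>s. H m i j s \<omega>)"
        using itoD(2)[OF HJ[of j m i]] by eventually_elim (use ab in auto)
    qed
    show "AE \<omega> in M. (\<exists>t\<in>{a..b}. \<exists>i. \<theta> < \<bar>R i t \<omega> - R i a \<omega>\<bar>) \<longrightarrow> eventually (\<lambda>m. \<omega> \<in> A m) sequentially"
      using Rc RK Ra sqH AE_space
    proof eventually_elim
      case (elim \<omega>)
      note cont = elim(1) and RK' = elim(2) and Ra' = elim(3) and sqH' = elim(4)
      show ?case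
      proof
        assume "\<exists>t\<in>{a..b}. \<exists>i. \<theta> < \<bar>R i t \<omega> - R i a \<omega>\<bar>"
        then obtain u k where u: "u \<in> {a..b}" "\<theta> < \<bar>R k u \<omega> - R k a \<omega>\<bar>" by blast
        \<comment> \<open>An oscillation below \<open>e\<close> within a cell has two uses: a grid
          point next to \<open>u\<close> is still more than \<open>\<theta>\<close> away from the
          start, and \<open>R\<close> moves by less than 1 within a cell.\<close>
        define e where "e = min 1 (\<bar>R k u \<omega> - R k a \<omega>\<bar> - \<theta>)"
        have e: "0 < e" using u by (simp add: e_def)
        have "\<exists>d>0. \<forall>s\<in>{a..b}. \<forall>r\<in>{a..b}. \<bar>r - s\<bar> < d \<longrightarrow> \<bar>R j r \<omega> - R j s \<omega>\<bar> < e" for j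
          using compact_uniformly_continuous[OF spec[OF cont, of j]] e
          unfolding uniformly_continuous_on_def dist_real_def by simp
        then obtain d where d: "\<And>j. 0 < d j" "\<And>j s r. s \<in> {a..b} \<Longrightarrow> r \<in> {a..b} \<Longrightarrow> \<bar>r - s\<bar> < d j \<Longrightarrow> \<bar>R j r \<omega> - R j s \<omega>\<bar> < e"
          by metis
        define d0 where "d0 = Min (range d)"
        have d0: "0 < d0" "\<And>j. d0 \<le> d j" using d(1) by (auto simp: d0_def)
        have "(\<lambda>m. (b - a) * (1 / real (Suc m))) \<longlonglongrightarrow> (b - a) * 0"
          using LIMSEQ_inverse_real_of_nat by (intro tendsto_mult_left) (simp add: inverse_eq_divide)
        then have "eventually (\<lambda>m. (b - a) / real (Suc m) < d0) sequentially"
          using d0(1) by (auto dest: order_tendstoD(2))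
        then show "eventually (\<lambda>m. \<omega> \<in> A m) sequentially"
        proof eventually_elim
          case (elim m)
          have near: "\<bar>R j r \<omega> - R j s \<omega>\<bar> < e" if "s \<in> {a..b}" "r \<in> {a..b}" "\<bar>r - s\<bar> \<le> (b - a) / real (Suc m)" for j s r
            using d(2)[OF that(1,2), of j] that(3) elim d0(2)[of j] by linarith
          have mono': "\<tau> m p \<le> \<tau> m (Suc p)" for p using \<tau>mono by simp
          let ?bad = "\<lambda>q. q \<le> Suc m \<and> (\<exists>i. \<theta> < \<bar>R i (\<tau> m q) \<omega> - R i a \<omega>\<bar>)"
          \<comment> \<open>The grid point just before \<open>u\<close> does it: rounding moves
            \<open>u\<close> by at most one cell, which costs less than the excess over
            \<open>\<theta>\<close>.\<close>
          have "\<exists>q. ?bad q"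
          proof (cases "u = a")
            case False
            define v where "v = (u - a) / (b - a) * real (Suc m)"
            define q where "q = nat \<lfloor>v\<rfloor>"
            have "0 \<le> v" using u ab by (simp add: v_def)
            then have q: "real q \<le> v" "v < real q + 1" unfolding q_def by linarith+
            have "v \<le> 1 * real (Suc m)"
              unfolding v_def using u ab by (intro mult_right_mono) auto
            then have "real q \<le> real (Suc m)" using order_trans[OF q(1)] by (simp only: mult_1)
            then have qm: "q \<le> Suc m" by (simp only: of_nat_le_iff)
            have "u - a = (b - a) * (v / real (Suc m))"
              using ab by (simp add: v_def del: of_nat_Suc)
            then have 1: "u - \<tau> m q = (b - a) * (v - real q) / real (Suc m)"
              by (simp add: \<tau>_def right_diff_distrib diff_divide_distrib del: of_nat_Suc)
            have "\<bar>u - \<tau> m q\<bar> \<le> (b - a) / real (Suc m)"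
            proof -
              have 2: "0 \<le> (b - a) * (v - real q)" using q ab by simp
              have "(b - a) * (v - real q) \<le> (b - a) * 1"
                using q ab by (intro mult_left_mono) auto
              then have "(b - a) * (v - real q) / real (Suc m) \<le> (b - a) / real (Suc m)"
                by (intro divide_right_mono) auto
              then show ?thesis unfolding 1 using divide_nonneg_nonneg[OF 2, of "real (Suc m)"] by simp
            qed
            then have "\<bar>R k u \<omega> - R k (\<tau> m q) \<omega>\<bar> < e"
              using near[of "\<tau> m q" u k] u \<tau>a \<tau>b[OF qm] by simp
            then have "\<theta> < \<bar>R k (\<tau> m q) \<omega> - R k a \<omega>\<bar>" unfolding e_def by linarith
            then show ?thesis using qm by blast
          qed (use u \<theta> in auto)
          define \<kappa> where "\<kappa> = (LEAST q. ?bad q)"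
          have bad\<kappa>: "?bad \<kappa>" unfolding \<kappa>_def by (rule LeastI_ex) fact
          have before: "\<not> ?bad q" if "q < \<kappa>" for q using not_less_Least that unfolding \<kappa>_def by blast
          have \<phi>: "\<phi> m p \<omega> = (if p < \<kappa> then 1 else 0)" if p: "p < Suc m" for p
          proof -
            have "\<omega> \<in> E m p \<longleftrightarrow> p < \<kappa>"
            proof
              assume "\<omega> \<in> E m p"
              then have le: "\<bar>R i (\<tau> m q) \<omega> - R i a \<omega>\<bar> \<le> \<theta>" if "q \<le> p" for q i
                using that unfolding E_def by simp
              obtain i where "\<theta> < \<bar>R i (\<tau> m \<kappa>) \<omega> - R i a \<omega>\<bar>" using bad\<kappa> by blast
              then have "\<not> \<kappa> \<le> p" using le[of \<kappa> i] by linarith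
              then show "p < \<kappa>" by simp
            next
              assume "p < \<kappa>"
              have "\<bar>R i (\<tau> m q) \<omega> - R i a \<omega>\<bar> \<le> \<theta>" if "q \<le> p" for q i
                using before[of q] \<open>p < \<kappa>\<close> that p by (simp add: not_less)
              then show "\<omega> \<in> E m p" using \<open>\<omega> \<in> space M\<close> unfolding E_def by simp
            qed
            then show ?thesis by (simp add: \<phi>_def indicator_def)
          qed
          obtain i where i: "\<theta> < \<bar>R i (\<tau> m \<kappa>) \<omega> - R i a \<omega>\<bar>" using bad\<kappa> by blast
          have \<kappa>m: "\<kappa> \<le> Suc m" using bad\<kappa> by blast
          have Jeq: "J m i j b \<omega> = K i j (\<tau> m \<kappa>) \<omega> - K i j a \<omega>" for j
          proof -
            have "J m i j b \<omega> = (\<Sum>p<Suc m. if p \<in> {..<\<kappa>} then K i j (\<tau> m (Suc p)) \<omega> - K i j (\<tau> m p) \<omega> else 0)"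
              unfolding J_def
            proof (intro sum.cong refl)
              fix p assume p: "p \<in> {..<Suc m}"
              then have "min (\<tau> m (Suc p)) b = \<tau> m (Suc p)" "min (\<tau> m p) b = \<tau> m p"
                using \<tau>b[of p m] \<tau>b[of "Suc p" m] by auto
              then show "\<phi> m p \<omega> * (K i j (min (\<tau> m (Suc p)) b) \<omega> - K i j (min (\<tau> m p) b) \<omega>) =
                 (if p \<in> {..<\<kappa>} then K i j (\<tau> m (Suc p)) \<omega> - K i j (\<tau> m p) \<omega> else 0)"
                using \<phi>[of p] p by simp
            qed
            also have "\<dots> = (\<Sum>p\<in>{..<Suc m} \<inter> {..<\<kappa>}. K i j (\<tau> m (Suc p)) \<omega> - K i j (\<tau> m p) \<omega>)"
              by (subst sum.inter_restrict) auto
            also have "{..<Suc m} \<inter> {..<\<kappa>} = {..<\<kappa>}" using \<kappa>m by auto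
            also have "(\<Sum>p<\<kappa>. K i j (\<tau> m (Suc p)) \<omega> - K i j (\<tau> m p) \<omega>) = K i j (\<tau> m \<kappa>) \<omega> - K i j (\<tau> m 0) \<omega>"
              by (rule sum_lessThan_telescope)
            finally show ?thesis by (simp add: \<tau>0)
          qed
          have "R i (\<tau> m \<kappa>) \<omega> - R i a \<omega> = (\<Sum>j\<in>UNIV. J m i j b \<omega>)"
            unfolding Jeq using RK' \<tau>a \<tau>b[OF \<kappa>m] by simp
          then obtain j where j: "\<theta> / ?n < \<bar>J m i j b \<omega>\<bar>"
            using i exists_large_summand[of \<theta> "\<lambda>j. J m i j b \<omega>"] by auto
          \<comment> \<open>While a cell is switched on, \<open>R\<close> is at most 1 at the start,
            has moved by at most \<open>\<theta> \<le> 1\<close> at the left end of the cell, and by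
            less than 1 inside it. This is the factor 3, whose square gives
            \<open>9 * \<eta>\<close>.\<close>
          have "sq_norm b (\<lambda>s. H m i j s \<omega>) \<le> 3\<^sup>2 * sq_norm b (\<lambda>s. indicator {a<..b} s * C s $ i $ j)"
          proof (rule sq_int_dominated(2))
            have "(\<lambda>s. indicator {a<..b} s * (indicator {0..b} s * C s $ i $ j)) \<in> borel_measurable lborel"
              by (rule lborel_measurable_mult) (use C in \<open>auto simp: sq_int_iff\<close>)
            then have "set_borel_measurable lborel {0..b} (\<lambda>s. indicator {a<..b} s * C s $ i $ j)"
              by (simp only: set_borel_measurable_def real_scaleR_def mult.left_commute)
            then show "sq_int b (\<lambda>s. indicator {a<..b} s * C s $ i $ j)"
              by (rule sq_int_dominated(1)[OF C[of i j], where c=1]) (auto simp: indicator_def)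
            show "set_borel_measurable lborel {0..b} (\<lambda>s. H m i j s \<omega>)" using sqH' by (simp add: sq_int_def)
            fix s :: real
            show "\<bar>H m i j s \<omega>\<bar> \<le> 3 * \<bar>indicator {a<..b} s * C s $ i $ j\<bar>"
            proof (rule step_sum_cases[of "Suc m" "\<tau> m" s, OF mono'])
              fix p
              assume 2: "p < Suc m" "\<tau> m p < s" "s \<le> \<tau> m (Suc p)"
                "\<And>z. (\<Sum>i<Suc m. z i * indicator {\<tau> m i<..\<tau> m (Suc i)} s) = (z p :: real)"
              have Hs: "H m i j s \<omega> = \<phi> m p \<omega> * (indicator {a<..b} s * C s $ i $ j * R j s \<omega>)"
                using 2(4)[of "\<lambda>p. \<phi> m p \<omega>"] unfolding H_def sum_distrib_right[symmetric] by simp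
              show ?thesis
              proof (cases "p < \<kappa>")
                case True
                have s: "s \<in> {a..b}" "\<bar>s - \<tau> m p\<bar> \<le> (b - a) / real (Suc m)"
                  using 2 \<tau>a[of m p] \<tau>b[of "Suc p" m] \<tau>Suc[of m p] by auto
                have "\<bar>R j s \<omega> - R j (\<tau> m p) \<omega>\<bar> < 1"
                  using near[of "\<tau> m p" s j] s 2 \<tau>a \<tau>b[of p m] by (auto simp: e_def)
                moreover have "\<bar>R j (\<tau> m p) \<omega> - R j a \<omega>\<bar> \<le> \<theta>"
                  using before[OF True] 2 by (auto simp: not_less)
                moreover have "\<bar>R j a \<omega>\<bar> \<le> 1" using Ra' by simp
                ultimately have "\<bar>R j s \<omega>\<bar> \<le> 3" using \<theta> by linarith
                then have "\<bar>indicator {a<..b} s * C s $ i $ j\<bar> * \<bar>R j s \<omega>\<bar> \<le> \<bar>indicator {a<..b} s * C s $ i $ j\<bar> * 3"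
                  by (intro mult_left_mono) auto
                then show ?thesis unfolding Hs using \<phi>[of p] 2 True by (simp add: abs_mult)
              next
                case False
                then show ?thesis unfolding Hs using \<phi>[of p] 2 by simp
              qed
            next
              assume 3: "\<And>z. (\<Sum>i<Suc m. z i * indicator {\<tau> m i<..\<tau> m (Suc i)} s) = (0 :: real)"
              have "H m i j s \<omega> = 0"
                using 3[of "\<lambda>p. \<phi> m p \<omega>"] unfolding H_def sum_distrib_right[symmetric] by simp
              then show ?thesis by simp
            qed
          qed
          also have "\<dots> \<le> 3\<^sup>2 * \<eta>" using \<eta>(2) by (intro mult_left_mono) auto
          finally have "sq_norm b (\<lambda>s. H m i j s \<omega>) \<le> 9 * \<eta>" by simp
          then show ?case unfolding A_def using j \<open>\<omega> \<in> space M\<close> by auto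
        qed
      qed
    qed
  qed
qed

end

subsection \<open>Cramer's rule for the inverse matrix\<close>

text \<open>Unlike \<open>matrix_inv\<close>, which is a choice, this is an explicit rational
  function of the entries, so continuity and measurability can be read off. At singular matrices
  division by zero gives 0, which keeps it measurable everywhere.\<close>

definition cramer_inverse :: "real^'n^'n \<Rightarrow> real^'n^'n" where
  "cramer_inverse A = (\<chi> m l. det (\<chi> i j. if j = m then (if i = l then 1 else 0) else A $ i $ j) / det A)"

lemma matrix_mult_cramer_inverse:
  fixes A :: "real^'n^'n"
  assumes "det A \<noteq> 0"
  shows "A ** cramer_inverse A = mat 1"
proof -
  have "(A ** cramer_inverse A) $ i $ l = mat 1 $ i $ l" for i l
  proof -
    have "A *v (\<chi> k. det (\<chi> i j. if j = k then axis l 1 $ i else A $ i $ j) / det A) = axis l 1"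
      by (subst cramer[OF assms]) (rule refl)
    moreover have "(\<chi> i j. if j = k then axis l 1 $ i else A $ i $ j) =
        (\<chi> i j. if j = k then (if i = l then 1 else 0) else A $ i $ j)" for k
      by (simp add: vec_eq_iff axis_def)
    ultimately have "(A *v (\<chi> k. cramer_inverse A $ k $ l)) $ i = axis l 1 $ i"
      by (simp only: cramer_inverse_def vec_lambda_beta)
    then show ?thesis by (simp add: matrix_matrix_mult_def matrix_vector_mult_def mat_def axis_def)
  qed
  then show ?thesis by (simp add: vec_eq_iff)
qed

lemma matrix_inv_eq_cramer_inverse:
  fixes A :: "real^'n^'n"
  assumes "invertible A"
  shows "matrix_inv A = cramer_inverse A"
proof -
  have "det A \<noteq> 0" using assms by (simp add: invertible_det_nz)
  then have "matrix_inv A = matrix_inv A ** (A ** cramer_inverse A)"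
    by (simp add: matrix_mult_cramer_inverse)
  also have "\<dots> = cramer_inverse A"
  proof -
    have "matrix_inv A ** A = mat 1"
      using someI_ex[OF assms[unfolded invertible_def]] unfolding matrix_inv_def by blast
    then show ?thesis by (simp add: matrix_mul_assoc)
  qed
  finally show ?thesis .
qed

lemma continuous_on_det:
  fixes A :: "'t::topological_space \<Rightarrow> real^'n^'n"
  assumes "\<And>i j. continuous_on S (\<lambda>t. A t $ i $ j)"
  shows "continuous_on S (\<lambda>t. det (A t))"
  unfolding det_def by (intro continuous_intros assms)

lemma continuous_on_cramer_inverse:
  fixes A :: "'t::topological_space \<Rightarrow> real^'n^'n"
  assumes A: "continuous_on S A" and nz: "\<And>t. t \<in> S \<Longrightarrow> det (A t) \<noteq> 0"
  shows "continuous_on S (\<lambda>t. cramer_inverse (A t) $ m $ l)"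
proof -
  have c: "continuous_on S (\<lambda>t. A t $ i $ j)" for i j by (intro continuous_intros A)
  have "continuous_on S (\<lambda>t. det (\<chi> i j. if j = m then (if i = l then 1 else 0) else A t $ i $ j))"
  proof (rule continuous_on_det)
    fix i j
    show "continuous_on S (\<lambda>t. (\<chi> i j. if j = m then (if i = l then 1 else 0) else A t $ i $ j) $ i $ j)"
      by (cases "j = m") (use c in simp_all)
  qed
  then show ?thesis
    unfolding cramer_inverse_def using continuous_on_det[of S A, OF c] nz by (simp add: continuous_on_divide)
qed

lemma borel_measurable_matrix_entry:
  "A \<in> borel_measurable N \<Longrightarrow> (\<lambda>x. (A x :: real^'n^'m) $ i $ j) \<in> borel_measurable N"
  by (rule measurable_compose[of A N borel]) (auto intro!: borel_measurable_continuous_onI continuous_intros)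

lemma borel_measurable_det:
  fixes A :: "'t \<Rightarrow> real^'n^'n"
  assumes "\<And>i j. (\<lambda>x. A x $ i $ j) \<in> borel_measurable N"
  shows "(\<lambda>x. det (A x)) \<in> borel_measurable N"
  unfolding det_def by (intro borel_measurable_sum borel_measurable_times borel_measurable_prod assms borel_measurable_const)

lemma borel_measurable_cramer_inverse:
  fixes A :: "'t \<Rightarrow> real^'n^'n"
  assumes A: "A \<in> borel_measurable N"
  shows "(\<lambda>x. cramer_inverse (A x) $ m $ l) \<in> borel_measurable N"
proof -
  have "(\<lambda>x. det (\<chi> i j. if j = m then (if i = l then 1 else 0) else A x $ i $ j)) \<in> borel_measurable N"
  proof (rule borel_measurable_det)
    fix i j
    show "(\<lambda>x. (\<chi> i j. if j = m then (if i = l then 1 else 0) else A x $ i $ j) $ i $ j) \<in> borel_measurable N"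
      by (cases "j = m") (use borel_measurable_matrix_entry[OF A] in simp_all)
  qed
  then show ?thesis
    unfolding cramer_inverse_def
    using borel_measurable_divide borel_measurable_det[OF borel_measurable_matrix_entry[OF A]] by simp
qed

text \<open>Each of the \<open>CARD('n)\<close> entries in a row deviates by at most
  \<open>1 / (2 * CARD('n))\<close>, so a kernel vector with largest entry \<open>K\<close> in
  absolute value satisfies \<open>K \<le> K / 2\<close> and vanishes.\<close>

lemma det_near_identity:
  fixes A :: "real^'n^'n"
  assumes "\<And>i l. \<bar>A $ i $ l - (if i = l then 1 else 0)\<bar> \<le> 1 / (2 * real CARD('n))"
  shows "det A \<noteq> 0"
proof -
  have "x = 0" if x: "A *v x = 0" for x
  proof -
    define K where "K = Max (range (\<lambda>i. \<bar>x $ i\<bar>))"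
    have K: "\<bar>x $ i\<bar> \<le> K" for i by (auto simp: K_def)
    have "K \<in> range (\<lambda>i. \<bar>x $ i\<bar>)" unfolding K_def by (rule Max_in) auto
    then obtain i where i: "K = \<bar>x $ i\<bar>" by auto
    have "(\<Sum>l\<in>UNIV. A $ i $ l * x $ l) = 0" using x by (simp add: vec_eq_iff matrix_vector_mult_def)
    moreover have "(\<Sum>l\<in>UNIV. (if i = l then 1 else 0) * x $ l) = x $ i"
      by (simp add: if_distrib[of "\<lambda>c. c * _"] cong: if_cong)
    ultimately have "(\<Sum>l\<in>UNIV. (A $ i $ l - (if i = l then 1 else 0)) * x $ l) = - x $ i"
      by (simp add: left_diff_distrib sum_subtractf)
    then have "K = \<bar>\<Sum>l\<in>UNIV. (A $ i $ l - (if i = l then 1 else 0)) * x $ l\<bar>" using i by simp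
    also have "\<dots> \<le> (\<Sum>l\<in>(UNIV::'n set). 1 / (2 * real CARD('n)) * K)"
      by (rule order_trans[OF sum_abs], rule sum_mono, unfold abs_mult, rule mult_mono) (use assms K in auto)
    also have "\<dots> = K / 2" by simp
    finally have "K \<le> 0" by simp
    then show "x = 0" using K by (auto simp: vec_eq_iff intro: order_trans[THEN abs_le_zero_iff[THEN iffD1]])
  qed
  then have "invertible A"
    using matrix_left_invertible_ker[of A] invertible_left_inverse[of A] by auto
  then show ?thesis by (simp add: invertible_det_nz)
qed

section \<open>Adaptedness of vector and matrix processes and of Stieltjes integrals\<close>

context stochastic_basis
begin

lemma adapted_continuous_vec:
  fixes Z :: "real \<Rightarrow> 'a \<Rightarrow> 'b::euclidean_space"
  assumes m: "\<And>t e. 0 \<le> t \<Longrightarrow> e \<in> Basis \<Longrightarrow> (\<lambda>\<omega>. Z t \<omega> \<bullet> e) \<in> borel_measurable (F t)"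
    and c: "AE \<omega> in M. continuous_on {0..} (\<lambda>t. Z t \<omega>)"
  shows "adapted_continuous M F Z"
  unfolding adapted_continuous_def
proof (intro conjI allI impI c)
  fix t :: real assume "0 \<le> t"
  then show "Z t \<in> borel_measurable (F t)" by (subst borel_measurable_euclidean_space) (use m in auto)
qed

lemma adapted_continuous_entry:
  fixes G :: "real \<Rightarrow> 'a \<Rightarrow> real^'n^'n"
  assumes "adapted_continuous M F G"
  shows "adapted_continuous M F (\<lambda>t \<omega>. G t \<omega> $ i $ j)"
  unfolding adapted_continuous_def
proof (intro conjI allI impI)
  show "(\<lambda>\<omega>. G t \<omega> $ i $ j) \<in> borel_measurable (F t)" if "0 \<le> t" for t
    by (rule borel_measurable_matrix_entry) (use assms that in \<open>simp add: adapted_continuous_def\<close>)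
  have "AE \<omega> in M. continuous_on {0..} (\<lambda>t. G t \<omega>)" using assms by (simp add: adapted_continuous_def)
  then show "AE \<omega> in M. continuous_on {0..} (\<lambda>t. G t \<omega> $ i $ j)"
    by eventually_elim (intro continuous_intros)
qed

lemma adapted_continuous_component:
  fixes X :: "real \<Rightarrow> 'a \<Rightarrow> real^'n"
  assumes "adapted_continuous M F X"
  shows "adapted_continuous M F (\<lambda>t \<omega>. X t \<omega> $ i)"
  unfolding adapted_continuous_def
proof (intro conjI allI impI)
  show "(\<lambda>\<omega>. X t \<omega> $ i) \<in> borel_measurable (F t)" if "0 \<le> t" for t
    by (rule measurable_compose[OF _ borel_measurable_vec_nth]) (use assms that in \<open>simp add: adapted_continuous_def\<close>)
  have "AE \<omega> in M. continuous_on {0..} (\<lambda>t. X t \<omega>)" using assms by (simp add: adapted_continuous_def)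
  then show "AE \<omega> in M. continuous_on {0..} (\<lambda>t. X t \<omega> $ i)"
    by eventually_elim (intro continuous_intros)
qed

lemma adapted_continuous_matrix_vector:
  fixes U :: "real \<Rightarrow> 'a \<Rightarrow> real^'n^'n" and Y :: "real \<Rightarrow> 'a \<Rightarrow> real^'n"
  assumes U: "adapted_continuous M F U" and Y: "adapted_continuous M F Y"
  shows "adapted_continuous M F (\<lambda>t \<omega>. U t \<omega> *v Y t \<omega>)"
proof (rule adapted_continuous_vec)
  fix t :: real and e :: "real^'n" assume t: "0 \<le> t" and "e \<in> Basis"
  then obtain i where e: "e = axis i 1" by (auto simp: Basis_vec_def)
  have "(\<lambda>\<omega>. \<Sum>j\<in>UNIV. U t \<omega> $ i $ j * Y t \<omega> $ j) \<in> borel_measurable (F t)"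
    using adapted_continuous_entry[OF U] adapted_continuous_component[OF Y] t
    by (intro borel_measurable_sum borel_measurable_times) (simp_all add: adapted_continuous_def)
  then show "(\<lambda>\<omega>. (U t \<omega> *v Y t \<omega>) \<bullet> e) \<in> borel_measurable (F t)"
    by (simp add: e inner_axis matrix_vector_mult_def)
next
  have "AE \<omega> in M. continuous_on {0..} (\<lambda>t. U t \<omega>)" "AE \<omega> in M. continuous_on {0..} (\<lambda>t. Y t \<omega>)"
    using U Y by (auto simp: adapted_continuous_def)
  then show "AE \<omega> in M. continuous_on {0..} (\<lambda>t. U t \<omega> *v Y t \<omega>)"
    by eventually_elim (auto simp: matrix_vector_mult_def intro!: continuous_intros continuous_on_vec_lambda)
qed

text \<open>Only the integrals of \<open>b\<close> are assumed adapted, not \<open>b\<close> itself.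
  Sums with left tags involve \<open>b\<close> through these integrals alone, and their almost sure
  limit stays adapted.\<close>

lemma measurable_stieltjes_integral:
  fixes V b :: "real \<Rightarrow> 'a \<Rightarrow> real"
  assumes V: "adapted_continuous M F V" and t: "0 \<le> t"
    and b: "AE \<omega> in M. \<forall>t\<ge>0. set_integrable lborel {0..t} (\<lambda>s. b s \<omega>)"
    and a: "\<And>t. 0 \<le> t \<Longrightarrow> (\<lambda>\<omega>. LBINT s:{0..t}. b s \<omega>) \<in> borel_measurable (F t)"
  shows "(\<lambda>\<omega>. LBINT s:{0..t}. V s \<omega> * b s \<omega>) \<in> borel_measurable (F t)"
proof (rule measurable_F_AE_LIMSEQ[OF t])
  let ?u = "\<lambda>m \<omega>. \<Sum>i<(Suc m)\<^sup>2. V (min (grid m i) t) \<omega> *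
      ((LBINT s:{0..min (grid m (Suc i)) t}. b s \<omega>) - (LBINT s:{0..min (grid m i) t}. b s \<omega>))"
  have a': "(\<lambda>\<omega>. LBINT s:{0..min r t}. b s \<omega>) \<in> borel_measurable (F t)" if "0 \<le> r" for r
    by (rule measurable_F_mono[OF a]) (use that t in auto)
  show "?u m \<in> borel_measurable (F t)" for m
    by (intro borel_measurable_sum borel_measurable_times borel_measurable_diff a' stopped_measurable[OF V] grid_nonneg t)
  have "AE \<omega> in M. continuous_on {0..} (\<lambda>t. V t \<omega>)" using V by (simp add: adapted_continuous_def)
  then show "AE \<omega> in M. (\<lambda>m. ?u m \<omega>) \<longlonglongrightarrow> (LBINT s:{0..t}. V s \<omega> * b s \<omega>)"
    using b
  proof eventually_elim
    case (elim \<omega>)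
    show ?case
    proof (rule riemann_stieltjes_tendsto[OF t, of "\<lambda>t. V t \<omega>" "\<lambda>s. b s \<omega>" "\<lambda>m i. min (grid m i) t"])
      show "continuous_on {0..t} (\<lambda>t. V t \<omega>)" by (rule continuous_on_subset[OF elim(1)]) auto
      show "set_integrable lborel {0..t} (\<lambda>s. b s \<omega>)" using elim(2) t by blast
      show "min (grid m i) t \<le> min (grid m i) t \<and> min (grid m i) t \<le> min (grid m (Suc i)) t" for m i
        using grid_mono[of i "Suc i" m] by auto
    qed
  qed
qed

end

subsection \<open>Invertibility of the fundamental matrix\<close>

context brownian_motion
begin

text \<open>The individual Ito integrals are kept as a parameter, because integration by parts and
  the perturbation of a column act on each of them separately.\<close>

definition fundamental_matrix :: "(real \<Rightarrow> real^'n^'n) \<Rightarrow> (real \<Rightarrow> 'a \<Rightarrow> real^'n^'n) \<Rightarrow>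
    ('n \<Rightarrow> 'n \<Rightarrow> 'n \<Rightarrow> real \<Rightarrow> 'a \<Rightarrow> real) \<Rightarrow> bool" where
  "fundamental_matrix C G I \<longleftrightarrow> adapted_continuous M F G \<and>
     (\<forall>i j l. ito j (\<lambda>s \<omega>. C s $ i $ j * G s \<omega> $ j $ l) (I i j l)) \<and>
     (AE \<omega> in M. \<forall>t\<ge>0. \<forall>i l. G t \<omega> $ i $ l = (if i = l then 1 else 0) + (\<Sum>j\<in>UNIV. I i j l t \<omega>))"

text \<open>The bound of \<open>small_interval_escape\<close> with
  \<open>\<theta> = 1 / (2 * CARD('n))\<close>, the radius of \<open>det_near_identity\<close>,
  summed over the columns; 81 is the square of the 9 there and \<open>\<eta>\<^sup>2\<close> is
  split off.\<close>

definition escape_const :: real where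
  "escape_const = real CARD('n) * ((real CARD('n))\<^sup>2 * (64 * 81 / (1 / (2 * real CARD('n)) / real CARD('n)) ^ 4))"

lemma escape_const_nonneg: "0 \<le> escape_const"
  by (simp add: escape_const_def)

text \<open>The columns of \<open>G t (G a)\<^sup>-\<^sup>1\<close> solve the same equation and start from the identity at time
  \<open>a\<close>, so they stay close to it up to a small probability. The inverse is truncated at level \<open>k\<close> to
  make it a bounded multiplier.\<close>

lemma invertibility_step:
  assumes C: "\<And>i j t. 0 \<le> t \<Longrightarrow> sq_int t (\<lambda>s. C s $ i $ j)"
    and G: "fundamental_matrix C G I"
    and ab: "0 \<le> a" "a < b"
    and \<eta>: "0 < \<eta>" "\<And>i j. sq_norm b (\<lambda>s. indicator {a<..b} s * C s $ i $ j) \<le> \<eta>"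
  shows "\<exists>A\<in>sets M. prob A \<le> escape_const * \<eta>\<^sup>2 \<and>
    (AE \<omega> in M. det (G a \<omega>) \<noteq> 0 \<and> (\<exists>t\<in>{a..b}. det (G t \<omega>) = 0) \<longrightarrow> \<omega> \<in> A)"
proof -
  let ?n = "real CARD('n)"
  let ?\<theta> = "1 / (2 * ?n)"
  have n1: "1 \<le> ?n" by (simp add: Suc_le_eq)
  have Gac: "adapted_continuous M F G"
    and GI: "\<And>i j l. ito j (\<lambda>s \<omega>. C s $ i $ j * G s \<omega> $ j $ l) (I i j l)"
    and Geq: "AE \<omega> in M. \<forall>t\<ge>0. \<forall>i l. G t \<omega> $ i $ l = (if i = l then 1 else 0) + (\<Sum>j\<in>UNIV. I i j l t \<omega>)"
    using G unfolding fundamental_matrix_def by auto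
  have Gm: "G t \<in> borel_measurable (F t)" if "0 \<le> t" for t
    using Gac that by (simp add: adapted_continuous_def)
  have Gc: "AE \<omega> in M. continuous_on {0..} (\<lambda>t. G t \<omega>)" using Gac by (simp add: adapted_continuous_def)
  \<comment> \<open>On this event, known at time \<open>a\<close>, the inverse exists and its
    entries are bounded by \<open>k\<close>, as a multiplier for \<open>ito_step\<close> requires. A
    path with \<open>G a\<close> nonsingular lies in it for all large \<open>k\<close>.\<close>
  define T where "T k = {\<omega> \<in> space M. det (G a \<omega>) \<noteq> 0 \<and> (\<forall>m\<in>UNIV. \<forall>l\<in>UNIV. \<bar>cramer_inverse (G a \<omega>) $ m $ l\<bar> \<le> real k)}" for k :: nat
  define v where "v k m l \<omega> = indicator (T k) \<omega> * cramer_inverse (G a \<omega>) $ m $ l" for k m l \<omega>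
  \<comment> \<open>On \<open>T k\<close> this is the entry in row \<open>i\<close> and column
    \<open>l\<close> of \<open>G t\<close> times the inverse of \<open>G a\<close>; off
    \<open>T k\<close> it is zero. The index \<open>l\<close> is fixed, so each column is a vector
    process for \<open>small_interval_escape\<close>.\<close>
  define R where "R k l i t \<omega> = (\<Sum>m\<in>UNIV. v k m l \<omega> * G t \<omega> $ i $ m)" for k l i t \<omega>
  define K where "K k l i j t \<omega> = (\<Sum>m\<in>UNIV. v k m l \<omega> * (I i j m (min b t) \<omega> - I i j m (min a t) \<omega>))" for k l i j t \<omega>
  have Vm: "(\<lambda>\<omega>. cramer_inverse (G a \<omega>) $ m $ l) \<in> borel_measurable (F a)" for m l
    by (rule borel_measurable_cramer_inverse[OF Gm[OF ab(1)]])
  have dm: "(\<lambda>\<omega>. det (G a \<omega>)) \<in> borel_measurable (F a)"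
    by (rule borel_measurable_det[OF borel_measurable_matrix_entry[OF Gm[OF ab(1)]]])
  have Tm: "T k \<in> sets (F a)" for k
  proof -
    have "{\<omega> \<in> space (F a). det (G a \<omega>) \<noteq> 0 \<and> (\<forall>m\<in>UNIV. \<forall>l\<in>UNIV. \<bar>cramer_inverse (G a \<omega>) $ m $ l\<bar> \<le> real k)} \<in> sets (F a)"
      by (intro sets.sets_Collect_conj sets.sets_Collect_finite_All borel_measurable_le borel_measurable_abs Vm
        borel_measurable_neq dm borel_measurable_const) auto
    then show ?thesis using ab by (simp add: T_def space_F)
  qed
  have vm: "v k m l \<in> borel_measurable (F a)" for k m l
    unfolding v_def by (rule borel_measurable_times[OF borel_measurable_indicator[OF Tm] Vm])
  have vb: "\<bar>v k m l \<omega>\<bar> \<le> real k" for k m l \<omega>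
    by (cases "\<omega> \<in> T k") (auto simp: v_def T_def)
  have KI: "ito j (\<lambda>s \<omega>. indicator {a<..b} s * C s $ i $ j * R k l j s \<omega>) (K k l i j)" for k l i j
  proof -
    have "ito j (\<lambda>s \<omega>. \<Sum>m\<in>UNIV. v k m l \<omega> * indicator {a<..b} s * (C s $ i $ j * G s \<omega> $ j $ m)) (K k l i j)"
      unfolding K_def by (intro ito_sum ito_step[OF GI, where c="real k"] vm vb) (use ab in auto)
    also have "(\<lambda>s \<omega>. \<Sum>m\<in>UNIV. v k m l \<omega> * indicator {a<..b} s * (C s $ i $ j * G s \<omega> $ j $ m)) =
      (\<lambda>s \<omega>. indicator {a<..b} s * C s $ i $ j * R k l j s \<omega>)"
      by (simp only: R_def sum_distrib_left mult_ac)
    finally show ?thesis .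
  qed
  have Ra: "R k l i a \<omega> = indicator (T k) \<omega> * (if i = l then 1 else 0)" for k l i \<omega>
  proof (cases "\<omega> \<in> T k")
    case True
    then have "G a \<omega> ** cramer_inverse (G a \<omega>) = mat 1" by (intro matrix_mult_cramer_inverse) (simp add: T_def)
    then have "(G a \<omega> ** cramer_inverse (G a \<omega>)) $ i $ l = (if i = l then 1 else 0)" by (simp add: mat_def)
    then show ?thesis using True by (simp add: R_def v_def matrix_matrix_mult_def mult.commute)
  qed (simp add: R_def v_def)
  have esc: "\<exists>A\<in>sets M. prob A \<le> ?n\<^sup>2 * (64 * (9 * \<eta>)\<^sup>2 / (?\<theta> / ?n) ^ 4) \<and>
    (AE \<omega> in M. (\<exists>t\<in>{a..b}. \<exists>i. ?\<theta> < \<bar>R k l i t \<omega> - R k l i a \<omega>\<bar>) \<longrightarrow> \<omega> \<in> A)" for k l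
  proof (rule small_interval_escape[OF _ ab KI _ _ _ _ _ _ \<eta>])
    show "sq_int b (\<lambda>s. C s $ i $ j)" for i j using C ab by simp
    show "R k l j t \<in> borel_measurable (F t)" if "a \<le> t" "t \<le> b" for j t
      unfolding R_def
      by (intro borel_measurable_sum borel_measurable_times borel_measurable_matrix_entry Gm measurable_F_mono[OF vm])
        (use that ab in auto)
    show "AE \<omega> in M. \<forall>j. continuous_on {a..b} (\<lambda>t. R k l j t \<omega>)"
      using Gc
    proof eventually_elim
      case (elim \<omega>)
      have "continuous_on {a..b} (\<lambda>t. G t \<omega>)" by (rule continuous_on_subset[OF elim]) (use ab in auto)
      then show ?case unfolding R_def by (intro allI continuous_intros)
    qed
    show "AE \<omega> in M. \<forall>i. \<forall>t\<in>{a..b}. R k l i t \<omega> - R k l i a \<omega> = (\<Sum>j\<in>UNIV. K k l i j t \<omega> - K k l i j a \<omega>)"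
      using Geq
    proof eventually_elim
      case (elim \<omega>)
      show ?case
      proof (intro allI ballI)
        fix i t assume t: "t \<in> {a..b}"
        then have m: "min b t = t" "min a t = a" "min b a = a" "min a a = a" using ab by auto
        have G: "G t \<omega> $ i $ m - G a \<omega> $ i $ m = (\<Sum>j\<in>UNIV. I i j m t \<omega> - I i j m a \<omega>)" for m
          using elim t ab by (simp add: sum_subtractf)
        have "R k l i t \<omega> - R k l i a \<omega> = (\<Sum>m\<in>UNIV. v k m l \<omega> * (G t \<omega> $ i $ m - G a \<omega> $ i $ m))"
          by (simp add: R_def sum_subtractf right_diff_distrib)
        also have "\<dots> = (\<Sum>m\<in>UNIV. \<Sum>j\<in>UNIV. v k m l \<omega> * (I i j m t \<omega> - I i j m a \<omega>))"
          unfolding G sum_distrib_left ..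
        also have "\<dots> = (\<Sum>j\<in>UNIV. \<Sum>m\<in>UNIV. v k m l \<omega> * (I i j m t \<omega> - I i j m a \<omega>))"
          by (rule sum.swap)
        also have "\<dots> = (\<Sum>j\<in>UNIV. K k l i j t \<omega> - K k l i j a \<omega>)"
          unfolding K_def m by simp
        finally show "R k l i t \<omega> - R k l i a \<omega> = (\<Sum>j\<in>UNIV. K k l i j t \<omega> - K k l i j a \<omega>)" .
      qed
    qed
    show "AE \<omega> in M. \<forall>j. \<bar>R k l j a \<omega>\<bar> \<le> 1"
      unfolding Ra by (rule AE_I2) (auto simp: indicator_def)
    show "0 < ?\<theta>" by simp
    have "0 < 2 * ?n" "1 \<le> 2 * ?n" using n1 by linarith+
    then show "?\<theta> \<le> 1" by (rule divide_le_eq_1_pos[THEN iffD2])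
  qed
  have "\<exists>A\<in>sets M. prob A \<le> (\<Sum>l\<in>(UNIV::'n set). ?n\<^sup>2 * (64 * (9 * \<eta>)\<^sup>2 / (?\<theta> / ?n) ^ 4)) \<and>
    (AE \<omega> in M. (\<exists>l\<in>UNIV. \<exists>t\<in>{a..b}. \<exists>i. ?\<theta> < \<bar>R k l i t \<omega> - R k l i a \<omega>\<bar>) \<longrightarrow> \<omega> \<in> A)" for k
    by (rule finite_event_cover[OF _ esc]) simp
  moreover have "(\<Sum>l\<in>(UNIV::'n set). ?n\<^sup>2 * (64 * (9 * \<eta>)\<^sup>2 / (?\<theta> / ?n) ^ 4)) = escape_const * \<eta>\<^sup>2"
    by (simp add: escape_const_def power_mult_distrib)
  ultimately have cov: "\<exists>A\<in>sets M. prob A \<le> escape_const * \<eta>\<^sup>2 \<and>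
    (AE \<omega> in M. (\<exists>l\<in>UNIV. \<exists>t\<in>{a..b}. \<exists>i. ?\<theta> < \<bar>R k l i t \<omega> - R k l i a \<omega>\<bar>) \<longrightarrow> \<omega> \<in> A)" for k
    by (simp only:)
  show ?thesis
  proof (rule liminf_event_cover[OF cov])
    show "AE \<omega> in M. det (G a \<omega>) \<noteq> 0 \<and> (\<exists>t\<in>{a..b}. det (G t \<omega>) = 0) \<longrightarrow>
       (\<forall>\<^sub>F k in sequentially. \<exists>l\<in>UNIV. \<exists>t\<in>{a..b}. \<exists>i. ?\<theta> < \<bar>R k l i t \<omega> - R k l i a \<omega>\<bar>)"
    proof (rule AE_I2, intro impI)
      fix \<omega> assume \<omega>: "\<omega> \<in> space M" and "det (G a \<omega>) \<noteq> 0 \<and> (\<exists>t\<in>{a..b}. det (G t \<omega>) = 0)"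
      then obtain t where t: "t \<in> {a..b}" "det (G t \<omega>) = 0" and a: "det (G a \<omega>) \<noteq> 0" by blast
      let ?V = "cramer_inverse (G a \<omega>)"
      define c where "c = (\<Sum>m\<in>UNIV. \<Sum>l\<in>UNIV. \<bar>?V $ m $ l\<bar>)"
      have c: "\<bar>?V $ m $ l\<bar> \<le> c" for m l
      proof -
        have "\<bar>?V $ m $ l\<bar> \<le> (\<Sum>l\<in>UNIV. \<bar>?V $ m $ l\<bar>)" by (rule member_le_sum) auto
        also have "\<dots> \<le> c" unfolding c_def by (rule member_le_sum[of m UNIV "\<lambda>m. \<Sum>l\<in>UNIV. \<bar>?V $ m $ l\<bar>"]) (auto intro: sum_nonneg)
        finally show ?thesis .
      qed
      \<comment> \<open>A singular \<open>G t\<close> makes the product with the inverse of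
        \<open>G a\<close> singular, so some entry has left the neighbourhood of the
        identity.\<close>
      have "det (G t \<omega> ** ?V) = 0" using t by (simp add: det_mul)
      then obtain i l where il: "\<not> \<bar>(G t \<omega> ** ?V) $ i $ l - (if i = l then 1 else 0)\<bar> \<le> ?\<theta>"
        using det_near_identity[of "G t \<omega> ** ?V"] by blast
      show "\<forall>\<^sub>F k in sequentially. \<exists>l\<in>UNIV. \<exists>t\<in>{a..b}. \<exists>i. ?\<theta> < \<bar>R k l i t \<omega> - R k l i a \<omega>\<bar>"
        using eventually_ge_at_top[of "nat \<lceil>c\<rceil>"]
      proof eventually_elim
        case (elim k)
        then have "c \<le> real k" by linarith
        then have k: "\<omega> \<in> T k" using \<omega> a c unfolding T_def by (auto intro: order_trans)
        have "R k l i t \<omega> = (G t \<omega> ** ?V) $ i $ l"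
          using k by (simp add: R_def v_def matrix_matrix_mult_def mult.commute)
        moreover have "R k l i a \<omega> = (if i = l then 1 else 0)" using k by (simp add: Ra)
        ultimately have "?\<theta> < \<bar>R k l i t \<omega> - R k l i a \<omega>\<bar>" using il by simp
        then show ?case using t(1) by blast
      qed
    qed
  qed
qed

lemma fundamental_matrix_at_0:
  assumes G: "fundamental_matrix C G I"
  shows "AE \<omega> in M. G 0 \<omega> = mat 1"
proof -
  have I: "\<And>i j l. ito j (\<lambda>s \<omega>. C s $ i $ j * G s \<omega> $ j $ l) (I i j l)"
    and Geq: "AE \<omega> in M. \<forall>t\<ge>0. \<forall>i l. G t \<omega> $ i $ l = (if i = l then 1 else 0) + (\<Sum>j\<in>UNIV. I i j l t \<omega>)"
    using G unfolding fundamental_matrix_def by auto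
  have "AE \<omega> in M. \<forall>i j l. I i j l 0 \<omega> = 0"
    unfolding AE_all_countable using ito_at_0[OF I] by blast
  then show ?thesis using Geq
    by eventually_elim (simp add: vec_eq_iff mat_def)
qed

text \<open>A passage to a singular matrix has to occur within some cell that begins nonsingular.
  The escape bounds for the cells are quadratic in their energies, whose sum is fixed, so refining
  the partition makes the total probability small.\<close>

lemma fundamental_matrix_invertible_interval:
  assumes C: "\<And>i j t. 0 \<le> t \<Longrightarrow> sq_int t (\<lambda>s. C s $ i $ j)"
    and G: "fundamental_matrix C G I" and T: "0 < T"
  shows "AE \<omega> in M. \<not> (\<exists>t\<in>{0..T}. det (G t \<omega>) = 0)"
proof (rule AE_not_if_small_cover)
  fix e :: real assume e: "0 < e"
  \<comment> \<open>A deterministic clock whose increment bounds the energy of every entry of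
    \<open>C\<close> on a cell. The summand \<open>t\<close> makes it strictly increasing, since the
    cell bounds need \<open>0 < \<eta>\<close>.\<close>
  define \<Gamma> where "\<Gamma> t = t + (\<Sum>i\<in>UNIV. \<Sum>j\<in>UNIV. sq_norm t (\<lambda>s. C s $ i $ j))" for t
  have \<Gamma>c: "continuous_on {0..} \<Gamma>"
    unfolding \<Gamma>_def using C by (intro continuous_intros continuous_on_set_integral) (auto simp: sq_int_def)
  have cell: "sq_norm b (\<lambda>s. indicator {a<..b} s * C s $ i $ j) \<le> \<Gamma> b - \<Gamma> a" if ab: "0 \<le> a" "a < b" for a b i j
  proof -
    let ?h = "\<lambda>i j. sq_norm b (\<lambda>s. C s $ i $ j) - sq_norm a (\<lambda>s. C s $ i $ j)"
    have nn: "0 \<le> ?h i j" for i j using sq_norm_mono(2)[OF C[of b i j], of a] ab by simp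
    have "sq_norm b (\<lambda>s. indicator {a<..b} s * C s $ i $ j) = (LBINT s:{0..b}. indicator {a<..b} s * (C s $ i $ j)\<^sup>2)"
      unfolding set_lebesgue_integral_def
      by (rule Bochner_Integration.integral_cong) (auto simp: indicator_def)
    also have "\<dots> = ?h i j"
      using set_integral_Ioc_diff[of b "\<lambda>s. (C s $ i $ j)\<^sup>2" a b] C[of b i j] ab by (simp add: sq_int_def)
    also have "\<dots> \<le> (\<Sum>j\<in>UNIV. ?h i j)" by (rule member_le_sum) (use nn in auto)
    also have "\<dots> \<le> (\<Sum>i\<in>UNIV. \<Sum>j\<in>UNIV. ?h i j)"
      by (rule member_le_sum[of i UNIV "\<lambda>i. \<Sum>j\<in>UNIV. ?h i j"]) (use nn in \<open>auto intro: sum_nonneg\<close>)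
    also have "\<dots> \<le> \<Gamma> b - \<Gamma> a" using ab by (simp add: \<Gamma>_def sum_subtractf)
    finally show ?thesis .
  qed
  have \<Gamma>0: "0 \<le> \<Gamma> 0" unfolding \<Gamma>_def by (intro add_nonneg_nonneg sum_nonneg sq_norm_nonneg) simp
  have \<Gamma>less: "\<Gamma> a < \<Gamma> b" if "0 \<le> a" "a < b" for a b
  proof -
    have "(\<Sum>i\<in>UNIV. \<Sum>j\<in>UNIV. sq_norm a (\<lambda>s. C s $ i $ j)) \<le> (\<Sum>i\<in>UNIV. \<Sum>j\<in>UNIV. sq_norm b (\<lambda>s. C s $ i $ j))"
      using that by (intro sum_mono sq_norm_mono(2)[OF C]) auto
    then show ?thesis using that by (simp add: \<Gamma>_def)
  qed
  \<comment> \<open>Chosen so that \<open>escape_const * \<epsilon> * \<Gamma> T \<le> e\<close>;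
    adding 1 keeps the divisor positive.\<close>
  define \<epsilon> where "\<epsilon> = e / (escape_const * \<Gamma> T + 1)"
  have \<Gamma>T: "0 \<le> \<Gamma> T" using \<Gamma>less[of 0 T] T \<Gamma>0 by simp
  have den: "0 < escape_const * \<Gamma> T + 1" using mult_nonneg_nonneg[OF escape_const_nonneg \<Gamma>T] by simp
  have \<epsilon>: "0 < \<epsilon>" using e den by (simp add: \<epsilon>_def)
  have "uniformly_continuous_on {0..T} \<Gamma>"
    by (rule compact_uniformly_continuous[OF continuous_on_subset[OF \<Gamma>c]]) auto
  then obtain d where d: "0 < d" "\<And>s r. s \<in> {0..T} \<Longrightarrow> r \<in> {0..T} \<Longrightarrow> dist r s < d \<Longrightarrow> dist (\<Gamma> r) (\<Gamma> s) < \<epsilon>"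
    using \<epsilon> unfolding uniformly_continuous_on_def by meson
  have "0 < d / T" using d T by simp
  then obtain m where m: "1 / real (Suc m) < d / T" using nat_approx_posE by blast
  define s where "s k = T * (real k / real (Suc m))" for k
  have s0: "s 0 = 0" and sT: "s (Suc m) = T" by (simp_all add: s_def del: of_nat_Suc)
  have sless: "s k < s (Suc k)" for k using T by (auto simp: s_def intro!: mult_strict_left_mono divide_strict_right_mono)
  have snn: "0 \<le> s k" for k using T by (simp add: s_def)
  have smono: "s p \<le> s q" if "p \<le> q" for p q using that sless by (metis lift_Suc_mono_le less_imp_le)
  have sle: "s k \<le> T" if "k \<le> Suc m" for k using smono[OF that] sT by simp
  have sd: "s (Suc k) - s k = T * (1 / real (Suc m))" for k
    by (simp only: s_def right_diff_distrib[symmetric] diff_divide_distrib[symmetric]) simp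
  define \<eta> where "\<eta> k = \<Gamma> (s (Suc k)) - \<Gamma> (s k)" for k
  have \<eta>0: "0 < \<eta> k" for k using \<Gamma>less[OF snn sless] by (simp add: \<eta>_def)
  have \<eta>\<epsilon>: "\<eta> k \<le> \<epsilon>" if "k < Suc m" for k
  proof -
    have "T * (1 / real (Suc m)) < T * (d / T)" using m T by (rule mult_strict_left_mono)
    then have "dist (s (Suc k)) (s k) < d" using sd[of k] sless[of k] T by (simp add: dist_real_def)
    then have "dist (\<Gamma> (s (Suc k))) (\<Gamma> (s k)) < \<epsilon>"
      using that snn sle[of k] sle[of "Suc k"] by (intro d(2)) auto
    then show ?thesis by (simp add: \<eta>_def dist_real_def)
  qed
  have "\<exists>A\<in>sets M. prob A \<le> (\<Sum>k\<in>{..<Suc m}. escape_const * (\<eta> k)\<^sup>2) \<and>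
    (AE \<omega> in M. (\<exists>k\<in>{..<Suc m}. det (G (s k) \<omega>) \<noteq> 0 \<and> (\<exists>t\<in>{s k..s (Suc k)}. det (G t \<omega>) = 0)) \<longrightarrow> \<omega> \<in> A)"
    by (rule finite_event_cover, simp)
      (rule invertibility_step[OF C G snn sless \<eta>0], assumption, unfold \<eta>_def, rule cell[OF snn sless])
  then obtain A where A: "A \<in> sets M" "prob A \<le> (\<Sum>k<Suc m. escape_const * (\<eta> k)\<^sup>2)"
    "AE \<omega> in M. (\<exists>k\<in>{..<Suc m}. det (G (s k) \<omega>) \<noteq> 0 \<and> (\<exists>t\<in>{s k..s (Suc k)}. det (G t \<omega>) = 0)) \<longrightarrow> \<omega> \<in> A"
    by blast
  \<comment> \<open>One factor of the square is bounded by \<open>\<epsilon>\<close>, the other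
    telescopes to the total increment of the clock.\<close>
  have "(\<Sum>k<Suc m. escape_const * (\<eta> k)\<^sup>2) \<le> (\<Sum>k<Suc m. (escape_const * \<epsilon>) * \<eta> k)"
  proof (rule sum_mono)
    fix k assume "k \<in> {..<Suc m}"
    then have "(\<eta> k)\<^sup>2 \<le> \<epsilon> * \<eta> k" using \<eta>\<epsilon>[of k] \<eta>0[of k] by (simp add: power2_eq_square)
    then show "escape_const * (\<eta> k)\<^sup>2 \<le> escape_const * \<epsilon> * \<eta> k"
      unfolding mult.assoc by (rule mult_left_mono[OF _ escape_const_nonneg])
  qed
  also have "\<dots> = (escape_const * \<epsilon>) * (\<Gamma> T - \<Gamma> 0)"
    unfolding sum_distrib_left[symmetric] \<eta>_def using sum_lessThan_telescope[of "\<lambda>k. \<Gamma> (s k)" "Suc m"] by (simp only: s0 sT)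
  also have "\<dots> \<le> (escape_const * \<epsilon>) * \<Gamma> T"
    using \<Gamma>0 \<epsilon> escape_const_nonneg by (intro mult_left_mono) auto
  also have "\<dots> \<le> \<epsilon> * (escape_const * \<Gamma> T + 1)" using \<epsilon> by (simp add: algebra_simps)
  also have "\<dots> = e" unfolding \<epsilon>_def using den by (simp del: distrib_left_numeral)
  finally have "prob A \<le> e" using A(2) by simp
  moreover have "AE \<omega> in M. (\<exists>t\<in>{0..T}. det (G t \<omega>) = 0) \<longrightarrow> \<omega> \<in> A"
    using A(3) fundamental_matrix_at_0[OF G]
  proof eventually_elim
    case (elim \<omega>)
    have d0: "det (G (s 0) \<omega>) \<noteq> 0" using elim(2) by (simp add: s0)
    show ?case
    proof
      assume "\<exists>t\<in>{0..T}. det (G t \<omega>) = 0"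
      then obtain t where t: "0 \<le> t" "t \<le> T" "det (G t \<omega>) = 0" by auto
      \<comment> \<open>The first grid point by which a singular time has occurred. The preceding
        grid point is nonsingular, so the cell between them realises the covered condition.\<close>
      define p where "p = (LEAST p. \<exists>t\<in>{s 0..s p}. det (G t \<omega>) = 0)"
      have "\<exists>t\<in>{s 0..s (Suc m)}. det (G t \<omega>) = 0" using t by (auto simp: s0 sT)
      then have p: "\<exists>t\<in>{s 0..s p}. det (G t \<omega>) = 0" "p \<le> Suc m"
        unfolding p_def by (rule LeastI, rule Least_le)
      have "p \<noteq> 0"
      proof
        assume "p = 0"
        then obtain r where "s 0 \<le> r" "r \<le> s 0" "det (G r \<omega>) = 0" using p(1) by auto
        then show False using d0 by (simp add: order.antisym)
      qed
      then obtain k where k: "p = Suc k" by (cases p) auto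
      have nk: "\<not> (\<exists>t\<in>{s 0..s k}. det (G t \<omega>) = 0)"
        using not_less_Least[of k "\<lambda>p. \<exists>t\<in>{s 0..s p}. det (G t \<omega>) = 0"] k by (simp add: p_def[symmetric])
      obtain r where r: "r \<in> {s 0..s (Suc k)}" "det (G r \<omega>) = 0" using p(1) k by auto
      have "r \<in> {s k..s (Suc k)}" using r nk by force
      moreover have "det (G (s k) \<omega>) \<noteq> 0" using nk smono[of 0 k] by auto
      moreover have "k \<in> {..<Suc m}" using p(2) k by simp
      ultimately show "\<omega> \<in> A" using elim(1) r(2) by blast
    qed
  qed
  ultimately show "\<exists>A\<in>sets M. prob A \<le> e \<and> (AE \<omega> in M. (\<exists>t\<in>{0..T}. det (G t \<omega>) = 0) \<longrightarrow> \<omega> \<in> A)"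
    using A(1) by blast
qed

lemma fundamental_matrix_invertible:
  assumes C: "\<And>i j t. 0 \<le> t \<Longrightarrow> sq_int t (\<lambda>s. C s $ i $ j)"
    and G: "fundamental_matrix C G I"
  shows "AE \<omega> in M. \<forall>t\<ge>0. det (G t \<omega>) \<noteq> 0"
proof -
  have "AE \<omega> in M. \<forall>k::nat. \<not> (\<exists>t\<in>{0..real (Suc k)}. det (G t \<omega>) = 0)"
    unfolding AE_all_countable by (intro allI fundamental_matrix_invertible_interval[OF C G]) auto
  then show ?thesis
  proof eventually_elim
    case (elim \<omega>)
    show ?case
    proof (intro allI impI)
      fix t :: real assume t: "0 \<le> t"
      have "t \<le> real (Suc (nat \<lceil>t\<rceil>))" by linarith
      then show "det (G t \<omega>) \<noteq> 0" using elim[rule_format, of "nat \<lceil>t\<rceil>"] t by auto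
    qed
  qed
qed

subsection \<open>Uniqueness for the homogeneous equation\<close>

text \<open>Adding an integer multiple \<open>c\<close> of \<open>Z\<close> to column \<open>l\<close> of \<open>U\<close> gives another fundamental matrix,
  which is singular as soon as \<open>1 + c (U\<^sup>-\<^sup>1 Z)\<^sub>l = 0\<close>. If \<open>Z\<close> left \<open>0\<close>, continuity would produce such a
  time.\<close>

lemma homogeneous_linear_sde_zero:
  fixes Z :: "real \<Rightarrow> 'a \<Rightarrow> real^'n"
  assumes C: "\<And>i j t. 0 \<le> t \<Longrightarrow> sq_int t (\<lambda>s. C s $ i $ j)"
    and U: "fundamental_matrix C U I"
    and Z: "adapted_continuous M F Z"
    and K: "\<And>i j. ito j (\<lambda>s \<omega>. C s $ i $ j * Z s \<omega> $ j) (K i j)"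
    and ZK: "AE \<omega> in M. \<forall>t\<ge>0. \<forall>i. Z t \<omega> $ i = (\<Sum>j\<in>UNIV. K i j t \<omega>)"
  shows "AE \<omega> in M. \<forall>t\<ge>0. Z t \<omega> = 0"
proof -
  have Ua: "adapted_continuous M F U"
    and UI: "\<And>i j l. ito j (\<lambda>s \<omega>. C s $ i $ j * U s \<omega> $ j $ l) (I i j l)"
    and Ueq: "AE \<omega> in M. \<forall>t\<ge>0. \<forall>i l. U t \<omega> $ i $ l = (if i = l then 1 else 0) + (\<Sum>j\<in>UNIV. I i j l t \<omega>)"
    using U unfolding fundamental_matrix_def by auto
  have Uc: "AE \<omega> in M. continuous_on {0..} (\<lambda>t. U t \<omega>)" using Ua by (simp add: adapted_continuous_def)
  have Zc: "AE \<omega> in M. continuous_on {0..} (\<lambda>t. Z t \<omega>)" using Z by (simp add: adapted_continuous_def)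
  \<comment> \<open>Since \<open>Z\<close> solves the same linear equation and starts at zero, the
    perturbed column has the same equation and the same initial value.\<close>
  define G where "G c l t \<omega> = (\<chi> i m. U t \<omega> $ i $ m + (if m = l then c * Z t \<omega> $ i else 0))" for c l t \<omega>
  define J where "J c l i j m t \<omega> = I i j m t \<omega> + (if m = l then c else 0) * K i j t \<omega>" for c l i j m t \<omega>
  have G: "fundamental_matrix C (G c l) (J c l)" for c l
    unfolding fundamental_matrix_def
  proof (intro conjI allI)
    have Gc: "AE \<omega> in M. continuous_on {0..} (\<lambda>t. G c l t \<omega>)"
      using Uc Zc
    proof eventually_elim
      case (elim \<omega>)
      have "continuous_on {0..} (\<lambda>t. U t \<omega> $ i $ m + (if m = l then c * Z t \<omega> $ i else 0))" for i m
        by (cases "m = l") (auto intro!: continuous_intros elim)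
      then show ?case unfolding G_def by (intro continuous_on_vec_lambda)
    qed
    show "adapted_continuous M F (G c l)"
    proof (rule adapted_continuous_vec[OF _ Gc])
      fix t :: real and E :: "real^'n^'n" assume t: "0 \<le> t" and "E \<in> Basis"
      then obtain i m where E: "E = axis i (axis m 1)" by (auto simp: Basis_vec_def)
      have "(\<lambda>\<omega>. U t \<omega> $ i $ m) \<in> borel_measurable (F t)" "(\<lambda>\<omega>. Z t \<omega> $ i) \<in> borel_measurable (F t)"
        using adapted_continuous_entry[OF Ua] adapted_continuous_component[OF Z] t
        by (auto simp: adapted_continuous_def)
      then have "(\<lambda>\<omega>. U t \<omega> $ i $ m + (if m = l then c * Z t \<omega> $ i else 0)) \<in> borel_measurable (F t)"
        by (cases "m = l") auto
      then show "(\<lambda>\<omega>. G c l t \<omega> \<bullet> E) \<in> borel_measurable (F t)"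
        unfolding E inner_axis by (simp add: G_def)
    qed
    fix i j m
    have "ito j (\<lambda>s \<omega>. 1 * (C s $ i $ j * U s \<omega> $ j $ m) + (if m = l then c else 0) * (C s $ i $ j * Z s \<omega> $ j))
        (\<lambda>t \<omega>. 1 * I i j m t \<omega> + (if m = l then c else 0) * K i j t \<omega>)"
      by (rule ito_lincomb[OF UI K])
    then show "ito j (\<lambda>s \<omega>. C s $ i $ j * G c l s \<omega> $ j $ m) (J c l i j m)"
      unfolding J_def by (cases "m = l") (simp_all add: G_def distrib_left mult.left_commute)
  next
    show "AE \<omega> in M. \<forall>t\<ge>0. \<forall>i m. G c l t \<omega> $ i $ m = (if i = m then 1 else 0) + (\<Sum>j\<in>UNIV. J c l i j m t \<omega>)"
      using Ueq ZK
      by eventually_elim (simp add: G_def J_def sum.distrib sum_distrib_left[symmetric])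
  qed
  \<comment> \<open>Integer multiples are countably many, so one null set serves for all of them.
    The path-dependent multiple needed below must therefore be an integer.\<close>
  have Gdet: "AE \<omega> in M. \<forall>c::int. \<forall>l. \<forall>t\<ge>0. det (G (of_int c) l t \<omega>) \<noteq> 0"
    unfolding AE_all_countable by (intro allI fundamental_matrix_invertible[OF C G])
  have K0: "AE \<omega> in M. \<forall>i j. K i j 0 \<omega> = 0"
    unfolding AE_all_countable using ito_at_0[OF K] by blast
  have Udet: "AE \<omega> in M. \<forall>t\<ge>0. det (U t \<omega>) \<noteq> 0"
    by (rule fundamental_matrix_invertible[OF C U])
  show ?thesis using Uc Zc ZK K0 Gdet Udet
  proof eventually_elim
    case (elim \<omega>)
    note Uc = elim(1) and Zc = elim(2) and Gd = elim(5) and Ud = elim(6)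
    have Z0: "Z 0 \<omega> = 0" using elim(3,4) by (simp add: vec_eq_iff)
    define y where "y t = cramer_inverse (U t \<omega>) *v Z t \<omega>" for t
    have Uy: "U t \<omega> *v y t = Z t \<omega>" if "0 \<le> t" for t
      using Ud that by (simp add: y_def matrix_vector_mul_assoc matrix_mult_cramer_inverse)
    have y0: "y 0 = 0" by (simp add: y_def Z0)
    have yc: "continuous_on {0..} (\<lambda>t. y t $ l)" for l
    proof -
      have "continuous_on {0..} (\<lambda>t. cramer_inverse (U t \<omega>) $ l $ i)" for i
        by (rule continuous_on_cramer_inverse[OF Uc]) (use Ud in auto)
      then have "continuous_on {0..} (\<lambda>t. \<Sum>i\<in>UNIV. cramer_inverse (U t \<omega>) $ l $ i * Z t \<omega> $ i)"
        by (intro continuous_on_sum continuous_on_mult[OF _ continuous_on_component[OF Zc]])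
      then show ?thesis by (simp add: y_def matrix_vector_mult_def)
    qed
    show ?case
    proof (intro allI impI, rule ccontr)
      fix u :: real assume u: "0 \<le> u" and "Z u \<omega> \<noteq> 0"
      then have "y u \<noteq> 0" using Uy[OF u] by auto
      then obtain l where l: "y u $ l \<noteq> 0" by (auto simp: vec_eq_iff)
      \<comment> \<open>The sign makes the coordinate positive at \<open>u\<close>. By continuity
        from 0 it takes some value \<open>1 / (N + 1)\<close>, whose reciprocal is an integer, and
        this supplies the multiple \<open>c\<close>.\<close>
      define \<sigma> :: int where "\<sigma> = (if 0 < y u $ l then 1 else -1)"
      have \<sigma>: "0 < of_int \<sigma> * y u $ l" "of_int \<sigma> * of_int \<sigma> = (1::real)" using l by (auto simp: \<sigma>_def)
      obtain N where N: "1 / real (Suc N) < of_int \<sigma> * y u $ l" using nat_approx_posE[OF \<sigma>(1)] by blast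
      have "\<exists>t\<ge>0. t \<le> u \<and> of_int \<sigma> * y t $ l = 1 / real (Suc N)"
        by (rule IVT') (use N u y0 in \<open>auto intro!: continuous_intros continuous_on_subset[OF yc]\<close>)
      then obtain t where t: "0 \<le> t" "of_int \<sigma> * y t $ l = 1 / real (Suc N)" by blast
      define c :: int where "c = - \<sigma> * int (Suc N)"
      have "of_int c * y t $ l = - real (Suc N) * (of_int \<sigma> * y t $ l)" by (simp add: c_def algebra_simps)
      then have c: "of_int c * y t $ l = - 1" unfolding t(2) by (simp del: of_nat_Suc)
      \<comment> \<open>Applied to \<open>y t\<close>, the perturbed matrix gives
        \<open>U y + c y\<^sub>l Z\<close>, which is \<open>Z - Z\<close>. As \<open>y t\<close> is
        not zero, this contradicts invertibility.\<close>
      have "G (of_int c) l t \<omega> *v y t = 0"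
      proof -
        have "(G (of_int c) l t \<omega> *v y t) $ i = 0" for i
        proof -
          have "(G (of_int c) l t \<omega> *v y t) $ i =
            (\<Sum>m\<in>UNIV. U t \<omega> $ i $ m * y t $ m) + (\<Sum>m\<in>UNIV. if m = l then of_int c * Z t \<omega> $ i * y t $ m else 0)"
            by (simp add: G_def matrix_vector_mult_def sum.distrib distrib_right if_distrib[of "\<lambda>z. z * _"] cong: if_cong)
          also have "(\<Sum>m\<in>UNIV. if m = l then of_int c * Z t \<omega> $ i * y t $ m else 0) = Z t \<omega> $ i * (of_int c * y t $ l)"
            by simp
          also have "(\<Sum>m\<in>UNIV. U t \<omega> $ i $ m * y t $ m) = Z t \<omega> $ i"
            using Uy[OF t(1)] by (simp add: matrix_vector_mult_def vec_eq_iff)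
          finally show ?thesis by (simp add: c)
        qed
        then show ?thesis by (simp add: vec_eq_iff)
      qed
      moreover have "invertible (G (of_int c) l t \<omega>)" using Gd t by (simp add: invertible_det_nz)
      ultimately have "y t = 0"
        using matrix_left_invertible_ker[of "G (of_int c) l t \<omega>"] by (auto simp: invertible_def)
      then show False using c by simp
    qed
  qed
qed

end

subsection \<open>Variation of constants\<close>

lemma set_integral_sum:
  fixes f :: "'i \<Rightarrow> real \<Rightarrow> real"
  assumes "\<And>i. i \<in> A \<Longrightarrow> set_integrable lborel S (f i)"
  shows "set_integrable lborel S (\<lambda>s. \<Sum>i\<in>A. f i s)"
    "(LBINT s:S. (\<Sum>i\<in>A. f i s)) = (\<Sum>i\<in>A. LBINT s:S. f i s)"
proof -
  have i: "\<And>i. i \<in> A \<Longrightarrow> integrable lborel (\<lambda>s. indicator S s *\<^sub>R f i s)"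
    using assms by (simp add: set_integrable_def)
  show "set_integrable lborel S (\<lambda>s. \<Sum>i\<in>A. f i s)"
    unfolding set_integrable_def scaleR_sum_right by (rule Bochner_Integration.integrable_sum[OF i])
  show "(LBINT s:S. (\<Sum>i\<in>A. f i s)) = (\<Sum>i\<in>A. LBINT s:S. f i s)"
    unfolding set_lebesgue_integral_def scaleR_sum_right by (rule Bochner_Integration.integral_sum[OF i])
qed

lemma set_integral_vec:
  fixes g :: "real \<Rightarrow> real^'n"
  shows "set_integrable lborel S g \<longleftrightarrow> (\<forall>l. set_integrable lborel S (\<lambda>s. g s $ l))"
    and "set_integrable lborel S g \<Longrightarrow> (LBINT s:S. g s) $ l = (LBINT s:S. g s $ l)"
proof -
  have comp: "integrable lborel (\<lambda>s. indicator S s *\<^sub>R g s $ l)"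
    and int: "(LBINT s. indicator S s *\<^sub>R g s) $ l = (LBINT s. indicator S s *\<^sub>R g s $ l)"
    if "integrable lborel (\<lambda>s. indicator S s *\<^sub>R g s)" for l
    using integrable_bounded_linear[OF bounded_linear_vec_nth that, of l]
      integral_bounded_linear[OF bounded_linear_vec_nth that, of l] by simp_all
  have "integrable lborel (\<lambda>s. indicator S s *\<^sub>R g s)" if "\<forall>l. integrable lborel (\<lambda>s. indicator S s *\<^sub>R g s $ l)"
  proof -
    have "integrable lborel (\<lambda>s. \<Sum>l\<in>UNIV. (indicator S s *\<^sub>R g s $ l) *\<^sub>R (axis l 1 :: real^'n))"
      using that by (intro Bochner_Integration.integrable_sum integrable_scaleR_left) auto
    also have "(\<lambda>s. \<Sum>l\<in>UNIV. (indicator S s *\<^sub>R g s $ l) *\<^sub>R (axis l 1 :: real^'n)) = (\<lambda>s. indicator S s *\<^sub>R g s)"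
      by (simp add: fun_eq_iff vec_eq_iff axis_def if_distrib[of "\<lambda>c. _ * c"] cong: if_cong)
    finally show ?thesis .
  qed
  then show "set_integrable lborel S g \<longleftrightarrow> (\<forall>l. set_integrable lborel S (\<lambda>s. g s $ l))"
    using comp unfolding set_integrable_def by blast
  show "set_integrable lborel S g \<Longrightarrow> (LBINT s:S. g s) $ l = (LBINT s:S. g s $ l)"
    using int unfolding set_integrable_def set_lebesgue_integral_def .
qed

lemma set_integral_cong_Icc:
  fixes g h :: "real \<Rightarrow> 'b::{banach, second_countable_topology}"
  assumes "\<And>s. 0 \<le> s \<Longrightarrow> s \<le> t \<Longrightarrow> g s = h s"
  shows "set_integrable lborel {0..t} g \<longleftrightarrow> set_integrable lborel {0..t} h"
    "(LBINT s:{0..t}. g s) = (LBINT s:{0..t}. h s)"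
proof -
  show "set_integrable lborel {0..t} g \<longleftrightarrow> set_integrable lborel {0..t} h"
    by (rule set_integrable_cong) (use assms in auto)
  show "(LBINT s:{0..t}. g s) = (LBINT s:{0..t}. h s)"
    by (rule set_lebesgue_integral_cong) (use assms in auto)
qed

context brownian_motion
begin

text \<open>Each entry of \<open>U\<close> is a Kronecker delta plus Ito integrals \<open>I\<close>.
  Integration by parts turns \<open>N I\<close> into an Ito integral plus the integral of
  \<open>I n\<close>; collecting the latter with the delta terms yields the drift
  \<open>U n\<close>, and \<open>Z\<close> is the remaining noise.\<close>

lemma drift_product:
  fixes x :: "real^'n" and N n :: "'n \<Rightarrow> real \<Rightarrow> 'a \<Rightarrow> real"
  assumes U: "fundamental_matrix C U I"
    and C: "\<And>i j. has_measurable_version M (\<lambda>s \<omega>. C s $ i $ j)"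
    and N: "\<And>l. adapted_continuous M F (N l)"
    and n: "AE \<omega> in M. \<forall>l. \<forall>t\<ge>0. set_integrable lborel {0..t} (\<lambda>s. n l s \<omega>) \<and> N l t \<omega> = x $ l + (LBINT s:{0..t}. n l s \<omega>)"
  defines "Z \<equiv> (\<lambda>i j t \<omega>. \<Sum>l\<in>UNIV. N l t \<omega> * I i j l t \<omega> - (LBINT s:{0..t}. I i j l s \<omega> * n l s \<omega>))"
  shows "ito j (\<lambda>s \<omega>. C s $ i $ j * (\<Sum>l\<in>UNIV. U s \<omega> $ j $ l * N l s \<omega>)) (Z i j)"
    and "AE \<omega> in M. \<forall>t\<ge>0. \<forall>i. set_integrable lborel {0..t} (\<lambda>s. \<Sum>l\<in>UNIV. U s \<omega> $ i $ l * n l s \<omega>) \<and>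
      (\<Sum>l\<in>UNIV. U t \<omega> $ i $ l * N l t \<omega>) =
        x $ i + (LBINT s:{0..t}. \<Sum>l\<in>UNIV. U s \<omega> $ i $ l * n l s \<omega>) + (\<Sum>j\<in>UNIV. Z i j t \<omega>)"
proof -
  have UI: "\<And>i j l. ito j (\<lambda>s \<omega>. C s $ i $ j * U s \<omega> $ j $ l) (I i j l)"
    and Ueq: "AE \<omega> in M. \<forall>t\<ge>0. \<forall>i l. U t \<omega> $ i $ l = (if i = l then 1 else 0) + (\<Sum>j\<in>UNIV. I i j l t \<omega>)"
    using U unfolding fundamental_matrix_def by auto
  have n': "AE \<omega> in M. \<forall>t\<ge>0. set_integrable lborel {0..t} (\<lambda>s. n l s \<omega>) \<and> N l t \<omega> = x $ l + (LBINT s:{0..t}. n l s \<omega>)" for l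
    using n by eventually_elim blast
  have "ito j (\<lambda>s \<omega>. \<Sum>l\<in>UNIV. N l s \<omega> * (C s $ i $ j * U s \<omega> $ j $ l)) (Z i j)" for i j
    unfolding Z_def by (intro ito_sum ito_product[OF UI N n']) simp
  moreover have "(\<lambda>s \<omega>. \<Sum>l\<in>UNIV. N l s \<omega> * (C s $ i $ j * U s \<omega> $ j $ l)) =
    (\<lambda>s \<omega>. C s $ i $ j * (\<Sum>l\<in>UNIV. U s \<omega> $ j $ l * N l s \<omega>))" for i j
    by (simp only: sum_distrib_left mult_ac)
  ultimately show "ito j (\<lambda>s \<omega>. C s $ i $ j * (\<Sum>l\<in>UNIV. U s \<omega> $ j $ l * N l s \<omega>)) (Z i j)"
    by simp
  have Ic: "AE \<omega> in M. \<forall>i j l. continuous_on {0..} (\<lambda>t. I i j l t \<omega>)"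
    unfolding AE_all_countable using itoD(3)[OF UI] by (simp add: adapted_continuous_def)
  show "AE \<omega> in M. \<forall>t\<ge>0. \<forall>i. set_integrable lborel {0..t} (\<lambda>s. \<Sum>l\<in>UNIV. U s \<omega> $ i $ l * n l s \<omega>) \<and>
      (\<Sum>l\<in>UNIV. U t \<omega> $ i $ l * N l t \<omega>) =
        x $ i + (LBINT s:{0..t}. \<Sum>l\<in>UNIV. U s \<omega> $ i $ l * n l s \<omega>) + (\<Sum>j\<in>UNIV. Z i j t \<omega>)"
    using Ueq n Ic
  proof eventually_elim
    case (elim \<omega>)
    note Ue = elim(1) and ne = elim(2) and Ie = elim(3)
    show ?case
    proof (intro allI impI)
      fix t :: real and i :: 'n assume t: "0 \<le> t"
      have ni: "set_integrable lborel {0..t} (\<lambda>s. n l s \<omega>)" for l using ne t by blast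
      have Nl: "N l t \<omega> = x $ l + (LBINT s:{0..t}. n l s \<omega>)" for l using ne t by blast
      have In: "set_integrable lborel {0..t} (\<lambda>s. I i j l s \<omega> * n l s \<omega>)" for j l
        by (rule set_integrable_continuous_mult[OF continuous_on_subset[OF Ie[rule_format]] ni]) auto
      let ?d = "\<lambda>l. if i = l then 1 else 0 :: real"
      let ?g = "\<lambda>l s. ?d l * n l s \<omega> + (\<Sum>j\<in>UNIV. I i j l s \<omega> * n l s \<omega>)"
      have dn: "set_integrable lborel {0..t} (\<lambda>s. ?d l * n l s \<omega>)" for l
        using ni by simp
      have sI: "set_integrable lborel {0..t} (\<lambda>s. \<Sum>j\<in>UNIV. I i j l s \<omega> * n l s \<omega>)" for l
        by (rule set_integral_sum(1)[OF In])
      have gi: "set_integrable lborel {0..t} (?g l)" for l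
        by (rule set_integral_add(1)[OF dn sI])
      have gint: "(LBINT s:{0..t}. ?g l s) = ?d l * (LBINT s:{0..t}. n l s \<omega>) + (\<Sum>j\<in>UNIV. LBINT s:{0..t}. I i j l s \<omega> * n l s \<omega>)" for l
        by (subst set_integral_add(2)[OF dn sI]) (simp only: set_integral_sum(2)[OF In] set_integral_mult_right)
      have eq: "(\<Sum>l\<in>UNIV. U s \<omega> $ i $ l * n l s \<omega>) = (\<Sum>l\<in>UNIV. ?g l s)" if "0 \<le> s" for s
        using Ue that by (simp only: distrib_right sum_distrib_right)
      have 1: "set_integrable lborel {0..t} (\<lambda>s. \<Sum>l\<in>UNIV. U s \<omega> $ i $ l * n l s \<omega>)"
        by (subst set_integral_cong_Icc(1)[OF eq], assumption, rule set_integral_sum(1)[OF gi])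
      have "(LBINT s:{0..t}. \<Sum>l\<in>UNIV. U s \<omega> $ i $ l * n l s \<omega>) = (LBINT s:{0..t}. \<Sum>l\<in>UNIV. ?g l s)"
        by (rule set_integral_cong_Icc(2)[OF eq])
      also have "\<dots> = (\<Sum>l\<in>UNIV. LBINT s:{0..t}. ?g l s)" by (rule set_integral_sum(2)[OF gi])
      also have "\<dots> = (\<Sum>l\<in>UNIV. ?d l * (LBINT s:{0..t}. n l s \<omega>)) + (\<Sum>l\<in>UNIV. \<Sum>j\<in>UNIV. LBINT s:{0..t}. I i j l s \<omega> * n l s \<omega>)"
        unfolding gint sum.distrib ..
      also have "(\<Sum>l\<in>UNIV. ?d l * (LBINT s:{0..t}. n l s \<omega>)) = (LBINT s:{0..t}. n i s \<omega>)"
        by (simp add: if_distrib[of "\<lambda>c. c * _"] cong: if_cong)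
      finally have 2: "(LBINT s:{0..t}. \<Sum>l\<in>UNIV. U s \<omega> $ i $ l * n l s \<omega>) =
        (LBINT s:{0..t}. n i s \<omega>) + (\<Sum>l\<in>UNIV. \<Sum>j\<in>UNIV. LBINT s:{0..t}. I i j l s \<omega> * n l s \<omega>)" .
      have 3: "(\<Sum>j\<in>UNIV. Z i j t \<omega>) = (\<Sum>l\<in>UNIV. \<Sum>j\<in>UNIV. N l t \<omega> * I i j l t \<omega>) -
          (\<Sum>l\<in>UNIV. \<Sum>j\<in>UNIV. LBINT s:{0..t}. I i j l s \<omega> * n l s \<omega>)"
        unfolding Z_def by (subst sum.swap) (simp only: sum_subtractf)
      have "(\<Sum>l\<in>UNIV. U t \<omega> $ i $ l * N l t \<omega>) = (\<Sum>l\<in>UNIV. ?d l * N l t \<omega> + (\<Sum>j\<in>UNIV. I i j l t \<omega> * N l t \<omega>))"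
        using Ue t by (simp only: distrib_right sum_distrib_right)
      also have "\<dots> = N i t \<omega> + (\<Sum>l\<in>UNIV. \<Sum>j\<in>UNIV. N l t \<omega> * I i j l t \<omega>)"
        unfolding sum.distrib by (simp add: if_distrib[of "\<lambda>c. c * _"] cong: if_cong) (simp only: mult.commute)
      finally have "(\<Sum>l\<in>UNIV. U t \<omega> $ i $ l * N l t \<omega>) =
          x $ i + (LBINT s:{0..t}. \<Sum>l\<in>UNIV. U s \<omega> $ i $ l * n l s \<omega>) + (\<Sum>j\<in>UNIV. Z i j t \<omega>)"
        unfolding 2 3 Nl[of i] by simp
      with 1 show "set_integrable lborel {0..t} (\<lambda>s. \<Sum>l\<in>UNIV. U s \<omega> $ i $ l * n l s \<omega>) \<and>
        (\<Sum>l\<in>UNIV. U t \<omega> $ i $ l * N l t \<omega>) =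
          x $ i + (LBINT s:{0..t}. \<Sum>l\<in>UNIV. U s \<omega> $ i $ l * n l s \<omega>) + (\<Sum>j\<in>UNIV. Z i j t \<omega>)" by blast
    qed
  qed
qed

lemma sq_int_entry:
  fixes C :: "real \<Rightarrow> real^'n^'n"
  assumes "C \<in> borel_measurable (restrict_space borel {0..})"
    and "set_integrable lborel {0..t} (\<lambda>s. (C s $ i $ j)\<^sup>2)"
  shows "sq_int t (\<lambda>s. C s $ i $ j)"
proof -
  have "(\<lambda>s. indicator {0..} s *\<^sub>R C s $ i $ j) \<in> borel_measurable borel"
    using borel_measurable_matrix_entry[OF assms(1), of i j]
    by (subst (asm) borel_measurable_restrict_space_iff) (auto simp: scaleR_conv_of_real)
  then have "(\<lambda>s. indicator {0..t} s *\<^sub>R (indicator {0..} s *\<^sub>R C s $ i $ j)) \<in> borel_measurable lborel"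
    unfolding real_scaleR_def by - (rule lborel_measurable_mult, simp, simp only: measurable_lborel2)
  also have "(\<lambda>s. indicator {0..t} s *\<^sub>R (indicator {0..} s *\<^sub>R C s $ i $ j)) = (\<lambda>s. indicator {0..t} s *\<^sub>R C s $ i $ j)"
    by (auto simp: indicator_def)
  finally show ?thesis using assms(2) by (simp add: sq_int_def set_borel_measurable_def)
qed

lemma fundamental_matrix_exists:
  assumes C: "\<And>i j. has_measurable_version M (\<lambda>s \<omega>. C s $ i $ j)"
    and U: "solves_linear_matrix_sde M F B C U"
  obtains I where "fundamental_matrix C U I"
proof -
  have Ua: "adapted_continuous M F U" using U by (simp add: solves_linear_matrix_sde_def)
  have "\<forall>i l. \<exists>J. (\<forall>j. has_ito_integral M F (\<lambda>t \<omega>. B t \<omega> $ j) (\<lambda>s \<omega>. C s $ i $ j * U s \<omega> $ j $ l) (J j)) \<and>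
        (AE \<omega> in M. \<forall>t\<ge>0. U t \<omega> $ i $ l = (if i = l then 1 else 0) + (LBINT s:{0..t}. 0) + (\<Sum>j\<in>UNIV. J j t \<omega>))"
    using U unfolding solves_linear_matrix_sde_def has_ito_differential_def by blast
  then obtain J where J: "\<forall>i l. (\<forall>j. has_ito_integral M F (\<lambda>t \<omega>. B t \<omega> $ j) (\<lambda>s \<omega>. C s $ i $ j * U s \<omega> $ j $ l) (J i l j)) \<and>
        (AE \<omega> in M. \<forall>t\<ge>0. U t \<omega> $ i $ l = (if i = l then 1 else 0) + (LBINT s:{0..t}. 0) + (\<Sum>j\<in>UNIV. J i l j t \<omega>))"
    unfolding choice_iff by (elim exE)
  have "fundamental_matrix C U (\<lambda>i j l. J i l j)"
    unfolding fundamental_matrix_def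
  proof (intro conjI allI Ua)
    fix i j l
    show "ito j (\<lambda>s \<omega>. C s $ i $ j * U s \<omega> $ j $ l) (J i l j)"
      unfolding ito_def
      using J by (intro conjI has_measurable_version_mult C has_measurable_version_adapted_continuous adapted_continuous_entry[OF Ua]) blast
  next
    have "AE \<omega> in M. \<forall>i l. \<forall>t\<ge>0. U t \<omega> $ i $ l = (if i = l then 1 else 0) + (LBINT s:{0..t}. 0) + (\<Sum>j\<in>UNIV. J i l j t \<omega>)"
      unfolding AE_all_countable using J by blast
    then show "AE \<omega> in M. \<forall>t\<ge>0. \<forall>i l. U t \<omega> $ i $ l = (if i = l then 1 else 0) + (\<Sum>j\<in>UNIV. J i l j t \<omega>)"
      by eventually_elim (simp add: set_lebesgue_integral_def)
  qed
  then show ?thesis by (rule that)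
qed

text \<open>By (B) the adapted process \<open>Y\<close> itself has the finite variation form
  required of \<open>N\<close>, and its density times \<open>U\<close> is \<open>f\<close>. Thus
  \<open>drift_product\<close> applies directly.\<close>

lemma random_de_imp_sde:
  fixes C :: "real \<Rightarrow> real^'n^'n" and Y :: "real \<Rightarrow> 'a \<Rightarrow> real^'n"
  assumes Chmv: "\<And>i j. has_measurable_version M (\<lambda>s \<omega>. C s $ i $ j)"
    and Csq: "\<And>i j t. 0 \<le> t \<Longrightarrow> sq_int t (\<lambda>s. C s $ i $ j)"
    and U: "fundamental_matrix C U I"
    and Y: "adapted_continuous M F Y" and de: "satisfies_random_de M U f x Y"
  shows "solves_sde M F B C f x (\<lambda>t \<omega>. U t \<omega> *v Y t \<omega>)"
proof -
  define n where "n l s \<omega> = (matrix_inv (U s \<omega>) *v f s (U s \<omega> *v Y s \<omega>)) $ l" for l s \<omega>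
  have Ua: "adapted_continuous M F U" using U by (simp add: fundamental_matrix_def)
  have Ud: "AE \<omega> in M. \<forall>t\<ge>0. det (U t \<omega>) \<noteq> 0" by (rule fundamental_matrix_invertible[OF Csq U])
  have n: "AE \<omega> in M. \<forall>l. \<forall>t\<ge>0. set_integrable lborel {0..t} (\<lambda>s. n l s \<omega>) \<and> Y t \<omega> $ l = x $ l + (LBINT s:{0..t}. n l s \<omega>)"
    using de unfolding satisfies_random_de_def
  proof eventually_elim
    case (elim \<omega>)
    show ?case
    proof (intro allI impI)
      fix l t assume "0 \<le> (t::real)"
      then have i: "set_integrable lborel {0..t} (\<lambda>s. matrix_inv (U s \<omega>) *v f s (U s \<omega> *v Y s \<omega>))"
        and Yt: "Y t \<omega> = x + (LBINT s:{0..t}. matrix_inv (U s \<omega>) *v f s (U s \<omega> *v Y s \<omega>))"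
        using elim by auto
      show "set_integrable lborel {0..t} (\<lambda>s. n l s \<omega>) \<and> Y t \<omega> $ l = x $ l + (LBINT s:{0..t}. n l s \<omega>)"
        using set_integral_vec(1)[THEN iffD1, OF i] unfolding Yt n_def by (simp add: set_integral_vec(2)[OF i])
    qed
  qed
  define Z where "Z i j t \<omega> = (\<Sum>l\<in>UNIV. Y t \<omega> $ l * I i j l t \<omega> - (LBINT s:{0..t}. I i j l s \<omega> * n l s \<omega>))" for i j t \<omega>
  note P = drift_product[OF U Chmv adapted_continuous_component[OF Y] n, folded Z_def]
  have Un: "AE \<omega> in M. \<forall>s\<ge>0. \<forall>i. (\<Sum>l\<in>UNIV. U s \<omega> $ i $ l * n l s \<omega>) = f s (U s \<omega> *v Y s \<omega>) $ i"
    using Ud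
  proof eventually_elim
    case (elim \<omega>)
    show ?case
    proof (intro allI impI)
      fix s :: real and i assume "0 \<le> s"
      then have d: "det (U s \<omega>) \<noteq> 0" using elim by blast
      then have "U s \<omega> ** matrix_inv (U s \<omega>) = mat 1"
        by (simp add: matrix_inv_eq_cramer_inverse invertible_det_nz matrix_mult_cramer_inverse)
      then have "U s \<omega> *v (matrix_inv (U s \<omega>) *v f s (U s \<omega> *v Y s \<omega>)) = f s (U s \<omega> *v Y s \<omega>)"
        by (simp add: matrix_vector_mul_assoc)
      then have "(U s \<omega> *v (matrix_inv (U s \<omega>) *v f s (U s \<omega> *v Y s \<omega>))) $ i = f s (U s \<omega> *v Y s \<omega>) $ i" by simp
      then show "(\<Sum>l\<in>UNIV. U s \<omega> $ i $ l * n l s \<omega>) = f s (U s \<omega> *v Y s \<omega>) $ i"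
        unfolding n_def by (subst (asm) matrix_vector_mult_def) simp
    qed
  qed
  show ?thesis
    unfolding solves_sde_def has_ito_differential_def
  proof (intro conjI allI adapted_continuous_matrix_vector Ua Y)
    fix i
    show "AE \<omega> in M. \<forall>t\<ge>0. set_integrable lborel {0..t} (\<lambda>s. f s (U s \<omega> *v Y s \<omega>) $ i)"
      using P(2) Un
    proof eventually_elim
      case (elim \<omega>)
      show ?case
      proof (intro allI impI)
        fix t :: real assume "0 \<le> t"
        then have "set_integrable lborel {0..t} (\<lambda>s. \<Sum>l\<in>UNIV. U s \<omega> $ i $ l * n l s \<omega>)" using elim(1) by blast
        then show "set_integrable lborel {0..t} (\<lambda>s. f s (U s \<omega> *v Y s \<omega>) $ i)"
          by (subst (asm) set_integral_cong_Icc(1)[where h="\<lambda>s. f s (U s \<omega> *v Y s \<omega>) $ i"]) (use elim(2) in auto)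
      qed
    qed
    show "\<exists>J. (\<forall>j. has_ito_integral M F (\<lambda>t \<omega>. B t \<omega> $ j) (\<lambda>s \<omega>. C s $ i $ j * (U s \<omega> *v Y s \<omega>) $ j) (J j)) \<and>
        (AE \<omega> in M. \<forall>t\<ge>0. (U t \<omega> *v Y t \<omega>) $ i = x $ i + (LBINT s:{0..t}. f s (U s \<omega> *v Y s \<omega>) $ i) + (\<Sum>j\<in>UNIV. J j t \<omega>))"
    proof (intro exI[of _ "Z i"] conjI allI)
      show "has_ito_integral M F (\<lambda>t \<omega>. B t \<omega> $ j) (\<lambda>s \<omega>. C s $ i $ j * (U s \<omega> *v Y s \<omega>) $ j) (Z i j)" for j
        using P(1)[of j i] by (simp add: ito_def matrix_vector_mult_def)
      show "AE \<omega> in M. \<forall>t\<ge>0. (U t \<omega> *v Y t \<omega>) $ i = x $ i + (LBINT s:{0..t}. f s (U s \<omega> *v Y s \<omega>) $ i) + (\<Sum>j\<in>UNIV. Z i j t \<omega>)"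
        using P(2) Un
      proof eventually_elim
        case (elim \<omega>)
        show ?case
        proof (intro allI impI)
          fix t :: real assume t: "0 \<le> t"
          have "(U t \<omega> *v Y t \<omega>) $ i = (\<Sum>l\<in>UNIV. U t \<omega> $ i $ l * Y t \<omega> $ l)" by (simp add: matrix_vector_mult_def)
          also have "\<dots> = x $ i + (LBINT s:{0..t}. \<Sum>l\<in>UNIV. U s \<omega> $ i $ l * n l s \<omega>) + (\<Sum>j\<in>UNIV. Z i j t \<omega>)"
            using elim(1) t by blast
          also have "(LBINT s:{0..t}. \<Sum>l\<in>UNIV. U s \<omega> $ i $ l * n l s \<omega>) = (LBINT s:{0..t}. f s (U s \<omega> *v Y s \<omega>) $ i)"
            by (rule set_integral_cong_Icc(2)) (use elim(2) in blast)
          finally show "(U t \<omega> *v Y t \<omega>) $ i = x $ i + (LBINT s:{0..t}. f s (U s \<omega> *v Y s \<omega>) $ i) + (\<Sum>j\<in>UNIV. Z i j t \<omega>)" .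
        qed
      qed
    qed
  qed
qed

text \<open>Here \<open>N\<close> is constructed from \<open>X\<close> and not given, so most of the
  work is to show that it exists pathwise and is adapted. The drifts of \<open>X\<close> and
  \<open>U N\<close> are then equal, and uniqueness for the homogeneous equation identifies the
  two.\<close>

lemma sde_solution_formula:
  fixes C :: "real \<Rightarrow> real^'n^'n" and X :: "real \<Rightarrow> 'a \<Rightarrow> real^'n"
  assumes Chmv: "\<And>i j. has_measurable_version M (\<lambda>s \<omega>. C s $ i $ j)"
    and Csq: "\<And>i j t. 0 \<le> t \<Longrightarrow> sq_int t (\<lambda>s. C s $ i $ j)"
    and U: "fundamental_matrix C U I"
    and X: "solves_sde M F B C f x X"
  shows "AE \<omega> in M. \<forall>t\<ge>0.
    set_integrable lborel {0..t} (\<lambda>s. matrix_inv (U s \<omega>) *v f s (X s \<omega>)) \<and>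
    X t \<omega> = U t \<omega> *v (x + (LBINT s:{0..t}. matrix_inv (U s \<omega>) *v f s (X s \<omega>)))"
proof -
  have Xa: "adapted_continuous M F X" using X by (simp add: solves_sde_def)
  have Ua: "adapted_continuous M F U" using U by (simp add: fundamental_matrix_def)
  have Uc: "AE \<omega> in M. continuous_on {0..} (\<lambda>t. U t \<omega>)" using Ua by (simp add: adapted_continuous_def)
  have Ud: "AE \<omega> in M. \<forall>t\<ge>0. det (U t \<omega>) \<noteq> 0" by (rule fundamental_matrix_invertible[OF Csq U])
  have "\<forall>i. AE \<omega> in M. \<forall>t\<ge>0. set_integrable lborel {0..t} (\<lambda>s. f s (X s \<omega>) $ i)"
    using X unfolding solves_sde_def has_ito_differential_def by blast
  then have fi: "AE \<omega> in M. \<forall>t\<ge>0. set_integrable lborel {0..t} (\<lambda>s. f s (X s \<omega>) $ i)" for i by blast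
  have "\<forall>i. \<exists>K. (\<forall>j. has_ito_integral M F (\<lambda>t \<omega>. B t \<omega> $ j) (\<lambda>s \<omega>. C s $ i $ j * X s \<omega> $ j) (K j)) \<and>
      (AE \<omega> in M. \<forall>t\<ge>0. X t \<omega> $ i = x $ i + (LBINT s:{0..t}. f s (X s \<omega>) $ i) + (\<Sum>j\<in>UNIV. K j t \<omega>))"
    using X unfolding solves_sde_def has_ito_differential_def by blast
  then obtain K where K: "\<forall>i. (\<forall>j. has_ito_integral M F (\<lambda>t \<omega>. B t \<omega> $ j) (\<lambda>s \<omega>. C s $ i $ j * X s \<omega> $ j) (K i j)) \<and>
      (AE \<omega> in M. \<forall>t\<ge>0. X t \<omega> $ i = x $ i + (LBINT s:{0..t}. f s (X s \<omega>) $ i) + (\<Sum>j\<in>UNIV. K i j t \<omega>))"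
    unfolding choice_iff by (elim exE)
  have KI: "ito j (\<lambda>s \<omega>. C s $ i $ j * X s \<omega> $ j) (K i j)" for i j
    unfolding ito_def
    using K by (intro conjI has_measurable_version_mult Chmv has_measurable_version_adapted_continuous adapted_continuous_component[OF Xa]) blast
  have Xeq: "AE \<omega> in M. \<forall>t\<ge>0. X t \<omega> $ i = x $ i + (LBINT s:{0..t}. f s (X s \<omega>) $ i) + (\<Sum>j\<in>UNIV. K i j t \<omega>)" for i
    using K by blast
  \<comment> \<open>Entries of the inverse in Cramer form, so that they are adapted for all times
    and continuous on the paths where \<open>U\<close> never becomes singular.\<close>
  define V where "V l i t \<omega> = cramer_inverse (U t \<omega>) $ l $ i" for l i t \<omega>
  have V: "adapted_continuous M F (V l i)" for l i
    unfolding adapted_continuous_def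
  proof (intro conjI allI impI)
    show "V l i t \<in> borel_measurable (F t)" if "0 \<le> t" for t
      unfolding V_def by (rule borel_measurable_cramer_inverse) (use Ua that in \<open>simp add: adapted_continuous_def\<close>)
    show "AE \<omega> in M. continuous_on {0..} (\<lambda>t. V l i t \<omega>)"
      using Uc Ud
    proof eventually_elim
      case (elim \<omega>)
      show ?case unfolding V_def
        by (rule continuous_on_cramer_inverse[OF elim(1)]) (use elim(2) in auto)
    qed
  qed
  have Vc: "AE \<omega> in M. \<forall>l i. continuous_on {0..} (\<lambda>t. V l i t \<omega>)"
    unfolding AE_all_countable using V by (simp add: adapted_continuous_def)
  have fi': "AE \<omega> in M. \<forall>i. \<forall>t\<ge>0. set_integrable lborel {0..t} (\<lambda>s. f s (X s \<omega>) $ i)"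
    unfolding AE_all_countable using fi by blast
  define n where "n l s \<omega> = (\<Sum>i\<in>UNIV. V l i s \<omega> * f s (X s \<omega>) $ i)" for l s \<omega>
  define N where "N l t \<omega> = x $ l + (LBINT s:{0..t}. n l s \<omega>)" for l t \<omega>
  have Vf: "AE \<omega> in M. \<forall>l i. \<forall>t\<ge>0. set_integrable lborel {0..t} (\<lambda>s. V l i s \<omega> * f s (X s \<omega>) $ i)"
    using Vc fi'
  proof eventually_elim
    case (elim \<omega>)
    show ?case
    proof (intro allI impI)
      fix l i and t :: real assume "0 \<le> t"
      then have i: "set_integrable lborel {0..t} (\<lambda>s. f s (X s \<omega>) $ i)" using elim(2) by blast
      show "set_integrable lborel {0..t} (\<lambda>s. V l i s \<omega> * f s (X s \<omega>) $ i)"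
        by (rule set_integrable_continuous_mult[OF continuous_on_subset[OF elim(1)[rule_format]] i]) auto
    qed
  qed
  have nint: "AE \<omega> in M. \<forall>l. \<forall>t\<ge>0. set_integrable lborel {0..t} (\<lambda>s. n l s \<omega>) \<and>
      (LBINT s:{0..t}. n l s \<omega>) = (\<Sum>i\<in>UNIV. LBINT s:{0..t}. V l i s \<omega> * f s (X s \<omega>) $ i)"
    using Vf unfolding n_def
    by eventually_elim (intro allI impI conjI set_integral_sum, blast+)
  have Na: "adapted_continuous M F (N l)" for l
    unfolding adapted_continuous_def
  proof (intro conjI allI impI)
    fix t :: real assume t: "0 \<le> t"
    \<comment> \<open>The equation is solved for the drift integral: it is \<open>X\<close> minus
      the initial value minus the Ito integrals, all of them adapted.\<close>
    have fm: "(\<lambda>\<omega>. LBINT s:{0..r}. f s (X s \<omega>) $ i) \<in> borel_measurable (F r)" if r: "0 \<le> r" for r i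
    proof (rule measurable_F_AE_eq[OF r])
      have "X r \<in> borel_measurable (F r)" using Xa r by (simp add: adapted_continuous_def)
      then have "(\<lambda>\<omega>. X r \<omega> $ i) \<in> borel_measurable (F r)" by (rule measurable_compose[OF _ borel_measurable_vec_nth])
      moreover have "K i j r \<in> borel_measurable (F r)" for j
        using itoD(3)[OF KI] r by (simp add: adapted_continuous_def)
      ultimately show "(\<lambda>\<omega>. X r \<omega> $ i - x $ i - (\<Sum>j\<in>UNIV. K i j r \<omega>)) \<in> borel_measurable (F r)"
        by (intro borel_measurable_diff borel_measurable_sum borel_measurable_const)
      show "AE \<omega> in M. X r \<omega> $ i - x $ i - (\<Sum>j\<in>UNIV. K i j r \<omega>) = (LBINT s:{0..r}. f s (X s \<omega>) $ i)"
        using Xeq[of i] by eventually_elim (use r in simp)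
    qed simp
    have "(\<lambda>\<omega>. x $ l + (\<Sum>i\<in>UNIV. LBINT s:{0..t}. V l i s \<omega> * f s (X s \<omega>) $ i)) \<in> borel_measurable (F t)"
      by (intro borel_measurable_add borel_measurable_const borel_measurable_sum measurable_stieltjes_integral[OF V t fi fm])
    then show "N l t \<in> borel_measurable (F t)"
    proof (rule measurable_F_AE_eq[OF t])
      show "AE \<omega> in M. x $ l + (\<Sum>i\<in>UNIV. LBINT s:{0..t}. V l i s \<omega> * f s (X s \<omega>) $ i) = N l t \<omega>"
        using nint by eventually_elim (use t in \<open>simp add: N_def\<close>)
    qed simp
  next
    show "AE \<omega> in M. continuous_on {0..} (\<lambda>t. N l t \<omega>)"
      using nint
    proof eventually_elim
      case (elim \<omega>)
      then show ?case unfolding N_def by (intro continuous_intros continuous_on_set_integral) blast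
    qed
  qed
  have n: "AE \<omega> in M. \<forall>l. \<forall>t\<ge>0. set_integrable lborel {0..t} (\<lambda>s. n l s \<omega>) \<and> N l t \<omega> = x $ l + (LBINT s:{0..t}. n l s \<omega>)"
    using nint by eventually_elim (simp add: N_def)
  define Z where "Z i j t \<omega> = (\<Sum>l\<in>UNIV. N l t \<omega> * I i j l t \<omega> - (LBINT s:{0..t}. I i j l s \<omega> * n l s \<omega>))" for i j t \<omega>
  note P = drift_product[OF U Chmv Na n, folded Z_def]
  define Nv where "Nv t \<omega> = (\<chi> l. N l t \<omega>)" for t \<omega>
  have Nva: "adapted_continuous M F Nv"
  proof (rule adapted_continuous_vec)
    fix t :: real and e :: "real^'n" assume t: "0 \<le> t" and "e \<in> Basis"
    then obtain l where e: "e = axis l 1" by (auto simp: Basis_vec_def)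
    have "N l t \<in> borel_measurable (F t)" using Na[of l] t by (simp add: adapted_continuous_def)
    then show "(\<lambda>\<omega>. Nv t \<omega> \<bullet> e) \<in> borel_measurable (F t)" by (simp add: e inner_axis Nv_def)
  next
    have "AE \<omega> in M. \<forall>l. continuous_on {0..} (\<lambda>t. N l t \<omega>)"
      unfolding AE_all_countable using Na by (simp add: adapted_continuous_def)
    then show "AE \<omega> in M. continuous_on {0..} (\<lambda>t. Nv t \<omega>)"
      unfolding Nv_def by eventually_elim (intro continuous_on_vec_lambda, blast)
  qed
  have Ppos: "(\<Sum>l\<in>UNIV. U t \<omega> $ i $ l * N l t \<omega>) = (U t \<omega> *v Nv t \<omega>) $ i" for t \<omega> i
    by (simp add: Nv_def matrix_vector_mult_def)
  \<comment> \<open>Both terms have initial value \<open>x\<close> and drift \<open>f\<close>, so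
    only the noise is left, and it is linear in the difference.\<close>
  define D where "D t \<omega> = X t \<omega> - U t \<omega> *v Nv t \<omega>" for t \<omega>
  have UNa: "adapted_continuous M F (\<lambda>t \<omega>. U t \<omega> *v Nv t \<omega>)"
    by (rule adapted_continuous_matrix_vector[OF Ua Nva])
  have Da: "adapted_continuous M F D"
    unfolding adapted_continuous_def D_def
  proof (intro conjI allI impI)
    show "(\<lambda>\<omega>. X t \<omega> - U t \<omega> *v Nv t \<omega>) \<in> borel_measurable (F t)" if "0 \<le> t" for t
      using Xa UNa that by (intro borel_measurable_diff) (simp_all add: adapted_continuous_def)
    have "AE \<omega> in M. continuous_on {0..} (\<lambda>t. X t \<omega>)" "AE \<omega> in M. continuous_on {0..} (\<lambda>t. U t \<omega> *v Nv t \<omega>)"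
      using Xa UNa by (auto simp: adapted_continuous_def)
    then show "AE \<omega> in M. continuous_on {0..} (\<lambda>t. X t \<omega> - U t \<omega> *v Nv t \<omega>)"
      by eventually_elim (intro continuous_on_diff)
  qed
  have DI: "ito j (\<lambda>s \<omega>. C s $ i $ j * D s \<omega> $ j) (\<lambda>t \<omega>. K i j t \<omega> - Z i j t \<omega>)" for i j
    using ito_diff[OF KI[of j i] P(1)[of j i]] by (simp add: D_def Ppos right_diff_distrib)
  \<comment> \<open>The factor \<open>U\<close> cancels the inverse contained in \<open>n\<close>,
    at every time where \<open>U\<close> is nonsingular.\<close>
  have Un: "(\<Sum>l\<in>UNIV. U s \<omega> $ i $ l * n l s \<omega>) = f s (X s \<omega>) $ i" if d: "det (U s \<omega>) \<noteq> 0" for s \<omega> i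
  proof -
    have 1: "U s \<omega> *v (cramer_inverse (U s \<omega>) *v f s (X s \<omega>)) = f s (X s \<omega>)"
      using d by (simp add: matrix_vector_mul_assoc matrix_mult_cramer_inverse)
    have 2: "(cramer_inverse (U s \<omega>) *v f s (X s \<omega>)) $ l = n l s \<omega>" for l
      by (simp add: n_def V_def matrix_vector_mult_def)
    show ?thesis
      unfolding arg_cong[OF 1, of "\<lambda>w. w $ i", symmetric] 2[symmetric]
      unfolding matrix_vector_mult_def[of "U s \<omega>"] by simp
  qed
  have Deq: "AE \<omega> in M. \<forall>t\<ge>0. \<forall>i. D t \<omega> $ i = (\<Sum>j\<in>UNIV. K i j t \<omega> - Z i j t \<omega>)"
  proof -
    have "AE \<omega> in M. \<forall>i. \<forall>t\<ge>0. X t \<omega> $ i = x $ i + (LBINT s:{0..t}. f s (X s \<omega>) $ i) + (\<Sum>j\<in>UNIV. K i j t \<omega>)"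
      unfolding AE_all_countable using Xeq by blast
    then show ?thesis using P(2) Ud
    proof eventually_elim
      case (elim \<omega>)
      show ?case
      proof (intro allI impI)
        fix t :: real and i assume t: "0 \<le> t"
        have "(LBINT s:{0..t}. \<Sum>l\<in>UNIV. U s \<omega> $ i $ l * n l s \<omega>) = (LBINT s:{0..t}. f s (X s \<omega>) $ i)"
          by (rule set_integral_cong_Icc(2)) (use elim(3) Un in blast)
        then have "(U t \<omega> *v Nv t \<omega>) $ i = x $ i + (LBINT s:{0..t}. f s (X s \<omega>) $ i) + (\<Sum>j\<in>UNIV. Z i j t \<omega>)"
          using elim(2)[rule_format, OF t, of i] by (simp add: Ppos)
        then show "D t \<omega> $ i = (\<Sum>j\<in>UNIV. K i j t \<omega> - Z i j t \<omega>)"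
          using elim(1)[rule_format, OF t, of i] by (simp add: D_def sum_subtractf)
      qed
    qed
  qed
  have "AE \<omega> in M. \<forall>t\<ge>0. D t \<omega> = 0"
    by (rule homogeneous_linear_sde_zero[OF Csq U Da DI Deq])
  then show ?thesis using nint Ud
  proof eventually_elim
    case (elim \<omega>)
    show ?case
    proof (intro allI impI)
      fix t :: real assume t: "0 \<le> t"
      have comp: "(matrix_inv (U s \<omega>) *v f s (X s \<omega>)) $ l = n l s \<omega>" if "0 \<le> s" for s l
        using elim(3) that
        by (simp add: matrix_inv_eq_cramer_inverse invertible_det_nz n_def V_def matrix_vector_mult_def)
      have ni: "set_integrable lborel {0..t} (\<lambda>s. n l s \<omega>)" for l using elim(2) t by blast
      have i: "set_integrable lborel {0..t} (\<lambda>s. matrix_inv (U s \<omega>) *v f s (X s \<omega>))"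
        unfolding set_integral_vec(1)
      proof
        fix l
        show "set_integrable lborel {0..t} (\<lambda>s. (matrix_inv (U s \<omega>) *v f s (X s \<omega>)) $ l)"
          by (subst set_integral_cong_Icc(1)[where h="\<lambda>s. n l s \<omega>"]) (use comp ni in auto)
      qed
      have "x + (LBINT s:{0..t}. matrix_inv (U s \<omega>) *v f s (X s \<omega>)) = Nv t \<omega>"
        unfolding vec_eq_iff
      proof
        fix l
        have "(LBINT s:{0..t}. (matrix_inv (U s \<omega>) *v f s (X s \<omega>)) $ l) = (LBINT s:{0..t}. n l s \<omega>)"
          by (rule set_integral_cong_Icc(2)) (rule comp)
        then show "(x + (LBINT s:{0..t}. matrix_inv (U s \<omega>) *v f s (X s \<omega>))) $ l = Nv t \<omega> $ l"
          by (simp add: Nv_def N_def set_integral_vec(2)[OF i])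
      qed
      moreover have "X t \<omega> = U t \<omega> *v Nv t \<omega>" using elim(1) t by (simp add: D_def)
      ultimately show "set_integrable lborel {0..t} (\<lambda>s. matrix_inv (U s \<omega>) *v f s (X s \<omega>)) \<and>
        X t \<omega> = U t \<omega> *v (x + (LBINT s:{0..t}. matrix_inv (U s \<omega>) *v f s (X s \<omega>)))"
        using i by simp
    qed
  qed
qed

lemma solution_formula_imp_random_de:
  fixes U :: "real \<Rightarrow> 'a \<Rightarrow> real^'n^'n"
  assumes Ud: "AE \<omega> in M. \<forall>t\<ge>0. det (U t \<omega>) \<noteq> 0"
    and X: "AE \<omega> in M. \<forall>t\<ge>0.
      set_integrable lborel {0..t} (\<lambda>s. matrix_inv (U s \<omega>) *v f s (X s \<omega>)) \<and>
      X t \<omega> = U t \<omega> *v (x + (LBINT s:{0..t}. matrix_inv (U s \<omega>) *v f s (X s \<omega>)))"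
  shows "satisfies_random_de M U f x (\<lambda>t \<omega>. matrix_inv (U t \<omega>) *v X t \<omega>)"
  unfolding satisfies_random_de_def
  using Ud X
proof eventually_elim
  case (elim \<omega>)
  have inv: "U s \<omega> ** matrix_inv (U s \<omega>) = mat 1" "matrix_inv (U s \<omega>) ** U s \<omega> = mat 1" if "0 \<le> s" for s
  proof -
    show "U s \<omega> ** matrix_inv (U s \<omega>) = mat 1"
      using elim(1) that by (simp add: matrix_inv_eq_cramer_inverse invertible_det_nz matrix_mult_cramer_inverse)
    then show "matrix_inv (U s \<omega>) ** U s \<omega> = mat 1" by (simp add: matrix_left_right_inverse)
  qed
  have eq: "matrix_inv (U s \<omega>) *v f s (U s \<omega> *v (matrix_inv (U s \<omega>) *v X s \<omega>)) = matrix_inv (U s \<omega>) *v f s (X s \<omega>)"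
    if "0 \<le> s" for s
    using inv(1)[OF that] by (simp add: matrix_vector_mul_assoc)
  show ?case
  proof (intro allI impI)
    fix t :: real assume t: "0 \<le> t"
    have i: "set_integrable lborel {0..t} (\<lambda>s. matrix_inv (U s \<omega>) *v f s (X s \<omega>))"
      and Xt: "X t \<omega> = U t \<omega> *v (x + (LBINT s:{0..t}. matrix_inv (U s \<omega>) *v f s (X s \<omega>)))"
      using elim(2) t by auto
    have "set_integrable lborel {0..t} (\<lambda>s. matrix_inv (U s \<omega>) *v f s (U s \<omega> *v (matrix_inv (U s \<omega>) *v X s \<omega>)))"
      by (subst set_integral_cong_Icc(1)[OF eq]) (use i in auto)
    moreover have "(LBINT s:{0..t}. matrix_inv (U s \<omega>) *v f s (U s \<omega> *v (matrix_inv (U s \<omega>) *v X s \<omega>))) =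
        (LBINT s:{0..t}. matrix_inv (U s \<omega>) *v f s (X s \<omega>))"
      by (rule set_integral_cong_Icc(2)) (rule eq)
    moreover have "matrix_inv (U t \<omega>) *v X t \<omega> = x + (LBINT s:{0..t}. matrix_inv (U s \<omega>) *v f s (X s \<omega>))"
      by (subst Xt) (simp only: matrix_vector_mul_assoc inv(2)[OF t] matrix_vector_mul_lid)
    ultimately show "set_integrable lborel {0..t} (\<lambda>s. matrix_inv (U s \<omega>) *v f s (U s \<omega> *v (matrix_inv (U s \<omega>) *v X s \<omega>))) \<and>
      matrix_inv (U t \<omega>) *v X t \<omega> = x + (LBINT s:{0..t}. matrix_inv (U s \<omega>) *v f s (U s \<omega> *v (matrix_inv (U s \<omega>) *v X s \<omega>)))"
      by simp
  qed
qed

end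

theorem mainTheorem2:
  fixes M :: "'a measure" and F :: "real \<Rightarrow> 'a measure"
    and B :: "real \<Rightarrow> 'a \<Rightarrow> real ^ 'n"
    and C :: "real \<Rightarrow> real ^ 'n ^ 'n"
    and f :: "real \<Rightarrow> real ^ 'n \<Rightarrow> real ^ 'n"
    and x :: "real ^ 'n"
    and U :: "real \<Rightarrow> 'a \<Rightarrow> real ^ 'n ^ 'n"
  assumes "brownian_motion M F B"
    and "C \<in> borel_measurable (restrict_space borel {0..})"
    and "\<And>i j t. 0 \<le> t \<Longrightarrow> set_integrable lborel {0..t} (\<lambda>s. (C s $ i $ j)\<^sup>2)"
    and "(\<lambda>(t, v). f t v) \<in> borel_measurable (restrict_space borel ({0..} \<times> UNIV))"
    and "solves_linear_matrix_sde M F B C U"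
  shows "(\<forall>X. solves_sde M F B C f x X \<longrightarrow>
            (AE \<omega> in M. \<forall>t\<ge>0.
               set_integrable lborel {0..t} (\<lambda>s. matrix_inv (U s \<omega>) *v f s (X s \<omega>)) \<and>
               X t \<omega> = U t \<omega> *v (x + (LBINT s:{0..t}. matrix_inv (U s \<omega>) *v f s (X s \<omega>)))) \<and>
            satisfies_random_de M U f x (\<lambda>t \<omega>. matrix_inv (U t \<omega>) *v X t \<omega>)) \<and>
         (\<forall>Y. adapted_continuous M F Y \<longrightarrow> satisfies_random_de M U f x Y \<longrightarrow>
            solves_sde M F B C f x (\<lambda>t \<omega>. U t \<omega> *v Y t \<omega>))"
proof -
  interpret brownian_motion M F B by fact
  have Chmv: "has_measurable_version M (\<lambda>s \<omega>. C s $ i $ j)" for i j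
    by (intro has_measurable_version_deterministic borel_measurable_matrix_entry assms(2))
  have Csq: "sq_int t (\<lambda>s. C s $ i $ j)" if "0 \<le> t" for i j t
    by (rule sq_int_entry[OF assms(2,3)]) (use that in auto)
  obtain I where U: "fundamental_matrix C U I"
    using fundamental_matrix_exists[OF Chmv assms(5)] by blast
  have Ud: "AE \<omega> in M. \<forall>t\<ge>0. det (U t \<omega>) \<noteq> 0"
    by (rule fundamental_matrix_invertible[OF Csq U])
  show ?thesis
  proof (intro conjI allI impI)
    fix X assume X: "solves_sde M F B C f x X"
    show formula: "AE \<omega> in M. \<forall>t\<ge>0.
      set_integrable lborel {0..t} (\<lambda>s. matrix_inv (U s \<omega>) *v f s (X s \<omega>)) \<and>
      X t \<omega> = U t \<omega> *v (x + (LBINT s:{0..t}. matrix_inv (U s \<omega>) *v f s (X s \<omega>)))"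
      by (rule sde_solution_formula[OF Chmv Csq U X])
    show "satisfies_random_de M U f x (\<lambda>t \<omega>. matrix_inv (U t \<omega>) *v X t \<omega>)"
      by (rule solution_formula_imp_random_de[OF Ud formula])
  next
    fix Y assume Y: "adapted_continuous M F Y" "satisfies_random_de M U f x Y"
    show "solves_sde M F B C f x (\<lambda>t \<omega>. U t \<omega> *v Y t \<omega>)"
      by (rule random_de_imp_sde[OF Chmv Csq U Y])
  qed
qed

end
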